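(* If $p<\frac{1}{b}$, then $$\lim_{n\to\infty}\frac{1}{\log n}\max_{0\le i\le n}|X_i|=\frac{1}{\log[1/(qb)]},\qquad \mathbb{P}\text{-a.s.},$$ where the constant $q$ (defined in the context) lies in $(0,\frac1b)$ when $p<\frac1b$.
   Context: Tree. Let $b\ge 2$ be an integer and let $\mathbb{T}$ be the infinite $b$-ary tree rooted at $e$: every vertex has exactly $b$ children, and every vertex $x\ne e$ has one parent, denoted $\overleftarrow{x}$ (the first vertex after $x$ on the shortest path from $x$ to $e$). $|x|$ is the number of edges on the shortest path from $x$ to $e$ ($|e|=0$). For $|x|\ge 2$, $\overset{\Leftarrow}{x}$ denotes the parent of $\overleftarrow{x}$. The children of $x$ are denoted $x_1,\dots,x_b$. Environment. $\omega=(\omega(x,y),\,x,y\in\mathbb{T})$ is a family of non-negative random variables with $\sum_{y}\omega(x,y)=1$ for each $x$; its law is $\mathbf{P}$, with expectation $\mathbf{E}$. For $|x|\ge 2$ put $$A(x):=\frac{\omega(\overleftarrow{x},x)}{\omega(\overleftarrow{x},\overset{\Leftarrow}{x})}.$$ Standing assumptions: the random vectors $(\omega(x,\bullet))_{x\in\mathbb{T}\setminus\{e\}}$ (the transition probabilities from $x$ to its parent and to its $b$ ordered children) are i.i.d. and non-degenerate; the variables $A(x)$, $|x|\ge2$, are identically distributed; there is $\varepsilon_0>0$ such that $\omega(x,y)\ge\varepsilon_0$ if $x=\overleftarrow{y}$ or $y=\overleftarrow{x}$, and $\omega(x,y)=0$ otherwise. $A$ denotes a generic random variable with the common law of the $A(x)$.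 Walk. Given $\omega$, $(X_n)_{n\ge0}$ is the Markov chain on $\mathbb{T}$ with $X_0=e$ and $P_\omega(X_{n+1}=y\mid X_n=x)=\omega(x,y)$. The annealed law is $\mathbb{P}(\cdot):=\int P_\omega(\cdot)\,\mathbf{P}(d\omega)$. Constants. $p:=\inf_{t\in[0,1]}\mathbf{E}(A^t)$. For $r>0$, $\varrho(r):=\inf_{t\ge0}\{r^{-t}\,\mathbf{E}(A^t)\}$. $\underline{r}>0$ is defined by $\log\underline{r}=\mathbf{E}(\log A)$, and $\overline{r}:=\inf\{r>0:\varrho(r)\le\frac1b\}$ (one has $\underline r<\overline r$). Finally $q:=\sup_{r\in[\underline{r},\overline{r}]}r\,\varrho(r)$. *)

theory Defs
  imports "HOL-Probability.Probability"
begin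

text \<open>
  A vertex of the \<open>b\<close>-ary tree is a list over a finite type \<open>'b\<close> with \<open>b = CARD('b)\<close>. The list is
  read from the vertex towards the root: the root is \<open>[]\<close>, the children of \<open>x\<close> are the \<open>b\<close>
  vertices \<open>i # x\<close>, the parent of \<open>x \<noteq> []\<close> is \<open>tl x\<close>, and \<open>\<bar>x\<bar>\<close> is \<open>length x\<close>. So every list
  over \<open>'b\<close> is a vertex, and a child is identified by its label \<open>i\<close>.
\<close>

definition tree_adj :: "'b list \<Rightarrow> 'b list \<Rightarrow> bool" where
  "tree_adj x y \<longleftrightarrow> (x \<noteq> [] \<and> y = tl x) \<or> (y \<noteq> [] \<and> x = tl y)"

text \<open>The vector \<open>\<omega>(x, \<bullet>)\<close> for \<open>x \<noteq> []\<close>: entry \<open>None\<close> is the parent, entry \<open>Some i\<close> the child \<open>i # x\<close>.\<close>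

definition omega_vec :: "('b list \<Rightarrow> 'b list \<Rightarrow> real) \<Rightarrow> 'b list \<Rightarrow> 'b option \<Rightarrow> real" where
  "omega_vec \<omega> x k = (case k of None \<Rightarrow> \<omega> x (tl x) | Some i \<Rightarrow> \<omega> x (i # x))"

definition A_ratio :: "('b list \<Rightarrow> 'b list \<Rightarrow> real) \<Rightarrow> 'b list \<Rightarrow> real" where
  "A_ratio \<omega> x = \<omega> (tl x) x / \<omega> (tl x) (tl (tl x))"

locale random_environment = prob_space M
  for M :: "'w measure" and \<omega> :: "'w \<Rightarrow> 'b::finite list \<Rightarrow> 'b list \<Rightarrow> real" +
  assumes branching: "CARD('b) \<ge> 2"
    and omega_measurable: "\<And>x y. (\<lambda>w. \<omega> w x y) \<in> borel_measurable M"
    and omega_nonneg: "\<And>w x y. w \<in> space M \<Longrightarrow> 0 \<le> \<omega> w x y"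
    and omega_sum: "\<And>w x. w \<in> space M \<Longrightarrow> (\<omega> w x has_sum 1) UNIV"
    and omega_indep:
      "indep_vars (\<lambda>_. PiM UNIV (\<lambda>_. borel)) (\<lambda>x w. omega_vec (\<omega> w) x) (UNIV - {[]})"
    and omega_ident: "\<And>x y. x \<noteq> [] \<Longrightarrow> y \<noteq> [] \<Longrightarrow>
      distr M (PiM UNIV (\<lambda>_. borel)) (\<lambda>w. omega_vec (\<omega> w) x) =
      distr M (PiM UNIV (\<lambda>_. borel)) (\<lambda>w. omega_vec (\<omega> w) y)"
    and omega_nondegenerate: "\<And>x. x \<noteq> [] \<Longrightarrow> \<not> (\<exists>v. AE w in M. omega_vec (\<omega> w) x = v)"
    and A_ident: "\<And>x y. length x \<ge> 2 \<Longrightarrow> length y \<ge> 2 \<Longrightarrow>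
      distr M borel (\<lambda>w. A_ratio (\<omega> w) x) = distr M borel (\<lambda>w. A_ratio (\<omega> w) y)"
    and omega_elliptic: "\<exists>\<epsilon>0>0. AE w in M. \<forall>x y.
      (tree_adj x y \<longrightarrow> \<epsilon>0 \<le> \<omega> w x y) \<and> (\<not> tree_adj x y \<longrightarrow> \<omega> w x y = 0)"

text \<open>
  The law on path space of the Markov chain with transition probabilities \<open>\<omega>\<close> started at the
  root, by the Ionescu-Tulcea theorem; \<open>prob_quenched_path\<close> below is its characteristic property.
\<close>

definition walk_step :: "('b list \<Rightarrow> 'b list \<Rightarrow> real) \<Rightarrow> nat \<Rightarrow> (nat \<Rightarrow> 'b list) \<Rightarrow> 'b list pmf" where
  "walk_step \<omega> n h = (case n of 0 \<Rightarrow> return_pmf [] | Suc m \<Rightarrow> embed_pmf (\<omega> (h m)))"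

definition path_space :: "(nat \<Rightarrow> 'b list) measure" where
  "path_space = PiM UNIV (\<lambda>_. count_space UNIV)"

definition quenched_law :: "('b::finite list \<Rightarrow> 'b list \<Rightarrow> real) \<Rightarrow> (nat \<Rightarrow> 'b list) measure" where
  "quenched_law \<omega> = projective_family.lim UNIV
     (Ionescu_Tulcea.CI (\<lambda>n h. measure_pmf (walk_step \<omega> n h)) (\<lambda>_. count_space UNIV))
     (\<lambda>_. count_space UNIV)"

definition annealed_law ::
    "'w measure \<Rightarrow> ('w \<Rightarrow> 'b::finite list \<Rightarrow> 'b list \<Rightarrow> real) \<Rightarrow> (nat \<Rightarrow> 'b list) measure" where
  "annealed_law M \<omega> = M \<bind> (\<lambda>w. quenched_law (\<omega> w))"

text \<open>The constants, as functions of the law \<open>\<mu>\<close> of \<open>A\<close> and of \<open>b\<close>.\<close>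

definition moment :: "real measure \<Rightarrow> real \<Rightarrow> real" where
  "moment \<mu> t = (\<integral>a. a powr t \<partial>\<mu>)"

definition p_const :: "real measure \<Rightarrow> real" where
  "p_const \<mu> = (INF t\<in>{0..1}. moment \<mu> t)"

definition varrho :: "real measure \<Rightarrow> real \<Rightarrow> real" where
  "varrho \<mu> r = (INF t\<in>{0..}. r powr (- t) * moment \<mu> t)"

definition r_lower :: "real measure \<Rightarrow> real" where
  "r_lower \<mu> = exp (\<integral>a. ln a \<partial>\<mu>)"

definition r_upper :: "real measure \<Rightarrow> nat \<Rightarrow> real" where
  "r_upper \<mu> b = Inf {r. r > 0 \<and> varrho \<mu> r \<le> 1 / real b}"

definition q_const :: "real measure \<Rightarrow> nat \<Rightarrow> real" where
  "q_const \<mu> b = (SUP r\<in>{r_lower \<mu>..r_upper \<mu> b}. r * varrho \<mu> r)"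

subsection \<open>The quenched and annealed laws are as intended\<close>

lemma Ionescu_Tulcea_walk:
  "Ionescu_Tulcea (\<lambda>n h. measure_pmf (walk_step \<omega> n (h :: nat \<Rightarrow> 'b::finite list))) (\<lambda>_. count_space UNIV)"
proof
  show "(\<lambda>h. measure_pmf (walk_step \<omega> n h)) \<in>
      PiM {0..<n} (\<lambda>_. count_space UNIV) \<rightarrow>\<^sub>M subprob_algebra (count_space UNIV)" for n
  proof (cases n)
    case 0
    then show ?thesis
      by (simp add: walk_step_def measure_pmf_in_subprob_algebra)
  next
    case (Suc m)
    have "(\<lambda>h. h m) \<in> PiM {0..<n} (\<lambda>_. count_space UNIV :: 'b list measure) \<rightarrow>\<^sub>M count_space UNIV"
      using Suc by (intro measurable_component_singleton) auto
    moreover have "(\<lambda>x. measure_pmf (embed_pmf (\<omega> x))) \<in>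
        (count_space UNIV :: 'b list measure) \<rightarrow>\<^sub>M subprob_algebra (count_space UNIV)"
      by (simp add: measure_pmf_in_subprob_algebra)
    ultimately have "(\<lambda>h. measure_pmf (embed_pmf (\<omega> (h m)))) \<in>
        PiM {0..<n} (\<lambda>_. count_space UNIV :: 'b list measure) \<rightarrow>\<^sub>M subprob_algebra (count_space UNIV)"
      by (rule measurable_compose)
    then show ?thesis
      by (simp add: Suc walk_step_def)
  qed
qed

lemma quenched_law_cylinder:
  fixes \<omega> :: "'b::finite list \<Rightarrow> 'b list \<Rightarrow> real"
  shows "emeasure (quenched_law \<omega>) {X. \<forall>k<n. X k = xs k} = (\<Prod>k<n. pmf (walk_step \<omega> k xs) (xs k))"
    and "sets (quenched_law \<omega>) = sets path_space"
proof -
  let ?M = "\<lambda>_::nat. count_space UNIV :: 'b list measure"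
  let ?u = "\<lambda>_::nat. undefined :: 'b list"
  interpret IT: Ionescu_Tulcea "\<lambda>n h. measure_pmf (walk_step \<omega> n h)" ?M
    by (rule Ionescu_Tulcea_walk)
  have lim: "quenched_law \<omega> = IT.PF.lim"
    by (simp add: quenched_law_def)
  show "sets (quenched_law \<omega>) = sets path_space"
    unfolding lim path_space_def by (rule IT.PF.sets_lim)
  have u: "?u \<in> space (PiM {0..<0} ?M)"
    by (simp add: space_PiM)
  have single: "{restrict xs {0..<n}} \<in> sets (PiM {0..<n} ?M)" for n
  proof -
    have "{restrict xs {0..<n}} = PiE {0..<n} (\<lambda>k. {xs k})"
      by (auto simp: PiE_iff extensional_def restrict_def)
    then show ?thesis
      by (simp only:) (intro sets_PiM_I_finite; simp)
  qed
  have C: "emeasure (IT.C 0 n ?u) {restrict xs {0..<n}} = (\<Prod>k<n. pmf (walk_step \<omega> k xs) (xs k))" for n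
  proof (induction n)
    case 0
    then show ?case
      by (simp add: PiM_empty restrict_def)
  next
    case (Suc n)
    have step: "emeasure (IT.eP n h) {restrict xs {0..<Suc n}} =
        ennreal (pmf (walk_step \<omega> n xs) (xs n)) * indicator {restrict xs {0..<n}} h"
      if h: "h \<in> space (PiM {0..<n} ?M)" for h
    proof -
      have ext: "h \<in> extensional {0..<n}"
        using h by (simp add: space_PiM PiE_iff)
      have eq: "h(n := x) = restrict xs {0..<Suc n} \<longleftrightarrow> h = restrict xs {0..<n} \<and> x = xs n" for x
        using ext by (auto simp: fun_eq_iff extensional_def restrict_def split: if_splits)
      have "(\<lambda>x. h(n := x)) -` {restrict xs {0..<Suc n}} \<inter> space (count_space UNIV) =
          (if h = restrict xs {0..<n} then {xs n} else {})"
        unfolding vimage_def by (auto simp: eq simp del: fun_upd_apply)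
      moreover have "walk_step \<omega> n h = walk_step \<omega> n xs" if "h = restrict xs {0..<n}"
        using that by (auto simp: walk_step_def split: nat.split)
      ultimately show ?thesis
        by (subst IT.emeasure_eP[OF h single]) (auto simp: emeasure_pmf_single)
    qed
    have "emeasure (IT.C 0 (Suc n) ?u) {restrict xs {0..<Suc n}} =
        (\<integral>\<^sup>+h. emeasure (IT.eP n h) {restrict xs {0..<Suc n}} \<partial>IT.C 0 n ?u)"
    proof (simp del: IT.space_C, rule emeasure_bind)
      show "space (IT.C 0 n ?u) \<noteq> {}"
        using IT.prob_space_C[OF u] by (rule prob_space.not_empty)
      show "IT.eP n \<in> IT.C 0 n ?u \<rightarrow>\<^sub>M subprob_algebra (PiM {0..<Suc n} ?M)"
        using IT.measurable_eP[of n] IT.sets_C[OF u, of n] by (simp cong: measurable_cong_sets)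
    qed (rule single)
    also have "\<dots> = (\<integral>\<^sup>+h. ennreal (pmf (walk_step \<omega> n xs) (xs n)) * indicator {restrict xs {0..<n}} h \<partial>IT.C 0 n ?u)"
      using IT.space_C[OF u, of n] by (intro nn_integral_cong step) simp
    also have "\<dots> = ennreal (pmf (walk_step \<omega> n xs) (xs n)) * emeasure (IT.C 0 n ?u) {restrict xs {0..<n}}"
      using single[of n] IT.sets_C[OF u, of n] by (intro nn_integral_cmult_indicator) simp
    also have "\<dots> = ennreal (\<Prod>k<Suc n. pmf (walk_step \<omega> k xs) (xs k))"
      unfolding Suc.IH by (simp add: ennreal_mult prod_nonneg mult.commute)
    finally show ?case .
  qed
  have "{X. \<forall>k<n. X k = xs k} = IT.PF.emb UNIV {0..<n} {restrict xs {0..<n}}"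
    by (auto simp: prod_emb_def space_PiM fun_eq_iff restrict_def PiE_iff split: if_splits)
  moreover have "emeasure IT.PF.lim (IT.PF.emb UNIV {0..<n} {restrict xs {0..<n}}) =
      emeasure (IT.C 0 n ?u) (IT.PF.emb {0..<n} {0..<n} {restrict xs {0..<n}})"
    using IT.lim[OF finite_atLeastLessThan single] IT.emeasure_CI[OF order_refl single] by simp
  moreover have "IT.PF.emb {0..<n} {0..<n} {restrict xs {0..<n}} = {restrict xs {0..<n}}"
    using sets.sets_into_space[OF single[of n]] by (intro prod_emb_id) (auto simp: space_PiM)
  ultimately show "emeasure (quenched_law \<omega>) {X. \<forall>k<n. X k = xs k} = (\<Prod>k<n. pmf (walk_step \<omega> k xs) (xs k))"
    using C[of n] lim by simp
qed

lemma prob_space_quenched_law: "prob_space (quenched_law \<omega>)"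
proof (rule prob_spaceI)
  have "space (quenched_law \<omega>) = UNIV"
    using sets_eq_imp_space_eq[OF quenched_law_cylinder(2)[of \<omega>]] by (simp add: path_space_def space_PiM)
  then show "emeasure (quenched_law \<omega>) (space (quenched_law \<omega>)) = 1"
    using quenched_law_cylinder(1)[of \<omega> 0] by simp
qed

lemma sets_path_space:
  "sets path_space = sigma_sets UNIV (insert {} (range (\<lambda>(n::nat, xs). {X. \<forall>k<n. X k = (xs k :: 'b::finite list)})))"
    (is "_ = sigma_sets _ ?G")
proof (rule antisym)
  have P: "sets (path_space :: (nat \<Rightarrow> 'b list) measure) = sigma_sets UNIV {{f. f i \<in> A} |i A. True}"
    unfolding path_space_def by (subst sets_PiM_single) simp
  show "sets path_space \<subseteq> sigma_sets UNIV ?G"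
    unfolding P
  proof (rule sigma_sets_mono, safe)
    fix i and A :: "'b list set"
    have eq: "{f. f i \<in> A} = (\<Union>l. if l ! i \<in> A then {X. \<forall>k<Suc i. X k = l ! k} else {})" (is "?L = ?R")
    proof
      show "?L \<subseteq> ?R"
      proof
        fix f assume "f \<in> ?L"
        then show "f \<in> ?R"
          by (intro UN_I[of "map f [0..<Suc i]"]) (auto simp: nth_append nth_map simp del: upt_Suc)
      qed
    qed (auto split: if_splits)
    have "{X. \<forall>k<Suc i. X k = l ! k} \<in> ?G" for l :: "'b list list"
      by (rule insertI2, rule image_eqI[of _ _ "(Suc i, \<lambda>k. l ! k)"]) auto
    then show "{f. f i \<in> A} \<in> sigma_sets UNIV ?G"
      unfolding eq
      by (intro sigma_sets_UNION)
         (auto intro!: sigma_sets.Basic sigma_sets.Empty countable_image uncountable_def)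
  qed
  have "?G \<subseteq> sets path_space"
  proof -
    have "{X. \<forall>k<n. X k = xs k} \<in> sets path_space" for n and xs :: "nat \<Rightarrow> 'b list"
    proof -
      have "{X \<in> space path_space. \<forall>k\<in>{..<n}. X k = xs k} \<in> sets path_space"
        unfolding path_space_def by measurable
      then show ?thesis
        by (simp add: path_space_def space_PiM Ball_def)
    qed
    then show ?thesis
      by auto
  qed
  then show "sigma_sets UNIV ?G \<subseteq> sets path_space"
    using sets.sigma_sets_subset[of ?G path_space] by (simp add: path_space_def space_PiM)
qed

context random_environment
begin

lemma pmf_walk_step:
  assumes "w \<in> space M"
  shows "pmf (walk_step (\<omega> w) 0 h) x = of_bool (x = [])"
    and "pmf (walk_step (\<omega> w) (Suc m) h) x = \<omega> w (h m) x"
proof -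
  show "pmf (walk_step (\<omega> w) 0 h) x = of_bool (x = [])"
    by (simp add: walk_step_def)
  have "(\<omega> w (h m)) summable_on UNIV" "infsum (\<omega> w (h m)) UNIV = 1"
    using omega_sum[OF assms, of "h m"] by (auto simp: has_sum_imp_summable infsumI)
  then have "(\<integral>\<^sup>+y. ennreal (\<omega> w (h m) y) \<partial>count_space UNIV) = 1"
    using nn_integral_conv_infsetsum[of "\<omega> w (h m)" UNIV] omega_nonneg[OF assms]
      infsetsum_infsum[of "\<omega> w (h m)" UNIV] abs_summable_equivalent[of "\<omega> w (h m)" UNIV]
    by simp
  then show "pmf (walk_step (\<omega> w) (Suc m) h) x = \<omega> w (h m) x"
    unfolding walk_step_def by (simp add: pmf_embed_pmf omega_nonneg[OF assms])
qed

lemma prob_quenched_path: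
  assumes "w \<in> space M"
  shows "emeasure (quenched_law (\<omega> w)) {X. \<forall>k\<le>n. X k = xs k} =
    ennreal (of_bool (xs 0 = []) * (\<Prod>k<n. \<omega> w (xs k) (xs (Suc k))))"
proof -
  have "{X. \<forall>k\<le>n. X k = xs k} = {X. \<forall>k<Suc n. X k = xs k}"
    by (simp add: less_Suc_eq_le)
  then show ?thesis
    by (simp add: quenched_law_cylinder(1) prod.lessThan_Suc_shift pmf_walk_step[OF assms] del: prod.lessThan_Suc)
qed

lemma quenched_law_measurable: "(\<lambda>w. quenched_law (\<omega> w)) \<in> M \<rightarrow>\<^sub>M prob_algebra path_space"
proof (rule measurable_prob_algebra_generated[OF sets_path_space])
  show "Int_stable (insert {} (range (\<lambda>(n::nat, xs). {X. \<forall>k<n. X k = (xs k :: 'b list)})))"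
  proof (rule Int_stableI)
    let ?cyl = "\<lambda>(n::nat) xs. {X. \<forall>k<n. X k = (xs k :: 'b list)}"
    have *: "?cyl n xs \<inter> ?cyl m ys = {} \<or> ?cyl n xs \<inter> ?cyl m ys = ?cyl m ys" if "n \<le> m" for n m xs ys
    proof (cases "\<forall>k<n. xs k = ys k")
      case True
      then have "?cyl m ys \<subseteq> ?cyl n xs"
        using that by auto
      then show ?thesis
        by blast
    next
      case False
      then obtain k where "k < n" "xs k \<noteq> ys k" by blast
      with that have "?cyl n xs \<inter> ?cyl m ys = {}"
        by (auto dest!: spec[of _ k])
      then show ?thesis ..
    qed
    have cyl: "?cyl n xs \<in> range (\<lambda>(n, xs). ?cyl n xs)" for n xs
      by (rule image_eqI[of _ _ "(n, xs)"]) auto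
    fix a b assume "a \<in> insert {} (range (\<lambda>(n, xs). ?cyl n xs))" "b \<in> insert {} (range (\<lambda>(n, xs). ?cyl n xs))"
    then consider "a \<inter> b = {}" | n xs m ys where "a = ?cyl n xs" "b = ?cyl m ys"
      by auto
    then show "a \<inter> b \<in> insert {} (range (\<lambda>(n, xs). ?cyl n xs))"
    proof cases
      case 1
      then show ?thesis by (simp only: insertI1)
    next
      case 2
      have "a \<inter> b = {} \<or> a \<inter> b = b \<or> a \<inter> b = a"
      proof (cases "n \<le> m")
        case True
        then show ?thesis using *[of n m xs ys] unfolding 2 by blast
      next
        case False
        then have "m \<le> n" by simp
        from *[OF this, of ys xs] show ?thesis
          unfolding 2 by (simp only: Int_commute) blast
      qed
      moreover have "a \<in> range (\<lambda>(n, xs). ?cyl n xs)" "b \<in> range (\<lambda>(n, xs). ?cyl n xs)"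
        unfolding 2 by (rule cyl)+
      ultimately show ?thesis
        by (elim disjE) (simp_all only: insertI1 insertI2)
    qed
  qed
next
  fix A assume "A \<in> insert {} (range (\<lambda>(n::nat, xs). {X. \<forall>k<n. X k = (xs k :: 'b list)}))"
  then consider "A = {}" | n :: nat and xs where "A = {X. \<forall>k<n. X k = (xs k :: 'b list)}"
    by auto
  then show "(\<lambda>w. emeasure (quenched_law (\<omega> w)) A) \<in> borel_measurable M"
  proof cases
    case 2
    have [measurable]: "(\<lambda>w. pmf (walk_step (\<omega> w) k xs) (xs k)) \<in> borel_measurable M" for k
    proof (cases k)
      case 0
      then show ?thesis
        by (simp add: walk_step_def)
    next
      case (Suc m)
      then show ?thesis
        using omega_measurable[of "xs m" "xs k"] by (simp add: pmf_walk_step(2) cong: measurable_cong)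
    qed
    show ?thesis
      unfolding 2 quenched_law_cylinder(1) by measurable
  qed simp
qed (auto simp: prob_space_quenched_law quenched_law_cylinder(2))

lemma prob_space_annealed_law: "prob_space (annealed_law M \<omega>)"
  and sets_annealed_law: "sets (annealed_law M \<omega>) = sets path_space"
proof -
  show "prob_space (annealed_law M \<omega>)"
    unfolding annealed_law_def
    by (rule prob_space_bind[OF _ measurable_prob_algebraD[OF quenched_law_measurable]])
       (simp add: prob_space_quenched_law)
  show "sets (annealed_law M \<omega>) = sets path_space"
    unfolding annealed_law_def by (rule sets_bind) (auto simp: quenched_law_cylinder(2) not_empty)
qed

lemma emeasure_annealed_law:
  "E \<in> sets path_space \<Longrightarrow> emeasure (annealed_law M \<omega>) E = (\<integral>\<^sup>+w. emeasure (quenched_law (\<omega> w)) E \<partial>M)"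
  unfolding annealed_law_def
  by (intro emeasure_bind[OF not_empty measurable_prob_algebraD[OF quenched_law_measurable]])

end

end

theory Submission
  imports Defs
begin

text \<open>
  Write \<open>W\<^sub>n\<close> for the sum over generation \<open>n\<close> of the products of \<open>A\<close> along the path from the root.
  By reversibility, the chance that the walk reaches generation \<open>n\<close> within \<open>N\<close> steps is at most of
  order \<open>N W\<^sub>n\<close>, and \<open>W\<^sub>n \<le> (\<Sum> \<Prod> A\<^sup>t)\<close> raised to the power \<open>1/t\<close> for \<open>0 < t \<le> 1\<close>; the best \<open>t\<close> gives
  the exponential rate \<open>q b\<close>. Conversely, a Lyapunov function built from the probability \<open>\<gamma>\<^sub>n\<close> of
  hitting generation \<open>n\<close> during one excursion bounds the chance of staying below generation \<open>n\<close> for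
  \<open>N\<close> steps by a finite constant over \<open>\<gamma>\<^sub>n N\<close>. To bound \<open>\<gamma>\<^sub>n\<close> from below, keep only the paths
  along which \<open>A\<close> behaves as under the \<open>t\<close>-tilted law in every block of \<open>L\<close> generations: they form a
  supercritical branching structure, on which a second moment computation yields the rate \<open>q b\<close>
  with positive probability, and the exponentially many subtrees of an early generation make
  this almost sure. Borel-Cantelli turns both bounds into the limit.
\<close>

section \<open>The killed walk and its reversible measure\<close>

text \<open>The mean of \<open>W_n\<close> alone gives the wrong rate in general: if paths behaving
  as under the 1-tilted law are too rare to exist, it is carried by exceptional environments. This
  is why a critical exponent \<open>t\<close> appears, the first zero of \<open>offspring b\<close>
  in \<open>[0, 1]\<close>, or 1 if there is no zero before. At this \<open>t\<close> the fractional
  moment exponent \<open>(ln b + ln (moment \<mu> t)) / t\<close> equals the exponent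
  \<open>rate b t\<close> of the surviving paths, and both equal \<open>ln (q b)\<close>, so the two
  estimates meet.

  Three obstacles shape the lower bound. The recursion for \<open>hit\<close> has the nonlinear form
  \<open>S / (1 + S)\<close>; it is started from a small constant \<open>e\<close>, and as
  \<open>ln (q b) < 0\<close> the quadratic losses form a convergent geometric series. The ratios
  \<open>A\<close> of siblings are read off one row and are dependent; independence is used only
  along a single path and between disjoint sets of rows. Finally \<open>offspring\<close> may vanish
  at \<open>t\<close>, so the construction runs at exponents slightly below it.

  \<open>A\<close> has no meaning in generation 1, where its denominator would be a step upwards
  from the root; hence the hypotheses \<open>x \<noteq> []\<close> and the sums over
  \<open>[i]\<close>.\<close>

definition words :: "nat \<Rightarrow> 'b::finite list set" where
  "words k = {zs. length zs = k}"

lemma finite_words [simp]: "finite (words k)"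
  using finite_lists_length_eq[of "UNIV :: 'a set" k] by (simp add: words_def)

lemma words_0: "words 0 = {[]}"
  by (auto simp: words_def)

lemma card_words: "card (words k :: 'b::finite list set) = CARD('b) ^ k"
  using card_lists_length_eq[of "UNIV :: 'b set" k] by (simp add: words_def)

text \<open>A word lists the labels from the endpoint upwards, so its last letter is the first step
  down from the base vertex; recursions that unfold at the base vertex need this split.\<close>

lemma sum_words_Suc:
  fixes f :: "'b::finite list \<Rightarrow> 'c::comm_monoid_add"
  shows "(\<Sum>zs\<in>words (Suc k). f zs) = (\<Sum>i\<in>UNIV. \<Sum>zs\<in>words k. f (zs @ [i]))"
proof -
  have "bij_betw (\<lambda>(i, zs). zs @ [i]) (UNIV \<times> words k) (words (Suc k) :: 'b list set)"
    by (rule bij_betw_byWitness[where f' = "\<lambda>zs. (last zs, butlast zs)"])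
      (auto simp: words_def Suc_length_conv intro: append_butlast_last_id)
  then have "(\<Sum>zs\<in>words (Suc k). f zs) = (\<Sum>(i, zs)\<in>UNIV \<times> words k. f (zs @ [i]))"
    by (subst sum.reindex_bij_betw[symmetric]) (auto simp: case_prod_unfold)
  then show ?thesis
    by (simp add: sum.cartesian_product)
qed

section \<open>Weights of paths and their sums over a generation\<close>

primrec path_weight :: "('b list \<Rightarrow> 'b list \<Rightarrow> real) \<Rightarrow> 'b list \<Rightarrow> 'b list \<Rightarrow> real" where
  "path_weight p [] x = 1"
| "path_weight p (i # zs) x = path_weight p zs x * A_ratio p (i # zs @ x)"

lemma path_weight_snoc: "path_weight p (zs @ [i]) x = A_ratio p (i # x) * path_weight p zs (i # x)"
  by (induction zs) auto

definition level_sum :: "('b::finite list \<Rightarrow> 'b list \<Rightarrow> real) \<Rightarrow> nat \<Rightarrow> 'b list \<Rightarrow> real" where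
  "level_sum p k x = (\<Sum>zs\<in>words k. path_weight p zs x)"

lemma level_sum_0 [simp]: "level_sum p 0 x = 1"
  by (simp add: level_sum_def words_0)

lemma level_sum_Suc: "level_sum p (Suc k) x = (\<Sum>i\<in>UNIV. A_ratio p (i # x) * level_sum p k (i # x))"
  by (simp add: level_sum_def sum_words_Suc path_weight_snoc sum_distrib_left)

text \<open>\<open>hit p d x\<close> is the probability that the walk started at \<open>x\<close> reaches a descendant of
  generation \<open>\<bar>x\<bar> + d\<close> before it visits the parent of \<open>x\<close>.\<close>

primrec hit :: "('b::finite list \<Rightarrow> 'b list \<Rightarrow> real) \<Rightarrow> nat \<Rightarrow> 'b list \<Rightarrow> real" where
  "hit p 0 x = 1"
| "hit p (Suc d) x = (\<Sum>i\<in>UNIV. A_ratio p (i # x) * hit p d (i # x)) /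
     (1 + (\<Sum>i\<in>UNIV. A_ratio p (i # x) * hit p d (i # x)))"

text \<open>\<open>exit_time p d x\<close> is the mean time to go from \<open>x\<close> to its parent, for the walk cut at
  generation \<open>\<bar>x\<bar> + d\<close>.\<close>

primrec exit_time :: "('b::finite list \<Rightarrow> 'b list \<Rightarrow> real) \<Rightarrow> nat \<Rightarrow> 'b list \<Rightarrow> real" where
  "exit_time p 0 x = 0"
| "exit_time p (Suc d) x = 1 / p x (tl x) + (\<Sum>i\<in>UNIV. A_ratio p (i # x) * exit_time p d (i # x))"

text \<open>Powers of this operator, applied to the constant 1, give the probability of spending the
  next \<open>k\<close> steps in \<open>F\<close>; the starting vertex itself is not tested.\<close>

definition killed :: "('b list \<Rightarrow> 'b list \<Rightarrow> real) \<Rightarrow> 'b list set \<Rightarrow> ('b list \<Rightarrow> real) \<Rightarrow> 'b list \<Rightarrow> real" where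
  "killed p F f x = (\<Sum>y\<in>F. p x y * f y)"

definition tree_ball :: "nat \<Rightarrow> 'b::finite list set" where
  "tree_ball n = {x. length x < n}"

lemma finite_tree_ball [simp]: "finite (tree_ball n)"
proof -
  have "tree_ball n \<subseteq> (\<Union>k<n. words k :: 'a list set)"
    by (auto simp: tree_ball_def words_def)
  then show ?thesis
    by (rule finite_subset) auto
qed

text \<open>One fixed realisation of the environment: everything proved here is deterministic and is
  later applied to almost every realisation.\<close>

locale elliptic_environment =
  fixes p :: "'b::finite list \<Rightarrow> 'b list \<Rightarrow> real" and \<epsilon> :: real
  assumes eps_pos: "0 < \<epsilon>"
    and p_adj: "\<And>x y. tree_adj x y \<Longrightarrow> \<epsilon> \<le> p x y"
    and p_not_adj: "\<And>x y. \<not> tree_adj x y \<Longrightarrow> p x y = 0"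
    and p_sum: "\<And>x. (p x has_sum 1) UNIV"
begin

lemma p_nonneg: "0 \<le> p x y"
  using p_adj[of x y] p_not_adj[of x y] eps_pos by (cases "tree_adj x y") auto

definition nbrs :: "'b list \<Rightarrow> 'b list set" where
  "nbrs x = (if x = [] then {} else {tl x}) \<union> range (\<lambda>i. i # x)"

lemma nbrs_iff: "y \<in> nbrs x \<longleftrightarrow> tree_adj x y"
  unfolding nbrs_def tree_adj_def by (cases y) auto

lemma finite_nbrs [simp]: "finite (nbrs x)"
  by (simp add: nbrs_def)

lemma sum_nbrs: "(\<Sum>y\<in>nbrs x. f y) = (if x = [] then 0 else f (tl x)) + (\<Sum>i\<in>UNIV. f (i # x))"
proof -
  have "(\<Sum>y\<in>range (\<lambda>i. i # x). f y) = (\<Sum>i\<in>UNIV. f (i # x))"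
    by (subst sum.reindex) (auto simp: inj_on_def)
  moreover have "x \<noteq> [] \<Longrightarrow> tl x \<notin> range (\<lambda>i. i # x)"
    by (auto simp: image_iff dest!: arg_cong[where f = length])
  ultimately show ?thesis
    by (auto simp: nbrs_def)
qed

lemma sum_p_nbrs: "(\<Sum>y\<in>nbrs x. p x y) = 1"
proof -
  have "(p x has_sum 1) (nbrs x)"
    using p_sum[of x] by (subst has_sum_cong_neutral[where T = UNIV and g = "p x"])
      (auto simp: nbrs_iff p_not_adj)
  then show ?thesis
    using has_sum_unique[OF _ has_sum_finite[of "nbrs x" "p x"]] by simp
qed

lemma p_row: "(if x = [] then 0 else p x (tl x)) + (\<Sum>i\<in>UNIV. p x (i # x)) = 1"
  using sum_p_nbrs[of x] by (simp add: sum_nbrs)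

lemma sum_p_le_1: "finite F \<Longrightarrow> (\<Sum>y\<in>F. p x y) \<le> 1"
proof -
  assume F: "finite F"
  have "(\<Sum>y\<in>F. p x y) = (\<Sum>y\<in>F \<inter> nbrs x. p x y)"
    using F by (intro sum.mono_neutral_right) (auto simp: nbrs_iff p_not_adj)
  also have "\<dots> \<le> (\<Sum>y\<in>nbrs x. p x y)"
    by (intro sum_mono2) (auto simp: p_nonneg)
  finally show ?thesis by (simp add: sum_p_nbrs)
qed

lemma p_le_1: "p x y \<le> 1"
  using sum_p_le_1[of "{y}" x] by simp

lemma p_parent: "x \<noteq> [] \<Longrightarrow> \<epsilon> \<le> p x (tl x)"
  and p_child: "\<epsilon> \<le> p x (i # x)"
  by (auto intro!: p_adj simp: tree_adj_def)

lemma eps_le_1: "\<epsilon> \<le> 1"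
  using p_child[of "[]"] p_le_1[of "[]"] by (rule order_trans)

lemma A_bounds:
  assumes "x \<noteq> []"
  shows "\<epsilon> \<le> A_ratio p (i # x)" "A_ratio p (i # x) \<le> 1 / \<epsilon>"
proof -
  have *: "\<epsilon> \<le> p x (tl x)" "p x (tl x) \<le> 1" "\<epsilon> \<le> p x (i # x)" "p x (i # x) \<le> 1"
    using assms p_parent p_child p_le_1 by auto
  show "\<epsilon> \<le> A_ratio p (i # x)"
    using * eps_pos mult_mono[of \<epsilon> "p x (i # x)" "p x (tl x)" 1] by (simp add: A_ratio_def field_simps)
  show "A_ratio p (i # x) \<le> 1 / \<epsilon>"
    using * eps_pos frac_le[of 1 "p x (i # x)" \<epsilon> "p x (tl x)"] by (simp add: A_ratio_def)
qed

lemma A_pos: "x \<noteq> [] \<Longrightarrow> 0 < A_ratio p (i # x)"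
  using A_bounds(1)[of x i] eps_pos by linarith

lemma path_weight_pos: "x \<noteq> [] \<Longrightarrow> 0 < path_weight p zs x"
  by (induction zs) (auto intro!: mult_pos_pos A_pos)

lemma path_weight_bounds:
  "x \<noteq> [] \<Longrightarrow> path_weight p zs x \<le> (1 / \<epsilon>) ^ length zs \<and> \<epsilon> ^ length zs \<le> path_weight p zs x"
proof (induction zs)
  case (Cons i zs)
  have "zs @ x \<noteq> []" using Cons.prems by simp
  note A = A_bounds[OF this, of i]
  have "path_weight p zs x * A_ratio p (i # zs @ x) \<le> (1 / \<epsilon>) ^ length zs * (1 / \<epsilon>)"
    using Cons A eps_pos by (intro mult_mono) auto
  moreover have "\<epsilon> ^ length zs * \<epsilon> \<le> path_weight p zs x * A_ratio p (i # zs @ x)"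
    using Cons A eps_pos path_weight_pos[of x zs] by (intro mult_mono) auto
  ultimately show ?case by (simp add: mult.commute)
qed simp

lemma level_sum_nonneg: "x \<noteq> [] \<Longrightarrow> 0 \<le> level_sum p k x"
  unfolding level_sum_def by (intro sum_nonneg less_imp_le path_weight_pos)

text \<open>\<open>conductance x\<close> is the conductance of the edge above \<open>x\<close>, normalised so that the
  reversible measure gives mass 1 to the root.\<close>

fun conductance :: "'b list \<Rightarrow> real" where
  "conductance [] = 1"
| "conductance [i] = p [] [i]"
| "conductance (i # x) = conductance x * A_ratio p (i # x)"

definition rev_measure :: "'b list \<Rightarrow> real" where
  "rev_measure x = (if x = [] then 1 else conductance x / p x (tl x))"

lemma conductance_Cons: "x \<noteq> [] \<Longrightarrow> conductance (i # x) = conductance x * A_ratio p (i # x)"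
  by (cases x) auto

lemma conductance_pos: "0 < conductance x"
proof (induction x)
  case (Cons i x)
  then show ?case
    using p_child[of "[]" i] eps_pos A_pos[of x i] by (cases "x = []") (auto simp: conductance_Cons)
qed simp

lemma rev_measure_pos: "0 < rev_measure x"
  using conductance_pos[of x] p_parent[of x] eps_pos by (auto simp: rev_measure_def)

lemma rev_measure_edge: "rev_measure x * p x (i # x) = rev_measure (i # x) * p (i # x) x"
proof -
  have "p (i # x) x > 0"
    using p_parent[of "i # x"] eps_pos by simp
  then show ?thesis
    by (cases "x = []") (auto simp: rev_measure_def conductance_Cons A_ratio_def)
qed

lemma reversible: "rev_measure x * p x y = rev_measure y * p y x"
proof (cases "tree_adj x y")
  case True
  then consider i where "x = i # y" | i where "y = i # x"
    unfolding tree_adj_def by (metis list.collapse)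
  then show ?thesis
    by cases (auto simp: rev_measure_edge)
next
  case False
  then have "\<not> tree_adj y x"
    by (auto simp: tree_adj_def)
  with False show ?thesis by (simp add: p_not_adj)
qed

lemma sum_conductance:
  "x \<noteq> [] \<Longrightarrow> (\<Sum>zs\<in>words k. conductance (zs @ x)) = conductance x * level_sum p k x"
proof (induction k arbitrary: x)
  case 0
  then show ?case by (simp add: words_0)
next
  case (Suc k)
  then have "(\<Sum>zs\<in>words (Suc k). conductance (zs @ x)) =
      (\<Sum>i\<in>UNIV. conductance (i # x) * level_sum p k (i # x))"
    by (simp add: sum_words_Suc)
  also have "\<dots> = conductance x * level_sum p (Suc k) x"
    using Suc.prems by (simp add: conductance_Cons level_sum_Suc sum_distrib_left mult_ac)
  finally show ?case .
qed

lemma sum_rev_measure_level: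
  "(\<Sum>x\<in>words (Suc k). rev_measure x) \<le> (\<Sum>i\<in>UNIV. level_sum p k [i]) / \<epsilon>"
proof -
  have "rev_measure x \<le> conductance x / \<epsilon>" if "x \<noteq> []" for x
    using that p_parent[of x] eps_pos conductance_pos[of x] by (auto simp: rev_measure_def intro!: frac_le)
  then have "(\<Sum>x\<in>words (Suc k). rev_measure x) \<le> (\<Sum>x\<in>words (Suc k). conductance x / \<epsilon>)"
    by (intro sum_mono) (simp add: words_def, metis Zero_not_Suc list.size(3))
  also have "\<dots> = (\<Sum>i\<in>UNIV. conductance [i] * level_sum p k [i]) / \<epsilon>"
    by (simp add: sum_words_Suc sum_conductance flip: sum_divide_distrib)
  also have "\<dots> \<le> (\<Sum>i\<in>UNIV. 1 * level_sum p k [i]) / \<epsilon>"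
    using eps_pos by (intro divide_right_mono sum_mono mult_right_mono)
      (auto simp: p_le_1 level_sum_nonneg)
  finally show ?thesis by simp
qed

section \<open>Escape of the killed walk from a ball\<close>

abbreviation survival :: "nat \<Rightarrow> nat \<Rightarrow> 'b list \<Rightarrow> real" where
  "survival n k \<equiv> (killed p (tree_ball n) ^^ k) (\<lambda>_. 1)"

text \<open>By reversibility the kernel can be moved from \<open>f\<close> to the measure, and
  killing can only lose mass, so the sum on the right does not grow when \<open>f\<close> is
  replaced by \<open>killed p F f\<close>. The vertex \<open>z\<close> contributes one of its
  nonnegative terms.\<close>

lemma rev_measure_killed_power:
  assumes "finite F" "z \<in> F" "\<And>x. 0 \<le> f x"
  shows "rev_measure z * (killed p F ^^ k) f z \<le> (\<Sum>x\<in>F. rev_measure x * f x)"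
  using assms(3)
proof (induction k arbitrary: f)
  case 0
  have "rev_measure z * f z = (\<Sum>x\<in>{z}. rev_measure x * f x)" by simp
  also have "\<dots> \<le> (\<Sum>x\<in>F. rev_measure x * f x)"
    using assms 0 rev_measure_pos by (intro sum_mono2) (auto intro!: mult_nonneg_nonneg intro: less_imp_le)
  finally show ?case by simp
next
  case (Suc k)
  have "rev_measure z * (killed p F ^^ Suc k) f z = rev_measure z * (killed p F ^^ k) (killed p F f) z"
    by (simp add: funpow_swap1)
  also have "\<dots> \<le> (\<Sum>x\<in>F. rev_measure x * killed p F f x)"
    using Suc.prems by (intro Suc.IH) (auto simp: killed_def intro!: sum_nonneg mult_nonneg_nonneg p_nonneg)
  also have "\<dots> = (\<Sum>x\<in>F. \<Sum>y\<in>F. rev_measure x * p x y * f y)"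
    by (simp add: killed_def sum_distrib_left mult_ac)
  also have "\<dots> = (\<Sum>y\<in>F. \<Sum>x\<in>F. rev_measure y * p y x * f y)"
    by (subst sum.swap) (simp add: reversible)
  also have "\<dots> = (\<Sum>y\<in>F. rev_measure y * f y * (\<Sum>x\<in>F. p y x))"
    by (simp add: sum_distrib_left mult_ac)
  also have "\<dots> \<le> (\<Sum>y\<in>F. rev_measure y * f y * 1)"
    using assms(1) Suc.prems
    by (intro sum_mono mult_left_mono sum_p_le_1 mult_nonneg_nonneg) (auto intro: less_imp_le rev_measure_pos)
  finally show ?case by simp
qed

lemma killed_diff: "killed p F (\<lambda>x. f x - g x) = (\<lambda>x. killed p F f x - killed p F g x)"
  by (rule ext) (simp add: killed_def right_diff_distrib sum_subtractf)

lemma killed_power_diff: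
  "(killed p F ^^ k) (\<lambda>x. f x - g x) = (\<lambda>x. (killed p F ^^ k) f x - (killed p F ^^ k) g x)"
  by (induction k) (auto simp: killed_diff)

lemma killed_one_interior: "Suc (length x) < n \<Longrightarrow> killed p (tree_ball n) (\<lambda>_. 1) x = 1"
proof -
  assume "Suc (length x) < n"
  then have "nbrs x \<subseteq> tree_ball n"
    by (auto simp: nbrs_def tree_ball_def)
  then have "(\<Sum>y\<in>tree_ball n. p x y) = (\<Sum>y\<in>nbrs x. p x y)"
    by (intro sum.mono_neutral_right) (auto simp: nbrs_iff p_not_adj)
  then show ?thesis by (simp add: killed_def sum_p_nbrs)
qed

text \<open>The decrements of the survival probability telescope, and each one averages
  \<open>?f\<close>, the chance of leaving the ball in one step. Inside the ball this chance
  vanishes except in the last generation \<open>n + 1\<close>, so every decrement is at most the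
  reversible mass of that generation, uniformly in time.\<close>

lemma escape_le:
  "1 - survival (Suc (Suc n)) N [] \<le> real N * ((\<Sum>i\<in>UNIV. level_sum p n [i]) / \<epsilon>)"
proof -
  let ?F = "tree_ball (Suc (Suc n)) :: 'b list set"
  let ?f = "\<lambda>x. 1 - killed p ?F (\<lambda>_. 1) x"
  have f: "0 \<le> ?f x" "?f x \<le> 1" for x
    using sum_p_le_1[of ?F x] by (auto simp: killed_def intro!: sum_nonneg p_nonneg)
  have "survival (Suc (Suc n)) k [] - survival (Suc (Suc n)) (Suc k) [] \<le> (\<Sum>i\<in>UNIV. level_sum p n [i]) / \<epsilon>"
    for k
  proof -
    have "survival (Suc (Suc n)) k [] - survival (Suc (Suc n)) (Suc k) [] = rev_measure [] * (killed p ?F ^^ k) ?f []"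
      by (simp add: killed_power_diff funpow_swap1 rev_measure_def)
    also have "\<dots> \<le> (\<Sum>x\<in>?F. rev_measure x * ?f x)"
      by (rule rev_measure_killed_power) (rule finite_tree_ball, simp add: tree_ball_def, rule f)
    also have "\<dots> = (\<Sum>x\<in>words (Suc n). rev_measure x * ?f x)"
      by (rule sum.mono_neutral_right)
        (use finite_tree_ball[of "Suc (Suc n)", where 'a = 'b] in \<open>auto simp: tree_ball_def words_def intro!: killed_one_interior[unfolded tree_ball_def]\<close>)
    also have "\<dots> \<le> (\<Sum>x\<in>words (Suc n). rev_measure x)"
      using f rev_measure_pos by (intro sum_mono) (auto intro!: mult_left_le less_imp_le)
    also note sum_rev_measure_level
    finally show ?thesis .
  qed
  then have "(\<Sum>k<N. survival (Suc (Suc n)) k [] - survival (Suc (Suc n)) (Suc k) []) \<le>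
      (\<Sum>k<N. (\<Sum>i\<in>UNIV. level_sum p n [i]) / \<epsilon>)"
    by (intro sum_mono) 
  then show ?thesis
    by (subst (asm) sum_lessThan_telescope') simp
qed

end

section \<open>Hitting probabilities and a Lyapunov function\<close>

lemma ratio_mono: "0 \<le> (s::real) \<Longrightarrow> s \<le> s' \<Longrightarrow> s / (1 + s) \<le> s' / (1 + s')"
  by (simp add: field_simps)

lemma ratio_divide: "0 < (D::real) \<Longrightarrow> 0 \<le> t \<Longrightarrow> (t / D) / (1 + t / D) = t / (D + t)"
proof -
  assume "0 < D" "0 \<le> t"
  then have "1 + t / D = (D + t) / D" by (simp add: field_simps)
  then show ?thesis using \<open>0 < D\<close> by simp
qed

context elliptic_environment
begin

lemma hit_bounds: "x \<noteq> [] \<Longrightarrow> 0 < hit p d x \<and> hit p d x \<le> 1"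
proof (induction d arbitrary: x)
  case (Suc d)
  have "0 < (\<Sum>i\<in>UNIV. A_ratio p (i # x) * hit p d (i # x))"
    using Suc by (intro sum_pos mult_pos_pos A_pos) auto
  then show ?case by simp
qed simp

lemma hit_Suc_ge:
  assumes "x \<noteq> []" "0 \<le> s" "s \<le> (\<Sum>i\<in>UNIV. A_ratio p (i # x) * hit p d (i # x))"
  shows "s / (1 + s) \<le> hit p (Suc d) x"
  using ratio_mono[OF assms(2,3)] by simp

text \<open>Keeping one child per generation costs at most a factor \<open>\<epsilon> / 2\<close>:
  \<open>\<epsilon>\<close> for the ratio \<open>A\<close>, and 2 for the denominator
  \<open>1 + s\<close> with \<open>s \<le> 1\<close>.\<close>

lemma hit_descendant:
  "x \<noteq> [] \<Longrightarrow> (\<epsilon> / 2) ^ length zs * hit p d (zs @ x) \<le> hit p (length zs + d) x"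
proof (induction zs arbitrary: x rule: rev_induct)
  case (snoc i zs)
  let ?h = "hit p (length zs + d) (i # x)"
  have h: "0 < ?h" "?h \<le> 1" using hit_bounds[of "i # x"] by auto
  have "\<epsilon> * ?h \<le> A_ratio p (i # x) * ?h"
    using A_bounds[OF snoc.prems, of i] h by (intro mult_right_mono) auto
  also have "\<dots> \<le> (\<Sum>j\<in>UNIV. A_ratio p (j # x) * hit p (length zs + d) (j # x))"
    using A_pos[OF snoc.prems] hit_bounds
    by (intro member_le_sum) (auto intro!: mult_nonneg_nonneg intro: less_imp_le)
  finally have "(\<epsilon> * ?h) / (1 + \<epsilon> * ?h) \<le> hit p (Suc (length zs + d)) x"
    using h eps_pos snoc.prems by (intro hit_Suc_ge) auto
  moreover have "(\<epsilon> / 2) * ?h \<le> (\<epsilon> * ?h) / (1 + \<epsilon> * ?h)"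
  proof -
    have "\<epsilon> * ?h \<le> 1" using h eps_le_1 eps_pos by (intro mult_le_one) auto
    then have "(\<epsilon> * ?h) / 2 \<le> (\<epsilon> * ?h) / (1 + \<epsilon> * ?h)"
      using h eps_pos by (intro divide_left_mono) (auto intro!: mult_pos_pos add_pos_pos)
    then show ?thesis by simp
  qed
  moreover have "(\<epsilon> / 2) * ((\<epsilon> / 2) ^ length zs * hit p d (zs @ i # x)) \<le> (\<epsilon> / 2) * ?h"
    using snoc.IH[of "i # x"] eps_pos by (intro mult_left_mono) auto
  ultimately have "(\<epsilon> / 2) * ((\<epsilon> / 2) ^ length zs * hit p d (zs @ i # x)) \<le> hit p (Suc (length zs + d)) x"
    by (meson order_trans)
  then show ?case by (simp add: mult.assoc del: hit.simps)
qed simp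

text \<open>Zeros of \<open>f\<close> discard descendants; the denominator is the price of the nonlinearity of the
  recursion for \<open>hit\<close>.\<close>

lemma hit_block:
  assumes f: "\<And>y. y \<noteq> [] \<Longrightarrow> 0 \<le> f y \<and> f y \<le> hit p d y"
  shows "x \<noteq> [] \<Longrightarrow> (\<Sum>zs\<in>words j. path_weight p zs x * f (zs @ x)) /
     (1 + (\<Sum>i<j. (1 / \<epsilon>) ^ Suc i) * (\<Sum>zs\<in>words j. f (zs @ x))) \<le> hit p (j + d) x"
proof (induction j arbitrary: x)
  case 0
  then show ?case using f by (simp add: words_0)
next
  case (Suc j)
  define T where "T = (\<lambda>j x. \<Sum>zs\<in>words j. path_weight p zs x * f (zs @ x))"
  define U where "U = (\<lambda>j x. \<Sum>zs\<in>words j. f (zs @ x))"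
  define c where "c = (\<Sum>i<j. (1 / \<epsilon>) ^ Suc i)"
  have c: "0 \<le> c" unfolding c_def using eps_pos by (intro sum_nonneg) auto
  have T_Suc: "T (Suc j) x = (\<Sum>i\<in>UNIV. A_ratio p (i # x) * T j (i # x))"
    by (simp add: T_def sum_words_Suc path_weight_snoc sum_distrib_left mult.assoc)
  have U_Suc: "U (Suc j) x = (\<Sum>i\<in>UNIV. U j (i # x))"
    by (simp add: U_def sum_words_Suc)
  have U0: "0 \<le> U j x" if "x \<noteq> []" for x j
    unfolding U_def using f that by (intro sum_nonneg) auto
  have T0: "0 \<le> T j x" if "x \<noteq> []" for x j
    unfolding T_def using f that path_weight_pos by (intro sum_nonneg mult_nonneg_nonneg) (auto intro: less_imp_le)
  have U_le: "U j (i # x) \<le> U (Suc j) x" for i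
    unfolding U_Suc using U0 by (intro member_le_sum) auto
  have TU: "T (Suc j) x \<le> (1 / \<epsilon>) ^ Suc j * U (Suc j) x"
    unfolding T_def U_def sum_distrib_left
  proof (intro sum_mono mult_right_mono)
    fix zs :: "'b list" assume "zs \<in> words (Suc j)"
    then show "path_weight p zs x \<le> (1 / \<epsilon>) ^ Suc j"
      using path_weight_bounds[OF Suc.prems, of zs] by (simp add: words_def)
    show "0 \<le> f (zs @ x)" using f Suc.prems by simp
  qed
  let ?S = "T (Suc j) x / (1 + c * U (Suc j) x)"
  have den: "0 < 1 + c * U (Suc j) x"
    using c U0[OF Suc.prems, of "Suc j"] by (simp add: add_pos_nonneg)
  \<comment> \<open>All children receive the common denominator built from
    \<open>U (Suc j) x\<close>, which dominates each \<open>U j (i # x)\<close>.\<close>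
  have "?S = (\<Sum>i\<in>UNIV. A_ratio p (i # x) * (T j (i # x) / (1 + c * U (Suc j) x)))"
    by (simp add: T_Suc sum_divide_distrib)
  also have "\<dots> \<le> (\<Sum>i\<in>UNIV. A_ratio p (i # x) * (T j (i # x) / (1 + c * U j (i # x))))"
    using A_pos[OF Suc.prems] T0 U0 U_le c den
    by (intro sum_mono mult_left_mono divide_left_mono)
       (auto intro!: mult_pos_pos add_pos_nonneg mult_left_mono mult_nonneg_nonneg intro: less_imp_le)
  also have "\<dots> \<le> (\<Sum>i\<in>UNIV. A_ratio p (i # x) * hit p (j + d) (i # x))"
    using A_pos[OF Suc.prems] Suc.IH
    by (intro sum_mono mult_left_mono) (auto simp: T_def U_def c_def intro: less_imp_le)
  finally have h: "?S / (1 + ?S) \<le> hit p (Suc (j + d)) x"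
    using Suc.prems T0[OF Suc.prems, of "Suc j"] den by (intro hit_Suc_ge) auto
  \<comment> \<open>Applying \<open>s / (1 + s)\<close> to a fraction adds its numerator to its
    denominator. By \<open>TU\<close> that numerator is at most
    \<open>(1 / \<epsilon>) ^ Suc j\<close> times \<open>U (Suc j) x\<close>, which is the next term
    of the geometric coefficient.\<close>
  have eq: "?S / (1 + ?S) = T (Suc j) x / (1 + c * U (Suc j) x + T (Suc j) x)"
    by (rule ratio_divide[OF den T0[OF Suc.prems]])
  have "T (Suc j) x / (1 + (c + (1 / \<epsilon>) ^ Suc j) * U (Suc j) x) \<le>
      T (Suc j) x / (1 + c * U (Suc j) x + T (Suc j) x)"
  proof (intro divide_left_mono mult_pos_pos)
    show "1 + c * U (Suc j) x + T (Suc j) x \<le> 1 + (c + (1 / \<epsilon>) ^ Suc j) * U (Suc j) x"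
      using TU by (simp add: distrib_right)
    moreover show "0 < 1 + c * U (Suc j) x + T (Suc j) x"
      using den T0[OF Suc.prems, of "Suc j"] by simp
    ultimately show "0 < 1 + (c + (1 / \<epsilon>) ^ Suc j) * U (Suc j) x"
      by linarith
  qed (rule T0[OF Suc.prems])
  from order_trans[OF this h[unfolded eq]] show ?case
    by (simp add: T_def U_def c_def del: hit.simps)
qed

section \<open>Mean exit times and the Lyapunov function\<close>

lemma exit_time_nonneg: "x \<noteq> [] \<Longrightarrow> 0 \<le> exit_time p d x"
proof (induction d arbitrary: x)
  case (Suc d)
  then show ?case
    using A_pos[of x] p_nonneg by (auto intro!: add_nonneg_nonneg sum_nonneg mult_nonneg_nonneg intro: less_imp_le)
qed simp

lemma exit_time_le: "x \<noteq> [] \<Longrightarrow> exit_time p d x \<le> (\<Sum>k<d. level_sum p k x) / \<epsilon>"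
proof (induction d arbitrary: x)
  case (Suc d)
  have "A_ratio p (i # x) * exit_time p d (i # x) \<le> A_ratio p (i # x) * ((\<Sum>k<d. level_sum p k (i # x)) / \<epsilon>)" for i
    using A_pos[OF Suc.prems] by (intro mult_left_mono Suc.IH) (auto intro: less_imp_le)
  then have "exit_time p (Suc d) x \<le> 1 / \<epsilon> + (\<Sum>i\<in>UNIV. A_ratio p (i # x) * ((\<Sum>k<d. level_sum p k (i # x)) / \<epsilon>))"
    unfolding exit_time.simps using Suc.prems p_parent[of x] eps_pos
    by (intro add_mono sum_mono frac_le) auto
  also have "(\<Sum>i\<in>UNIV. A_ratio p (i # x) * ((\<Sum>k<d. level_sum p k (i # x)) / \<epsilon>)) =
      (\<Sum>k<d. level_sum p (Suc k) x) / \<epsilon>"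
    unfolding level_sum_Suc by (subst sum.swap) (simp add: sum_divide_distrib sum_distrib_left)
  also have "1 / \<epsilon> + \<dots> = (\<Sum>k<Suc d. level_sum p k x) / \<epsilon>"
    unfolding sum.lessThan_Suc_shift by (simp add: add_divide_distrib)
  finally show ?case .
qed simp

text \<open>For the walk from \<open>x\<close>, \<open>miss n x\<close> is the probability of visiting the root before generation
  \<open>n\<close>, and \<open>return_time n x\<close> is the mean hitting time of the root when the tree is cut at
  generation \<open>n\<close>.\<close>

primrec miss :: "nat \<Rightarrow> 'b list \<Rightarrow> real" where
  "miss n [] = 1"
| "miss n (i # x) = miss n x * (1 - hit p (n - Suc (length x)) (i # x))"

primrec return_time :: "nat \<Rightarrow> 'b list \<Rightarrow> real" where
  "return_time n [] = 0"
| "return_time n (i # x) = return_time n x + exit_time p (n - Suc (length x)) (i # x)"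

text \<open>The \<open>\<gamma>\<close> of the overview: the chance that one excursion from the root
  reaches generation \<open>m + 1\<close>.\<close>

definition root_hit :: "nat \<Rightarrow> real" where
  "root_hit m = (\<Sum>i\<in>UNIV. p [] [i] * hit p m [i])"

definition root_return :: "nat \<Rightarrow> real" where
  "root_return m = 1 + (\<Sum>i\<in>UNIV. p [] [i] * exit_time p m [i])"

text \<open>\<open>miss\<close> has drift 0 away from the root and \<open>- root_hit\<close> at the
  root; \<open>return_time\<close> has drift -1 away from the root and
  \<open>root_return - 1\<close> at the root. The coefficient is the one that makes the total drift
  -1 at the root as well.\<close>

definition lyapunov :: "nat \<Rightarrow> 'b list \<Rightarrow> real" where
  "lyapunov n x = root_return (n - 1) / root_hit (n - 1) * miss n x + return_time n x"

lemma root_hit_pos: "0 < root_hit m"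
proof -
  have "0 < p [] [i]" for i using p_child[of "[]" i] eps_pos by simp
  then show ?thesis
    unfolding root_hit_def using hit_bounds by (intro sum_pos mult_pos_pos) auto
qed

lemma root_return_ge_1: "1 \<le> root_return m"
  unfolding root_return_def using p_nonneg exit_time_nonneg by (auto intro!: sum_nonneg mult_nonneg_nonneg)

lemma lyapunov_nonneg: "0 \<le> lyapunov n x"
proof -
  have "0 \<le> miss n x"
    by (induction x) (auto intro!: mult_nonneg_nonneg simp: hit_bounds)
  moreover have "0 \<le> return_time n x"
    by (induction x) (auto intro!: add_nonneg_nonneg simp: exit_time_nonneg)
  ultimately show ?thesis
    unfolding lyapunov_def using root_hit_pos[of "n - 1"] root_return_ge_1[of "n - 1"]
    by (auto intro!: add_nonneg_nonneg mult_nonneg_nonneg divide_nonneg_pos)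
qed

lemma lyapunov_step:
  assumes "length x < n"
  shows "(\<Sum>y\<in>nbrs x. p x y * lyapunov n y) = lyapunov n x - 1"
proof (cases x)
  case Nil
  define a where "a = root_return (n - 1) / root_hit (n - 1)"
  have "(\<Sum>y\<in>nbrs x. p x y * lyapunov n y) =
      (\<Sum>i\<in>UNIV. p [] [i] * (a * (1 - hit p (n - 1) [i]) + exit_time p (n - 1) [i]))"
    using Nil by (simp add: sum_nbrs lyapunov_def a_def)
  also have "\<dots> = a * (\<Sum>i\<in>UNIV. p [] [i]) - a * root_hit (n - 1) + (root_return (n - 1) - 1)"
    by (simp add: root_hit_def root_return_def sum_distrib_left algebra_simps sum.distrib sum_subtractf)
  also have "\<dots> = a - 1"
    using p_row[of "[]"] root_hit_pos[of "n - 1"] by (simp add: a_def)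
  finally show ?thesis using Nil by (simp add: lyapunov_def a_def)
next
  case (Cons i z)
  \<comment> \<open>The depth left below the children of \<open>x\<close>. It is 0 if they lie in
    generation \<open>n\<close>, where \<open>hit\<close> is 1 and thus \<open>miss\<close>
    vanishes, and \<open>exit_time\<close> is 0.\<close>
  define d where "d = n - Suc (length x)"
  have d: "n - length x = Suc d" "n - Suc (length z) = Suc d"
    using assms Cons by (auto simp: d_def)
  define pp where "pp = p x z"
  define q where "q = (\<lambda>j. p x (j # x))"
  have pp: "0 < pp" using p_parent[of x] eps_pos Cons by (simp add: pp_def)
  have row: "pp + (\<Sum>j\<in>UNIV. q j) = 1"
    using p_row[of x] Cons by (simp add: pp_def q_def)
  have A: "A_ratio p (j # x) = q j / pp" for j
    using Cons by (simp add: A_ratio_def pp_def q_def)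
  define S where "S = (\<Sum>j\<in>UNIV. A_ratio p (j # x) * hit p d (j # x))"
  have S: "0 \<le> S" unfolding S_def using A_pos[of x] hit_bounds Cons
    by (intro sum_nonneg mult_nonneg_nonneg) (auto intro: less_imp_le)
  have ppS: "pp * S = (\<Sum>j\<in>UNIV. q j * hit p d (j # x))"
    unfolding S_def A sum_distrib_left using pp by simp
  have hx: "hit p (Suc d) x = S / (1 + S)" by (simp add: S_def)
  have miss_x: "miss n x = miss n z / (1 + S)"
  proof -
    have "miss n x = miss n z * (1 - S / (1 + S))"
      using Cons d(2) hx by (simp del: hit.simps)
    also have "1 - S / (1 + S) = 1 / (1 + S)"
      using S by (simp add: field_simps)
    finally show ?thesis by simp
  qed
  then have miss_z: "miss n z = miss n x * (1 + S)"
    using S by simp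
  have m: "pp * miss n z + (\<Sum>j\<in>UNIV. q j * miss n (j # x)) = miss n x"
  proof -
    have "(\<Sum>j\<in>UNIV. q j * miss n (j # x)) = miss n x * ((\<Sum>j\<in>UNIV. q j) - pp * S)"
      unfolding ppS by (simp add: d_def sum_distrib_left sum_distrib_right right_diff_distrib sum_subtractf mult_ac)
    then have "pp * miss n z + (\<Sum>j\<in>UNIV. q j * miss n (j # x)) = miss n x * (pp + (\<Sum>j\<in>UNIV. q j))"
      unfolding miss_z by (simp add: algebra_simps)
    then show ?thesis by (simp add: row)
  qed
  define E where "E = (\<Sum>j\<in>UNIV. q j * exit_time p d (j # x))"
  have ret_x: "return_time n x = return_time n z + (1 / pp + E / pp)"
  proof -
    have "return_time n x = return_time n z + exit_time p (Suc d) x"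
      using Cons d by (simp del: exit_time.simps)
    moreover have "tl x = z" using Cons by simp
    ultimately show ?thesis
      by (simp add: A E_def sum_divide_distrib flip: pp_def)
  qed
  have r: "pp * return_time n z + (\<Sum>j\<in>UNIV. q j * return_time n (j # x)) = return_time n x - 1"
  proof -
    have "(\<Sum>j\<in>UNIV. q j * return_time n (j # x)) = return_time n x * (\<Sum>j\<in>UNIV. q j) + E"
      by (simp add: E_def d_def sum_distrib_left sum_distrib_right algebra_simps sum.distrib)
    moreover have "return_time n z = return_time n x - (1 / pp + E / pp)"
      using ret_x by simp
    ultimately have "pp * return_time n z + (\<Sum>j\<in>UNIV. q j * return_time n (j # x)) =
        return_time n x * (pp + (\<Sum>j\<in>UNIV. q j)) - 1"
      using pp by (simp add: field_simps)
    then show ?thesis by (simp add: row)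
  qed
  define a where "a = root_return (n - 1) / root_hit (n - 1)"
  have ly: "lyapunov n y = a * miss n y + return_time n y" for y
    by (simp add: lyapunov_def a_def)
  have "(\<Sum>y\<in>nbrs x. p x y * lyapunov n y) = pp * lyapunov n z + (\<Sum>j\<in>UNIV. q j * lyapunov n (j # x))"
    using Cons by (simp add: sum_nbrs pp_def q_def)
  also have "\<dots> = a * (pp * miss n z + (\<Sum>j\<in>UNIV. q j * miss n (j # x))) +
      (pp * return_time n z + (\<Sum>j\<in>UNIV. q j * return_time n (j # x)))"
    unfolding ly
    by (simp add: algebra_simps sum.distrib sum_distrib_left del: miss.simps return_time.simps)
  also have "\<dots> = lyapunov n x - 1"
    unfolding m r by (simp add: ly)
  finally show ?thesis .
qed

lemma killed_lyapunov_le: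
  assumes "length x < n"
  shows "killed p (tree_ball n) (lyapunov n) x \<le> lyapunov n x - 1"
proof -
  have "killed p (tree_ball n) (lyapunov n) x = (\<Sum>y\<in>tree_ball n \<inter> nbrs x. p x y * lyapunov n y)"
    unfolding killed_def by (intro sum.mono_neutral_right) (auto simp: nbrs_iff p_not_adj)
  also have "\<dots> \<le> (\<Sum>y\<in>nbrs x. p x y * lyapunov n y)"
    by (intro sum_mono2) (auto intro!: mult_nonneg_nonneg p_nonneg lyapunov_nonneg)
  finally show ?thesis
    by (simp add: lyapunov_step[OF assms])
qed

lemma killed_mono: "(\<And>y. y \<in> F \<Longrightarrow> f y \<le> g y) \<Longrightarrow> killed p F f x \<le> killed p F g x"
  unfolding killed_def by (intro sum_mono mult_left_mono p_nonneg) auto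

text \<open>Foster's argument: a nonnegative function with drift at most -1 dominates the mean exit
  time, here truncated and written as a sum of survival probabilities.\<close>

lemma sum_survival_le: "length x < n \<Longrightarrow> (\<Sum>k\<le>N. survival n k x) \<le> lyapunov n x"
proof (induction N arbitrary: x)
  case 0
  have "0 \<le> killed p (tree_ball n) (lyapunov n) x"
    unfolding killed_def by (intro sum_nonneg mult_nonneg_nonneg p_nonneg lyapunov_nonneg)
  then show ?case using killed_lyapunov_le[OF 0] by simp
next
  case (Suc N)
  have "(\<Sum>k\<le>Suc N. survival n k x) = 1 + killed p (tree_ball n) (\<lambda>y. \<Sum>k\<le>N. survival n k y) x"
    unfolding sum.atMost_Suc_shift by (simp add: killed_def sum_distrib_left sum.swap[of _ _ "{..N}"])
  also have "\<dots> \<le> 1 + killed p (tree_ball n) (lyapunov n) x"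
    using Suc.IH by (intro add_left_mono killed_mono) (auto simp: tree_ball_def)
  also have "\<dots> \<le> lyapunov n x"
    using killed_lyapunov_le[OF Suc.prems] by simp
  finally show ?case .
qed

lemma survival_Suc_le: "survival n (Suc k) x \<le> survival n k x"
proof (induction k arbitrary: x)
  case 0
  then show ?case using sum_p_le_1[of "tree_ball n" x] by (simp add: killed_def)
next
  case (Suc k)
  show ?case using killed_mono[OF Suc.IH] by simp
qed

lemma survival_antimono: "k \<le> l \<Longrightarrow> survival n l x \<le> survival n k x"
  using lift_Suc_antimono_le[of "\<lambda>k. survival n k x"] survival_Suc_le by blast

text \<open>Survival decreases in time, so its last value is at most the average of the earlier
  ones; at the root \<open>miss\<close> is 1 and \<open>return_time\<close> is 0.\<close>

lemma survival_le: "real (Suc N) * survival (Suc m) N [] \<le> root_return m / root_hit m"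
proof -
  have "real (Suc N) * survival (Suc m) N [] = (\<Sum>k\<le>N. survival (Suc m) N [])"
    by simp
  also have "\<dots> \<le> (\<Sum>k\<le>N. survival (Suc m) k [])"
    by (intro sum_mono survival_antimono) auto
  also have "\<dots> \<le> lyapunov (Suc m) []"
    by (rule sum_survival_le) simp
  finally show ?thesis by (simp add: lyapunov_def)
qed

lemma root_return_le: "root_return m \<le> 1 + (\<Sum>i\<in>UNIV. \<Sum>k<m. level_sum p k [i]) / \<epsilon>"
proof -
  have "p [] [i] * exit_time p m [i] \<le> 1 * ((\<Sum>k<m. level_sum p k [i]) / \<epsilon>)" for i
    using p_nonneg p_le_1 exit_time_le exit_time_nonneg by (intro mult_mono) auto
  then show ?thesis
    unfolding root_return_def by (auto simp: sum_divide_distrib intro: sum_mono)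
qed

lemma root_hit_ge:
  assumes "length zs = k"
  shows "\<epsilon> * ((\<epsilon> / 2) ^ k * hit p d (zs @ [i])) \<le> root_hit (k + d)"
proof -
  have "\<epsilon> * ((\<epsilon> / 2) ^ k * hit p d (zs @ [i])) \<le> p [] [i] * hit p (k + d) [i]"
    using hit_descendant[of "[i]" zs d] p_child[of "[]" i] assms eps_pos hit_bounds[of "zs @ [i]" d]
    by (intro mult_mono) auto
  also have "\<dots> \<le> root_hit (k + d)"
    unfolding root_hit_def using p_nonneg hit_bounds
    by (intro member_le_sum[where f = "\<lambda>i. p [] [i] * hit p (k + d) [i]"]) (auto intro!: mult_nonneg_nonneg intro: less_imp_le)
  finally show ?thesis .
qed

end

section \<open>The quenched law on stopped paths\<close>

lemma measurable_path_coord: "(\<lambda>X. X k) \<in> path_space \<rightarrow>\<^sub>M count_space UNIV"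
  unfolding path_space_def by simp

lemma space_path_space [simp]: "space path_space = UNIV"
  by (simp add: path_space_def space_PiM)

lemma sets_path_coord: "{X. X k \<in> A} \<in> sets path_space"
  using measurable_sets[OF measurable_path_coord, of A k] by (simp add: vimage_def)

lemma sets_path_stay_from: "{X. \<forall>k\<le>m. X (n + k) \<in> F k} \<in> sets path_space"
proof -
  have "{X. \<forall>k\<le>m. X (n + k) \<in> F k} = (\<Inter>k\<in>{..m}. {X. X (n + k) \<in> F k})"
    by auto
  then show ?thesis
    by (simp only:) (rule sets.finite_INT; simp add: sets_path_coord)
qed

lemma sets_path_stay: "{X. \<forall>k\<le>m. X k \<in> F} \<in> sets path_space"
  using sets_path_stay_from[of m 0 "\<lambda>_. F"] by simp

lemma sets_path_prefix_stay:
  "{X. (\<forall>k\<le>j. X k = xs k) \<and> (\<forall>k\<le>m. X (n + k) \<in> F)} \<in> sets path_space"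
proof -
  have "{X. (\<forall>k\<le>j. X k = xs k) \<and> (\<forall>k\<le>m. X (n + k) \<in> F)} =
      {X. \<forall>k\<le>j. X (0 + k) \<in> {xs k}} \<inter> {X. \<forall>k\<le>m. X (n + k) \<in> F}"
    by auto
  then show ?thesis
    by (simp only:) (intro sets.Int sets_path_stay_from)
qed

context random_environment
begin

text \<open>The prescribed prefix replaces the Markov property: the induction on \<open>m\<close>
  splits the event by the vertex visited at time \<open>Suc j\<close> and moves that vertex into the
  prefix, until only cylinders remain.\<close>

lemma emeasure_prefix_stay:
  assumes w: "w \<in> space M" and F: "finite F"
  shows "xs j \<in> F \<Longrightarrow>
    emeasure (quenched_law (\<omega> w)) {X. (\<forall>k\<le>j. X k = xs k) \<and> (\<forall>k\<le>m. X (j + k) \<in> F)} =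
    ennreal (of_bool (xs 0 = []) * (\<Prod>k<j. \<omega> w (xs k) (xs (Suc k))) * (killed (\<omega> w) F ^^ m) (\<lambda>_. 1) (xs j))"
proof (induction m arbitrary: j xs)
  case 0
  have "{X. (\<forall>k\<le>j. X k = xs k) \<and> (\<forall>k\<le>0. X (j + k) \<in> F)} = {X. \<forall>k\<le>j. X k = xs k}"
    using 0 by auto
  then show ?case by (simp add: prob_quenched_path[OF w])
next
  case (Suc m)
  let ?Q = "quenched_law (\<omega> w)"
  let ?xs = "\<lambda>y. xs(Suc j := y)"
  let ?E = "\<lambda>y. {X. (\<forall>k\<le>Suc j. X k = ?xs y k) \<and> (\<forall>k\<le>m. X (Suc j + k) \<in> F)}"
  let ?c = "of_bool (xs 0 = []) * (\<Prod>k<j. \<omega> w (xs k) (xs (Suc k))) :: real"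
  have c: "0 \<le> ?c" using omega_nonneg[OF w] by (intro mult_nonneg_nonneg prod_nonneg) auto
  have kn: "0 \<le> (killed (\<omega> w) F ^^ m) (\<lambda>_. 1) y" for m y
    by (induction m arbitrary: y) (auto simp: killed_def intro!: sum_nonneg mult_nonneg_nonneg omega_nonneg[OF w])
  have "{X. (\<forall>k\<le>j. X k = xs k) \<and> (\<forall>k\<le>Suc m. X (j + k) \<in> F)} = (\<Union>y\<in>F. ?E y)"
  proof (intro set_eqI iffI)
    fix X assume "X \<in> {X. (\<forall>k\<le>j. X k = xs k) \<and> (\<forall>k\<le>Suc m. X (j + k) \<in> F)}"
    then have X: "\<forall>k\<le>j. X k = xs k" "\<And>k. k \<le> Suc m \<Longrightarrow> X (j + k) \<in> F" by auto
    have "X (Suc j) \<in> F" using X(2)[of 1] by simp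
    moreover have "X (Suc j + k) \<in> F" if "k \<le> m" for k using X(2)[of "Suc k"] that by simp
    ultimately show "X \<in> (\<Union>y\<in>F. ?E y)"
      using X(1) by (intro UN_I[of "X (Suc j)"]) (auto simp: le_Suc_eq)
  next
    fix X assume "X \<in> (\<Union>y\<in>F. ?E y)"
    then obtain y where y: "y \<in> F" "\<And>k. k \<le> Suc j \<Longrightarrow> X k = ?xs y k" "\<And>k. k \<le> m \<Longrightarrow> X (Suc j + k) \<in> F"
      by auto
    have "X k = xs k" if "k \<le> j" for k using y(2)[of k] that by simp
    moreover have "X (j + k) \<in> F" if "k \<le> Suc m" for k
      using y(3)[of "k - 1"] that Suc.prems \<open>\<And>k. k \<le> j \<Longrightarrow> X k = xs k\<close>[of j] by (cases k) auto
    ultimately show "X \<in> {X. (\<forall>k\<le>j. X k = xs k) \<and> (\<forall>k\<le>Suc m. X (j + k) \<in> F)}" by auto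
  qed
  then have "emeasure ?Q {X. (\<forall>k\<le>j. X k = xs k) \<and> (\<forall>k\<le>Suc m. X (j + k) \<in> F)} = emeasure ?Q (\<Union>y\<in>F. ?E y)"
    by simp
  also have "\<dots> = (\<Sum>y\<in>F. emeasure ?Q (?E y))"
  proof (rule sum_emeasure[symmetric, OF _ _ F])
      show "disjoint_family_on ?E F"
      unfolding disjoint_family_on_def by (safe, drule spec[of _ "Suc j"], drule spec[of _ "Suc j"]) auto
    show "?E ` F \<subseteq> sets ?Q"
      unfolding image_subset_iff quenched_law_cylinder(2) by (intro ballI sets_path_prefix_stay)
  qed
  also have "\<dots> = (\<Sum>y\<in>F. ennreal (?c * (\<omega> w (xs j) y * (killed (\<omega> w) F ^^ m) (\<lambda>_. 1) y)))"
  proof (rule sum.cong)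
    fix y assume "y \<in> F"
    have "(\<Prod>k<Suc j. \<omega> w (?xs y k) (?xs y (Suc k))) = (\<Prod>k<j. \<omega> w (xs k) (xs (Suc k))) * \<omega> w (xs j) y"
      by simp
    then show "emeasure ?Q (?E y) = ennreal (?c * (\<omega> w (xs j) y * (killed (\<omega> w) F ^^ m) (\<lambda>_. 1) y))"
      using Suc.IH[of "?xs y" "Suc j"] \<open>y \<in> F\<close> by (simp add: mult.assoc)
  qed simp
  also have "\<dots> = ennreal (\<Sum>y\<in>F. ?c * (\<omega> w (xs j) y * (killed (\<omega> w) F ^^ m) (\<lambda>_. 1) y))"
    using kn omega_nonneg[OF w] by (intro sum_ennreal mult_nonneg_nonneg[OF c] mult_nonneg_nonneg) auto
  finally show ?case
    by (simp add: killed_def[of _ _ "(killed (\<omega> w) F ^^ m) (\<lambda>_. 1)"] sum_distrib_left mult.assoc)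
qed

lemma prob_stay:
  assumes w: "w \<in> space M" and F: "finite F" "[] \<in> F"
  shows "measure (quenched_law (\<omega> w)) {X. \<forall>k\<le>m. X k \<in> F} = (killed (\<omega> w) F ^^ m) (\<lambda>_. 1) []"
proof -
  have kn: "0 \<le> (killed (\<omega> w) F ^^ m) (\<lambda>_. 1) y" for m y
    by (induction m arbitrary: y) (auto simp: killed_def intro!: sum_nonneg mult_nonneg_nonneg omega_nonneg[OF w])
  have root: "AE X in quenched_law (\<omega> w). X 0 = []"
  proof -
    have "emeasure (quenched_law (\<omega> w)) {X. X 0 = []} = 1"
      using prob_quenched_path[OF w, of 0 "\<lambda>_. []"] by simp
    moreover have "{X. X 0 = []} \<in> sets path_space"
      using sets_path_coord[of 0 "{[]}"] by simp
    ultimately show ?thesis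
      using prob_space.AE_iff_emeasure_eq_1[OF prob_space_quenched_law, of "\<lambda>X. X 0 = []" "\<omega> w"]
      by (simp add: pred_def sets_eq_imp_space_eq[OF quenched_law_cylinder(2)] quenched_law_cylinder(2))
  qed
  have "emeasure (quenched_law (\<omega> w)) {X. \<forall>k\<le>m. X k \<in> F} =
      emeasure (quenched_law (\<omega> w)) {X. (\<forall>k\<le>0. X k = []) \<and> (\<forall>k\<le>m. X (0 + k) \<in> F)}"
    using root sets_path_stay sets_path_prefix_stay[where j = 0 and n = 0]
    by (intro emeasure_eq_AE) (auto simp: quenched_law_cylinder(2))
  also have "\<dots> = ennreal ((killed (\<omega> w) F ^^ m) (\<lambda>_. 1) [])"
    using emeasure_prefix_stay[OF w F(1), of "\<lambda>_. []" 0 m] F(2) by simp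
  finally show ?thesis
    using kn by (simp add: measure_def)
qed

end

section \<open>The variational constants\<close>

text \<open>\<open>tilted_mean \<mu> t\<close> is the mean of \<open>ln a\<close> under the law with density proportional to
  \<open>a\<^sup>t\<close>, that is, the derivative of \<open>ln (moment \<mu> t)\<close>.\<close>

definition tilted_mean :: "real measure \<Rightarrow> real \<Rightarrow> real" where
  "tilted_mean \<mu> t = (\<integral>a. ln a * a powr t \<partial>\<mu>) / moment \<mu> t"

locale bounded_ratio_law = prob_space \<mu> for \<mu> :: "real measure" +
  fixes \<epsilon> :: real
  assumes sets_mu [measurable_cong]: "sets \<mu> = sets borel"
    and eps_pos: "0 < \<epsilon>" and eps_le_1: "\<epsilon> \<le> 1"
    and AE_bounds: "AE a in \<mu>. \<epsilon> \<le> a \<and> a \<le> 1 / \<epsilon>"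
begin

lemma AE_ln_bound: "AE a in \<mu>. 0 < a \<and> \<bar>ln a\<bar> \<le> ln (1 / \<epsilon>)"
  using AE_bounds
proof eventually_elim
  case (elim a)
  have a: "0 < a" using elim eps_pos by linarith
  have "ln \<epsilon> \<le> ln a" "ln a \<le> ln (1 / \<epsilon>)"
    using elim eps_pos a by (auto intro!: ln_mono simp del: ln_le_cancel_iff)
  moreover have "ln (1 / \<epsilon>) = - ln \<epsilon>" using eps_pos by (simp add: ln_div)
  ultimately show ?case using a by linarith
qed

lemma powr_bound:
  assumes "0 < a" "\<bar>ln a\<bar> \<le> ln (1 / \<epsilon>)" "\<bar>t\<bar> \<le> C"
  shows "a powr t \<le> exp (C * ln (1 / \<epsilon>))" "exp (- (C * ln (1 / \<epsilon>))) \<le> a powr t"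
proof -
  have "\<bar>t * ln a\<bar> \<le> C * ln (1 / \<epsilon>)"
    using assms unfolding abs_mult by (intro mult_mono) auto
  then show "a powr t \<le> exp (C * ln (1 / \<epsilon>))" "exp (- (C * ln (1 / \<epsilon>))) \<le> a powr t"
    using assms(1) by (auto simp: powr_def)
qed

lemma integrable_powr [simp, intro]: "integrable \<mu> (\<lambda>a. a powr t)"
proof (rule integrable_const_bound)
  show "AE a in \<mu>. norm (a powr t) \<le> exp (\<bar>t\<bar> * ln (1 / \<epsilon>))"
    using AE_ln_bound by eventually_elim (auto intro: powr_bound)
qed measurable

lemma integrable_ln_powr [simp, intro]: "integrable \<mu> (\<lambda>a. ln a * a powr t)"
proof (rule integrable_const_bound)
  show "AE a in \<mu>. norm (ln a * a powr t) \<le> ln (1 / \<epsilon>) * exp (\<bar>t\<bar> * ln (1 / \<epsilon>))"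
    using AE_ln_bound by eventually_elim (auto simp: abs_mult intro!: mult_mono powr_bound)
qed measurable

lemma moment_pos: "0 < moment \<mu> t"
proof -
  have "(\<integral>a. exp (- (\<bar>t\<bar> * ln (1 / \<epsilon>))) \<partial>\<mu>) \<le> moment \<mu> t"
    unfolding moment_def
  proof (intro integral_mono_AE)
    show "AE a in \<mu>. exp (- (\<bar>t\<bar> * ln (1 / \<epsilon>))) \<le> a powr t"
      using AE_ln_bound by eventually_elim (auto intro: powr_bound)
  qed auto
  moreover have "(\<integral>a. exp (- (\<bar>t\<bar> * ln (1 / \<epsilon>))) \<partial>\<mu>) = exp (- (\<bar>t\<bar> * ln (1 / \<epsilon>)))"
    using prob_space by simp
  ultimately show ?thesis
    using exp_gt_zero[of "- (\<bar>t\<bar> * ln (1 / \<epsilon>))"] by linarith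
qed

lemma moment_0: "moment \<mu> 0 = 1"
proof -
  have "moment \<mu> 0 = (\<integral>a. 1 \<partial>\<mu>)"
    unfolding moment_def using AE_ln_bound by (intro integral_cong_AE) (auto elim!: eventually_mono)
  then show ?thesis by (simp add: prob_space)
qed

lemma tilted_mean_0: "tilted_mean \<mu> 0 = (\<integral>a. ln a \<partial>\<mu>)"
proof -
  have "(\<integral>a. ln a * a powr 0 \<partial>\<mu>) = (\<integral>a. ln a \<partial>\<mu>)"
    using AE_ln_bound by (intro integral_cong_AE) (auto elim!: eventually_mono)
  then show ?thesis by (simp add: tilted_mean_def moment_0)
qed

lemma continuous_moment: "continuous_on UNIV (moment \<mu>)"
  and continuous_ln_moment_integral: "continuous_on UNIV (\<lambda>t. \<integral>a. ln a * a powr t \<partial>\<mu>)"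
proof -
  let ?K = "ln (1 / \<epsilon>)"
  \<comment> \<open>One dominated convergence argument serves both claims: \<open>k = 0\<close> is
    the moment, \<open>k = 1\<close> its derivative.\<close>
  have "(\<lambda>n. \<integral>a. ln a ^ k * a powr u n \<partial>\<mu>) \<longlonglongrightarrow> (\<integral>a. ln a ^ k * a powr t \<partial>\<mu>)"
    if u: "u \<longlonglongrightarrow> t" for k :: nat and u t
  proof -
    have "Bseq u" using u by (simp add: convergentI convergent_imp_Bseq)
    then obtain C where C: "\<And>n. \<bar>u n\<bar> \<le> C" by (auto simp: Bseq_def)
    show ?thesis
    proof (rule integral_dominated_convergence[where w = "\<lambda>_. ?K ^ k * exp (C * ?K)"])
      show "AE a in \<mu>. (\<lambda>n. ln a ^ k * a powr u n) \<longlonglongrightarrow> ln a ^ k * a powr t"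
        using AE_ln_bound by eventually_elim (auto intro!: tendsto_intros u)
      show "AE a in \<mu>. norm (ln a ^ k * a powr u n) \<le> ?K ^ k * exp (C * ?K)" for n
        using AE_ln_bound
      proof eventually_elim
        case (elim a)
        have "\<bar>ln a\<bar> ^ k * a powr u n \<le> ?K ^ k * exp (C * ?K)"
          using elim C powr_bound by (intro mult_mono power_mono) auto
        then show ?case by (simp add: abs_mult power_abs)
      qed
    qed auto
  qed
  from this[of _ _ 0] this[of _ _ 1]
  show "continuous_on UNIV (moment \<mu>)" "continuous_on UNIV (\<lambda>t. \<integral>a. ln a * a powr t \<partial>\<mu>)"
    by (auto intro!: continuous_on_sequentiallyI simp: moment_def)
qed

lemma continuous_ln_moment: "continuous_on UNIV (\<lambda>t. ln (moment \<mu> t))"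
  using moment_pos by (intro continuous_intros continuous_moment) (auto simp: less_imp_neq[symmetric])

lemma continuous_tilted_mean: "continuous_on UNIV (tilted_mean \<mu>)"
  unfolding tilted_mean_def using moment_pos
  by (intro continuous_intros continuous_moment continuous_ln_moment_integral) (auto simp: less_imp_neq[symmetric])

text \<open>Jensen's inequality for the tilted law: the supporting line of the exponential at its mean.\<close>

lemma ln_moment_tangent: "ln (moment \<mu> t) + (u - t) * tilted_mean \<mu> t \<le> ln (moment \<mu> u)"
proof -
  let ?c = "(u - t) * tilted_mean \<mu> t"
  have "(\<integral>a. exp ?c * ((1 - ?c) * a powr t + (u - t) * (ln a * a powr t)) \<partial>\<mu>) \<le> moment \<mu> u"
    unfolding moment_def
  proof (intro integral_mono_AE)
    show "AE a in \<mu>. exp ?c * ((1 - ?c) * a powr t + (u - t) * (ln a * a powr t)) \<le> a powr u"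
      using AE_ln_bound
    proof eventually_elim
      case (elim a)
      have "exp ?c * ((1 - ?c) * a powr t + (u - t) * (ln a * a powr t)) =
          a powr t * exp ?c * (1 + ((u - t) * ln a - ?c))"
        by (simp add: algebra_simps)
      also have "\<dots> \<le> a powr t * exp ?c * exp ((u - t) * ln a - ?c)"
        by (intro mult_left_mono exp_ge_add_one_self) auto
      also have "\<dots> = a powr u"
        using elim by (simp add: powr_def mult.assoc flip: exp_add) (simp add: algebra_simps)
      finally show ?case .
    qed
  qed (auto intro!: integrable_mult_right Bochner_Integration.integrable_add)
  also have "(\<integral>a. exp ?c * ((1 - ?c) * a powr t + (u - t) * (ln a * a powr t)) \<partial>\<mu>) =
      exp ?c * ((1 - ?c) * moment \<mu> t + (u - t) * (\<integral>a. ln a * a powr t \<partial>\<mu>))"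
    by (simp add: moment_def)
  also have "(\<integral>a. ln a * a powr t \<partial>\<mu>) = tilted_mean \<mu> t * moment \<mu> t"
    using moment_pos[of t] by (simp add: tilted_mean_def)
  also have "exp ?c * ((1 - ?c) * moment \<mu> t + (u - t) * (tilted_mean \<mu> t * moment \<mu> t)) = exp ?c * moment \<mu> t"
    by (simp add: algebra_simps)
  finally have "ln (exp ?c * moment \<mu> t) \<le> ln (moment \<mu> u)"
    using moment_pos by (intro ln_mono) auto
  then show ?thesis
    using moment_pos[of t] by (simp add: ln_mult)
qed

text \<open>Convexity of the logarithmic moment: the tangents at 0 and at \<open>t\<close>, each
  evaluated at the other point, show that the slope has not decreased.\<close>

lemma r_lower_le: "0 < t \<Longrightarrow> r_lower \<mu> \<le> exp (tilted_mean \<mu> t)"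
proof -
  assume t: "0 < t"
  have "t * tilted_mean \<mu> 0 \<le> ln (moment \<mu> t)"
    using ln_moment_tangent[of 0 t] by (simp add: moment_0)
  moreover have "ln (moment \<mu> t) \<le> t * tilted_mean \<mu> t"
    using ln_moment_tangent[of t 0] by (simp add: moment_0)
  ultimately have "tilted_mean \<mu> 0 \<le> tilted_mean \<mu> t"
    using t by (meson mult_le_cancel_left_pos order_trans)
  then show ?thesis by (simp add: r_lower_def tilted_mean_0)
qed

section \<open>The function \<open>varrho\<close> as a Legendre transform\<close>

lemma bdd_below_varrho: "bdd_below ((\<lambda>t. r powr (- t) * moment \<mu> t) ` {0..})"
  using moment_pos by (intro bdd_belowI[of _ 0]) (auto intro!: mult_nonneg_nonneg intro: less_imp_le)

lemma varrho_le: "0 \<le> t \<Longrightarrow> varrho \<mu> r \<le> r powr (- t) * moment \<mu> t"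
  unfolding varrho_def by (rule cINF_lower[OF bdd_below_varrho]) auto

lemma varrho_antimono: "0 < r \<Longrightarrow> r \<le> r' \<Longrightarrow> varrho \<mu> r' \<le> varrho \<mu> r"
  unfolding varrho_def using moment_pos
  by (intro cINF_mono bdd_below_varrho) (auto intro!: bexI mult_right_mono powr_mono2' intro: less_imp_le)

text \<open>All tangents lie below the logarithmic moment, so for \<open>r\<close> equal to the
  exponential of the slope at \<open>t\<close> the infimum is attained at \<open>t\<close>.\<close>

lemma varrho_tilted:
  assumes "0 \<le> t"
  shows "varrho \<mu> (exp (tilted_mean \<mu> t)) = exp (ln (moment \<mu> t) - t * tilted_mean \<mu> t)"
proof (rule antisym)
  have eq: "exp (tilted_mean \<mu> t) powr (- u) * moment \<mu> u = exp (ln (moment \<mu> u) - u * tilted_mean \<mu> t)" for u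
    using moment_pos[of u] by (simp add: powr_def exp_diff exp_minus field_simps)
  show "varrho \<mu> (exp (tilted_mean \<mu> t)) \<le> exp (ln (moment \<mu> t) - t * tilted_mean \<mu> t)"
    using varrho_le[OF assms, of "exp (tilted_mean \<mu> t)"] unfolding eq .
  show "exp (ln (moment \<mu> t) - t * tilted_mean \<mu> t) \<le> varrho \<mu> (exp (tilted_mean \<mu> t))"
    unfolding varrho_def
  proof (rule cINF_greatest)
    fix u :: real assume "u \<in> {0..}"
    show "exp (ln (moment \<mu> t) - t * tilted_mean \<mu> t) \<le> exp (tilted_mean \<mu> t) powr (- u) * moment \<mu> u"
      unfolding eq using ln_moment_tangent[of t u] by (simp add: algebra_simps)
  qed simp
qed

text \<open>The tangents at \<open>t + h\<close> and \<open>t - h\<close>, evaluated at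
  \<open>t\<close>, bound the increments by slopes that are within \<open>\<delta>\<close> of the
  slope at \<open>t\<close> by continuity. The strict gaps become the decay rates of the tails in
  \<open>heavy_prob_ge\<close>.\<close>

lemma ln_moment_increments:
  assumes "0 < t" "0 < \<delta>"
  obtains h where "0 < h" "h < t"
    "ln (moment \<mu> (t + h)) - ln (moment \<mu> t) < h * (tilted_mean \<mu> t + \<delta>)"
    "ln (moment \<mu> (t - h)) - ln (moment \<mu> t) < - (h * (tilted_mean \<mu> t - \<delta>))"
proof -
  have "isCont (tilted_mean \<mu>) t"
    using continuous_tilted_mean by (simp add: continuous_on_eq_continuous_at)
  then obtain d where d: "0 < d" "\<And>u. \<bar>u - t\<bar> < d \<Longrightarrow> \<bar>tilted_mean \<mu> u - tilted_mean \<mu> t\<bar> < \<delta>"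
    using assms(2) by (metis continuous_at_eps_delta dist_real_def)
  define h where "h = min d t / 2"
  have h: "0 < h" "h < d" "h < t" using d assms by (auto simp: h_def)
  have "tilted_mean \<mu> (t + h) < tilted_mean \<mu> t + \<delta>" "tilted_mean \<mu> t - \<delta> < tilted_mean \<mu> (t - h)"
    using d(2)[of "t + h"] d(2)[of "t - h"] h by auto
  then have "h * tilted_mean \<mu> (t + h) < h * (tilted_mean \<mu> t + \<delta>)"
    "h * (tilted_mean \<mu> t - \<delta>) < h * tilted_mean \<mu> (t - h)"
    using h by auto
  moreover have "ln (moment \<mu> (t + h)) - ln (moment \<mu> t) \<le> h * tilted_mean \<mu> (t + h)"
    "ln (moment \<mu> (t - h)) - ln (moment \<mu> t) \<le> - (h * tilted_mean \<mu> (t - h))"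
    using ln_moment_tangent[of "t + h" t] ln_moment_tangent[of "t - h" t] by auto
  ultimately show ?thesis
    using h(1,3) by (intro that[of h]; linarith)
qed

text \<open>\<open>exp (offspring b t)\<close> is the growth rate of the number of paths along which \<open>ln A\<close>
  averages \<open>tilted_mean \<mu> t\<close>, and \<open>exp (rate b t)\<close> that of the sum of the products of
  \<open>A\<close> over these paths.\<close>

definition offspring :: "nat \<Rightarrow> real \<Rightarrow> real" where
  "offspring b t = ln (real b) + ln (moment \<mu> t) - t * tilted_mean \<mu> t"

definition rate :: "nat \<Rightarrow> real \<Rightarrow> real" where
  "rate b t = ln (real b) + ln (moment \<mu> t) + (1 - t) * tilted_mean \<mu> t"

lemma rate_eq: "rate b t = offspring b t + tilted_mean \<mu> t"
  by (simp add: rate_def offspring_def algebra_simps)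

lemma continuous_offspring: "continuous_on UNIV (offspring b)"
  unfolding offspring_def by (intro continuous_intros continuous_ln_moment continuous_tilted_mean)

lemma continuous_rate: "continuous_on UNIV (rate b)"
  unfolding rate_def by (intro continuous_intros continuous_ln_moment continuous_tilted_mean)

text \<open>\<open>offspring b\<close> starts at \<open>ln b > 0\<close>, so the first point where
  it fails to be positive is a zero; if this does not happen before 1, then
  \<open>t = 1\<close>.\<close>

lemma critical_exponent:
  assumes b: "2 \<le> b"
  obtains t where "0 < t" "t \<le> 1" "\<And>u. 0 \<le> u \<Longrightarrow> u < t \<Longrightarrow> 0 < offspring b u" "t = 1 \<or> offspring b t = 0"
proof (cases "\<forall>u. 0 \<le> u \<and> u < 1 \<longrightarrow> 0 < offspring b u")
  case True
  then show ?thesis by (intro that[of 1]) auto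
next
  case False
  have b0: "0 < offspring b 0" using b by (simp add: offspring_def moment_0)
  define S where "S = {u\<in>{0..1}. offspring b u \<le> 0}"
  have "closed S"
    using closed_Int[OF closed_atLeastAtMost closed_Collect_le[OF continuous_offspring continuous_on_const]]
    by (simp add: S_def Int_def)
  moreover have "S \<noteq> {}" using False unfolding S_def by (auto simp: not_less intro: less_imp_le)
  moreover have bdd: "bdd_below S" unfolding S_def by (intro bdd_belowI[of _ 0]) auto
  ultimately have T: "Inf S \<in> S" by (intro closed_contains_Inf)
  have T_le: "Inf S \<le> u" if "u \<in> S" for u using that bdd by (rule cInf_lower)
  \<comment> \<open>Membership in \<open>S\<close> gives only a nonpositive value at
    \<open>Inf S\<close>. A zero to its left, found by intermediate values, belongs to
    \<open>S\<close> too and hence is \<open>Inf S\<close>.\<close>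
  obtain u where u: "0 \<le> u" "u \<le> Inf S" "offspring b u = 0"
    using IVT2'[of "offspring b" "Inf S" 0 0] T b0 continuous_on_subset[OF continuous_offspring]
    by (auto simp: S_def)
  then have "u \<in> S" using T by (auto simp: S_def)
  with u T_le have "offspring b (Inf S) = 0" by (metis antisym)
  moreover have "Inf S \<noteq> 0" using b0 calculation by auto
  moreover have "0 < offspring b u" if "0 \<le> u" "u < Inf S" for u
  proof (rule ccontr)
    assume "\<not> 0 < offspring b u"
    then have "u \<in> S" using that T by (auto simp: S_def)
    with T_le that show False by fastforce
  qed
  moreover have "Inf S \<in> {0..1}" using T S_def by blast
  ultimately show ?thesis
    by (intro that[of "Inf S"]) (auto simp only: atLeastAtMost_iff less_le)
qed

section \<open>The value of \<open>q\<close> at the critical exponent\<close>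

context
  fixes b :: nat
  assumes b: "2 \<le> b" and p_lt: "p_const \<mu> < 1 / real b"
begin

lemma moment_lt: obtains t where "0 \<le> t" "t \<le> 1" "moment \<mu> t < 1 / real b"
proof -
  have "bdd_below (moment \<mu> ` {0..1})"
    using moment_pos by (intro bdd_belowI[of _ 0]) (auto intro: less_imp_le)
  then show ?thesis
    using p_lt that unfolding p_const_def by (subst (asm) cINF_less_iff) auto
qed

lemma r_upper_set: "1 \<in> {r. 0 < r \<and> varrho \<mu> r \<le> 1 / real b}"
proof -
  obtain t where "0 \<le> t" "t \<le> 1" "moment \<mu> t < 1 / real b" by (rule moment_lt)
  then show ?thesis using varrho_le[of t 1] by simp
qed

lemma r_upper_le: "0 < r \<Longrightarrow> varrho \<mu> r \<le> 1 / real b \<Longrightarrow> r_upper \<mu> b \<le> r"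
  unfolding r_upper_def by (rule cInf_lower) (auto intro!: bdd_belowI[of _ 0])

lemma r_upper_ge:
  assumes "0 \<le> t" "0 < offspring b t"
  shows "exp (tilted_mean \<mu> t) \<le> r_upper \<mu> b"
  unfolding r_upper_def
proof (rule cInf_greatest)
  fix r assume r: "r \<in> {r. 0 < r \<and> varrho \<mu> r \<le> 1 / real b}"
  show "exp (tilted_mean \<mu> t) \<le> r"
  proof (rule ccontr)
    assume "\<not> ?thesis"
    then have "varrho \<mu> (exp (tilted_mean \<mu> t)) \<le> varrho \<mu> r"
      using r by (intro varrho_antimono) auto
    then have "exp (ln (moment \<mu> t) - t * tilted_mean \<mu> t) \<le> exp (- ln (real b))"
      using r b assms(1) by (simp add: varrho_tilted exp_minus inverse_eq_divide)
    then show False using assms(2) by (simp add: offspring_def)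
  qed
qed (use r_upper_set in blast)

text \<open>For the upper bound, \<open>varrho\<close> is tested with the exponent \<open>t\<close>.
  If \<open>t < 1\<close>, then \<open>varrho\<close> equals \<open>1 / b\<close> at
  \<open>exp (tilted_mean \<mu> t)\<close>, so \<open>r_upper\<close> does not exceed this point; if
  \<open>t = 1\<close>, the power of \<open>r\<close> disappears. For the lower bound, the points
  \<open>exp (tilted_mean \<mu> u)\<close> with \<open>u < t\<close> lie in the interval and have
  the value \<open>exp (rate b u) / b\<close>. The last equation matches the exponent of the
  fractional moment bound.\<close>

lemma q_const_critical:
  assumes t: "0 < t" "t \<le> 1" "\<And>u. 0 \<le> u \<Longrightarrow> u < t \<Longrightarrow> 0 < offspring b u" "t = 1 \<or> offspring b t = 0"
  shows "q_const \<mu> b * real b = exp (rate b t)" "rate b t < 0"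
    "(ln (real b) + ln (moment \<mu> t)) / t = rate b t"
proof -
  have b0: "0 < real b" using b by simp
  have exp_rate: "exp (rate b u) / real b = moment \<mu> u * exp ((1 - u) * tilted_mean \<mu> u)" for u
    using moment_pos[of u] b0 by (simp add: rate_def exp_add)
  have bound: "r * varrho \<mu> r \<le> r powr (1 - u) * moment \<mu> u" if "0 < r" "0 \<le> u" for r u
  proof -
    have "r * varrho \<mu> r \<le> r * (r powr (- u) * moment \<mu> u)"
      using that by (intro mult_left_mono varrho_le) auto
    also have "\<dots> = r powr (1 - u) * moment \<mu> u"
      using that by (simp add: powr_diff powr_minus divide_inverse)
    finally show ?thesis .
  qed
  have rl: "0 < r_lower \<mu>" by (simp add: r_lower_def)
  have upper: "r * varrho \<mu> r \<le> exp (rate b t) / real b" if "r \<in> {r_lower \<mu>..r_upper \<mu> b}" for r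
  proof -
    have r: "0 < r" "r \<le> r_upper \<mu> b" using that rl by auto
    have "r powr (1 - t) \<le> exp ((1 - t) * tilted_mean \<mu> t)"
    proof (cases "t = 1")
      case False
      then have "ln (moment \<mu> t) - t * tilted_mean \<mu> t = - ln (real b)"
        using t(4) by (simp add: offspring_def)
      then have "varrho \<mu> (exp (tilted_mean \<mu> t)) = 1 / real b"
        using t(1) b0 by (simp add: varrho_tilted exp_minus inverse_eq_divide)
      then have "r \<le> exp (tilted_mean \<mu> t)"
        using r r_upper_le[of "exp (tilted_mean \<mu> t)"] by simp
      then have "r powr (1 - t) \<le> exp (tilted_mean \<mu> t) powr (1 - t)"
        using r t(2) by (intro powr_mono2) auto
      then show ?thesis by (simp add: powr_def)
    qed (use r in simp)
    then have "r powr (1 - t) * moment \<mu> t \<le> exp ((1 - t) * tilted_mean \<mu> t) * moment \<mu> t"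
      using moment_pos[of t] by (intro mult_right_mono) auto
    also have "\<dots> = exp (rate b t) / real b" by (simp add: exp_rate)
    finally show ?thesis
      using bound[of r t] r(1) t(1) by linarith
  qed
  have bdd: "bdd_above ((\<lambda>r. r * varrho \<mu> r) ` {r_lower \<mu>..r_upper \<mu> b})"
    using upper by (intro bdd_aboveI[of _ "exp (rate b t) / real b"]) auto
  have mem: "exp (tilted_mean \<mu> u) \<in> {r_lower \<mu>..r_upper \<mu> b}" if "0 < u" "u < t" for u
    using that r_lower_le r_upper_ge t(3) by auto
  have ne: "{r_lower \<mu>..r_upper \<mu> b} \<noteq> {}"
    using mem[of "t / 2"] t(1) by auto
  have lower: "exp (rate b u) / real b \<le> q_const \<mu> b" if "0 < u" "u < t" for u
  proof -
    have "exp (rate b u) / real b = exp (tilted_mean \<mu> u) * varrho \<mu> (exp (tilted_mean \<mu> u))"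
      using that moment_pos[of u] unfolding exp_rate
      by (simp add: varrho_tilted exp_diff left_diff_distrib)
    then show ?thesis
      unfolding q_const_def using cSUP_upper[OF mem[OF that] bdd] by simp
  qed
  \<comment> \<open>\<open>offspring\<close> may vanish at \<open>t\<close>, where
    \<open>r_upper_ge\<close> does not apply, so the lower bound at \<open>t\<close> is a limit from
    the left.\<close>
  have "isCont (\<lambda>u. exp (rate b u) / real b) t"
    using continuous_rate[of b] b0 by (intro continuous_intros) (auto simp: continuous_on_eq_continuous_at)
  then have "((\<lambda>u. exp (rate b u) / real b) \<longlongrightarrow> exp (rate b t) / real b) (at_left t)"
    by (simp add: isCont_def filterlim_at_split)
  moreover have "eventually (\<lambda>u. exp (rate b u) / real b \<le> q_const \<mu> b) (at_left t)"
    using eventually_at_left_real[OF t(1)] by eventually_elim (auto intro: lower)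
  ultimately have "exp (rate b t) / real b \<le> q_const \<mu> b"
    by (rule tendsto_upperbound) simp
  moreover have "q_const \<mu> b \<le> exp (rate b t) / real b"
    unfolding q_const_def using ne upper by (rule cSUP_least)
  ultimately have q: "q_const \<mu> b = exp (rate b t) / real b" by simp
  then show qb: "q_const \<mu> b * real b = exp (rate b t)" using b0 by simp
  \<comment> \<open>As \<open>r_upper \<le> 1\<close>, one fixed moment below \<open>1 / b\<close>
    bounds the whole supremum; this makes the inequality for \<open>q\<close> strict.\<close>
  obtain u where u: "0 \<le> u" "u \<le> 1" "moment \<mu> u < 1 / real b" by (rule moment_lt)
  have "q_const \<mu> b \<le> moment \<mu> u"
    unfolding q_const_def
  proof (rule cSUP_least[OF ne])
    fix r assume "r \<in> {r_lower \<mu>..r_upper \<mu> b}"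
    moreover have "r_upper \<mu> b \<le> 1" using r_upper_set r_upper_le by auto
    ultimately have r: "0 < r" "r \<le> 1" using rl by auto
    have "r powr (1 - u) \<le> 1" using r u by (intro powr_le1) auto
    then have "r powr (1 - u) * moment \<mu> u \<le> 1 * moment \<mu> u"
      using moment_pos[of u] by (intro mult_right_mono) auto
    with bound[OF r(1) u(1)] show "r * varrho \<mu> r \<le> moment \<mu> u" by simp
  qed
  with u(3) have "q_const \<mu> b < 1 / real b" by linarith
  then have "q_const \<mu> b * real b < 1" using b0 by (simp add: field_simps)
  with qb show "rate b t < 0" by simp
  show "(ln (real b) + ln (moment \<mu> t)) / t = rate b t"
  proof (cases "t = 1")
    case False
    then have "ln (real b) + ln (moment \<mu> t) = t * tilted_mean \<mu> t"
      using t(4) by (simp add: offspring_def)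
    then show ?thesis
      using t(1) unfolding rate_def by (simp add: algebra_simps)
  qed (simp add: rate_def)
qed

end

end

section \<open>Independence and level sums in the random environment\<close>

text \<open>After division by the sum all terms lie in \<open>[0, 1]\<close>, where raising to a
  power \<open>t \<le> 1\<close> does not decrease them.\<close>

lemma sum_powr_le:
  fixes f :: "'i \<Rightarrow> real"
  assumes "finite I" "\<And>i. i \<in> I \<Longrightarrow> 0 \<le> f i" "0 < t" "t \<le> 1"
  shows "(\<Sum>i\<in>I. f i) powr t \<le> (\<Sum>i\<in>I. f i powr t)"
proof (cases "(\<Sum>i\<in>I. f i) = 0")
  case True
  then show ?thesis by (simp add: sum_nonneg)
next
  case False
  define S where "S = (\<Sum>i\<in>I. f i)"
  have S: "0 < S" using False assms(2) unfolding S_def by (simp add: less_le sum_nonneg)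
  have "f i / S \<le> (f i / S) powr t" if "i \<in> I" for i
  proof (cases "f i = 0")
    case False
    have "f i \<le> S" unfolding S_def using assms that by (intro member_le_sum) auto
    then have "(f i / S) powr 1 \<le> (f i / S) powr t"
      using False assms(2)[OF that] assms(3,4) S by (intro powr_mono') (auto simp: field_simps)
    then show ?thesis using assms(2)[OF that] S by simp
  qed simp
  then have "(\<Sum>i\<in>I. f i / S) \<le> (\<Sum>i\<in>I. (f i / S) powr t)"
    by (rule sum_mono)
  also have "\<dots> = (\<Sum>i\<in>I. f i powr t) / S powr t"
    unfolding sum_divide_distrib using assms(2) S by (intro sum.cong) (auto simp: powr_divide)
  finally have "1 \<le> (\<Sum>i\<in>I. f i powr t) / S powr t"
    using S by (simp add: S_def flip: sum_divide_distrib)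
  then show ?thesis
    using S by (simp add: S_def[symmetric] field_simps)
qed

section \<open>Locality and independence\<close>

definition descendants :: "'b list \<Rightarrow> 'b list set" where
  "descendants x = range (\<lambda>zs. zs @ x)"

text \<open>\<open>A\<close> at a vertex is determined by the row of its parent, so weights of paths
  of length \<open>L\<close> from \<open>x\<close> depend on the rows in this block only. The strict
  bound keeps it disjoint from the subtrees rooted \<open>L\<close> generations below
  \<open>x\<close>.\<close>

definition block :: "nat \<Rightarrow> 'b list \<Rightarrow> 'b list set" where
  "block L x = {zs @ x | zs. length zs < L}"

lemma descendants_append: "descendants (zs @ x) \<subseteq> descendants x"
  by (auto simp: descendants_def)

lemma block_subset: "block L x \<subseteq> descendants x"
  by (auto simp: descendants_def block_def)

lemma descendants_not_root: "x \<noteq> [] \<Longrightarrow> descendants x \<subseteq> UNIV - {[]}"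
  by (auto simp: descendants_def)

lemma block_disjoint: "length zs = L \<Longrightarrow> block L x \<inter> descendants (zs @ x) = {}"
  by (auto simp: block_def descendants_def)

lemma descendants_disjoint:
  "length x = length y \<Longrightarrow> x \<noteq> y \<Longrightarrow> descendants x \<inter> descendants y = {}"
  by (auto simp: descendants_def)

context random_environment
begin

text \<open>The sigma-algebra generated by the rows at the vertices of \<open>K\<close>.
  Measurability for it says that a functional depends on these rows only; disjoint vertex sets then
  give independence.\<close>

definition local_events :: "'b list set \<Rightarrow> 'w measure" where
  "local_events K = vimage_algebra (space M) (\<lambda>w. \<lambda>z\<in>K. omega_vec (\<omega> w) z)
     (PiM K (\<lambda>_. PiM UNIV (\<lambda>_. borel)))"

lemma space_local_events [simp]: "space (local_events K) = space M"
  by (simp add: local_events_def)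

lemma restrict_env_in_space:
  "(\<lambda>w. \<lambda>z\<in>K. omega_vec (\<omega> w) z) \<in> X \<rightarrow> space (PiM K (\<lambda>_. PiM UNIV (\<lambda>_. borel)))"
  by (auto simp: space_PiM)

lemma measurable_restrict_env:
  "(\<lambda>w. \<lambda>z\<in>K. omega_vec (\<omega> w) z) \<in> local_events K \<rightarrow>\<^sub>M PiM K (\<lambda>_. PiM UNIV (\<lambda>_. borel))"
  unfolding local_events_def by (rule measurable_vimage_algebra1[OF restrict_env_in_space])

lemma local_events_mono:
  assumes "K \<subseteq> K'" "X \<in> local_events K \<rightarrow>\<^sub>M N"
  shows "X \<in> local_events K' \<rightarrow>\<^sub>M N"
proof -
  have "(\<lambda>w. restrict (\<lambda>z\<in>K'. omega_vec (\<omega> w) z) K) \<in> local_events K' \<rightarrow>\<^sub>M PiM K (\<lambda>_. PiM UNIV (\<lambda>_. borel))"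
    by (rule measurable_compose[OF measurable_restrict_env measurable_restrict_subset[OF assms(1)]])
  then have "(\<lambda>w. \<lambda>z\<in>K. omega_vec (\<omega> w) z) \<in> local_events K' \<rightarrow>\<^sub>M PiM K (\<lambda>_. PiM UNIV (\<lambda>_. borel))"
    using assms(1) by (simp add: Int_absorb1)
  then have "(\<lambda>w. w) \<in> local_events K' \<rightarrow>\<^sub>M local_events K"
    unfolding local_events_def[of K] by (intro measurable_vimage_algebra2) auto
  from measurable_compose[OF this assms(2)] show ?thesis .
qed

lemma measurable_local_omega_vec:
  assumes "z \<in> K"
  shows "(\<lambda>w. omega_vec (\<omega> w) z k) \<in> borel_measurable (local_events K)"
proof -
  have "(\<lambda>w. (\<lambda>z\<in>K. omega_vec (\<omega> w) z) z k) \<in> borel_measurable (local_events K)"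
    by (rule measurable_compose[OF measurable_compose[OF measurable_restrict_env
          measurable_component_singleton[OF assms]] measurable_component_singleton[OF UNIV_I]])
  then show ?thesis using assms by simp
qed

lemma measurable_local_A_ratio:
  assumes "x \<in> K"
  shows "(\<lambda>w. A_ratio (\<omega> w) (i # x)) \<in> borel_measurable (local_events K)"
proof -
  have "(\<lambda>w. omega_vec (\<omega> w) x (Some i) / omega_vec (\<omega> w) x None) \<in> borel_measurable (local_events K)"
    by (intro borel_measurable_divide measurable_local_omega_vec assms)
  then show ?thesis by (simp add: A_ratio_def omega_vec_def)
qed

lemma measurable_omega_vec: "(\<lambda>w. omega_vec (\<omega> w) x) \<in> M \<rightarrow>\<^sub>M PiM UNIV (\<lambda>_. borel)"
proof (rule measurable_PiM_single')
  show "(\<lambda>w. omega_vec (\<omega> w) x k) \<in> borel_measurable M" for k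
    by (cases k) (simp_all add: omega_vec_def omega_measurable)
qed simp

lemma local_events_measurable:
  assumes "X \<in> local_events K \<rightarrow>\<^sub>M N"
  shows "X \<in> M \<rightarrow>\<^sub>M N"
proof -
  have "(\<lambda>w. w) \<in> M \<rightarrow>\<^sub>M local_events K"
    unfolding local_events_def
    by (intro measurable_vimage_algebra2 measurable_restrict measurable_omega_vec) auto
  from measurable_compose[OF this assms] show ?thesis .
qed

lemma indep_vars_local:
  assumes X: "\<And>j. j \<in> J \<Longrightarrow> X j \<in> local_events (K j) \<rightarrow>\<^sub>M N j"
    and K: "\<And>j. j \<in> J \<Longrightarrow> K j \<subseteq> UNIV - {[]}" "disjoint_family_on K J"
  shows "indep_vars N X J"
  unfolding indep_vars_def2
proof
  show "\<forall>j\<in>J. X j \<in> M \<rightarrow>\<^sub>M N j"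
    using X local_events_measurable by blast
  have "indep_vars (\<lambda>j. PiM (K j) (\<lambda>_. PiM UNIV (\<lambda>_. borel))) (\<lambda>j w. \<lambda>z\<in>K j. omega_vec (\<omega> w) z) J"
    by (rule indep_vars_restrict[OF omega_indep K])
  then have "indep_sets (\<lambda>j. {(\<lambda>w. \<lambda>z\<in>K j. omega_vec (\<omega> w) z) -` A \<inter> space M | A.
      A \<in> sets (PiM (K j) (\<lambda>_. PiM UNIV (\<lambda>_. borel)))}) J"
    unfolding indep_vars_def2 by simp
  then have "indep_sets (\<lambda>j. sets (local_events (K j))) J"
    unfolding local_events_def sets_vimage_algebra2[OF restrict_env_in_space] .
  then show "indep_sets (\<lambda>j. {X j -` A \<inter> space M | A. A \<in> sets (N j)}) J"
  proof (rule indep_sets_mono_sets)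
    show "{X j -` A \<inter> space M | A. A \<in> sets (N j)} \<subseteq> sets (local_events (K j))" if "j \<in> J" for j
      using measurable_sets[OF X[OF that]] by auto
  qed
qed

lemma indep_var_local:
  assumes X: "X \<in> local_events K \<rightarrow>\<^sub>M N" and Y: "Y \<in> local_events K' \<rightarrow>\<^sub>M N'"
    and K: "K \<subseteq> UNIV - {[]}" "K' \<subseteq> UNIV - {[]}" "K \<inter> K' = {}"
  shows "indep_var N X N' Y"
  unfolding indep_var_def
  by (rule indep_vars_local[where K = "case_bool K K'"])
    (use assms in \<open>auto simp: disjoint_family_on_def split: bool.splits\<close>)

lemma expectation_local_mult:
  fixes X Y :: "'w \<Rightarrow> real"
  assumes "X \<in> borel_measurable (local_events K)" "Y \<in> borel_measurable (local_events K')"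
    and "K \<subseteq> UNIV - {[]}" "K' \<subseteq> UNIV - {[]}" "K \<inter> K' = {}"
    and "integrable M X" "integrable M Y"
  shows "expectation (\<lambda>w. X w * Y w) = expectation X * expectation Y"
  using indep_var_lebesgue_integral[OF indep_var_local[OF assms(1-5)] assms(6,7)] .

end

section \<open>Moments of path weights and growth of level sums\<close>

locale environment_law = random_environment M \<omega>
  for M :: "'w measure" and \<omega> :: "'w \<Rightarrow> 'b::finite list \<Rightarrow> 'b list \<Rightarrow> real" +
  fixes \<mu> :: "real measure" and \<epsilon> :: real
  assumes law_A: "\<And>x. length x \<ge> 2 \<Longrightarrow> distr M borel (\<lambda>w. A_ratio (\<omega> w) x) = \<mu>"
    and AE_elliptic: "AE w in M. elliptic_environment (\<omega> w) \<epsilon>"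
begin

lemma A_ratio_law: "x \<noteq> [] \<Longrightarrow> distr M borel (\<lambda>w. A_ratio (\<omega> w) (i # x)) = \<mu>"
  by (rule law_A) (cases x; simp)

lemma measurable_A_ratio [measurable]: "(\<lambda>w. A_ratio (\<omega> w) (i # x)) \<in> borel_measurable M"
  using local_events_measurable[OF measurable_local_A_ratio[of x UNIV i]] by simp

lemma A_nonneg: "w \<in> space M \<Longrightarrow> 0 \<le> A_ratio (\<omega> w) x"
  by (simp add: A_ratio_def omega_nonneg)

sublocale mu: bounded_ratio_law \<mu> \<epsilon>
proof -
  let ?x = "[undefined, undefined] :: 'b list"
  have mu: "\<mu> = distr M borel (\<lambda>w. A_ratio (\<omega> w) ?x)"
    by (simp add: law_A)
  have "AE w in M. 0 < \<epsilon> \<and> \<epsilon> \<le> 1"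
    using AE_elliptic by eventually_elim (simp add: elliptic_environment.eps_pos elliptic_environment.eps_le_1)
  then have eps: "0 < \<epsilon>" "\<epsilon> \<le> 1" by simp_all
  have "prob_space \<mu>"
    unfolding mu by (rule prob_space_distr) measurable
  moreover have "AE a in \<mu>. \<epsilon> \<le> a \<and> a \<le> 1 / \<epsilon>"
    unfolding mu
  proof (subst AE_distr_iff)
    show "AE w in M. \<epsilon> \<le> A_ratio (\<omega> w) ?x \<and> A_ratio (\<omega> w) ?x \<le> 1 / \<epsilon>"
      using AE_elliptic by eventually_elim (simp add: elliptic_environment.A_bounds)
  qed measurable
  moreover have "sets \<mu> = sets borel" unfolding mu by simp
  ultimately show "bounded_ratio_law \<mu> \<epsilon>"
    using eps by (simp add: bounded_ratio_law_def bounded_ratio_law_axioms_def)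
qed

lemma expectation_A_powr: "x \<noteq> [] \<Longrightarrow> expectation (\<lambda>w. A_ratio (\<omega> w) (i # x) powr t) = moment \<mu> t"
  unfolding moment_def A_ratio_law[symmetric, of x i] by (subst integral_distr) auto

lemma path_weight_nonneg: "w \<in> space M \<Longrightarrow> 0 \<le> path_weight (\<omega> w) zs x"
  by (induction zs) (auto simp: A_nonneg)

lemma measurable_local_path_weight:
  "(\<lambda>w. path_weight (\<omega> w) zs x) \<in> borel_measurable (local_events (block (length zs) x))"
proof (induction zs)
  case (Cons i zs)
  have "(\<lambda>w. path_weight (\<omega> w) zs x) \<in> borel_measurable (local_events (block (length (i # zs)) x))"
    by (rule local_events_mono[OF _ Cons]) (auto simp: block_def)
  moreover have "(\<lambda>w. A_ratio (\<omega> w) (i # zs @ x)) \<in> borel_measurable (local_events (block (length (i # zs)) x))"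
    by (rule measurable_local_A_ratio) (auto simp: block_def)
  ultimately show ?case by simp
qed simp

lemma measurable_path_weight [measurable]: "(\<lambda>w. path_weight (\<omega> w) zs x) \<in> borel_measurable M"
  by (rule local_events_measurable[OF measurable_local_path_weight])

lemma AE_path_weight_bounds:
  assumes "x \<noteq> []"
  shows "AE w in M. 0 < path_weight (\<omega> w) zs x \<and> path_weight (\<omega> w) zs x \<le> (1 / \<epsilon>) ^ length zs"
  using AE_elliptic
  by eventually_elim
    (use assms in \<open>simp add: elliptic_environment.path_weight_bounds elliptic_environment.path_weight_pos\<close>)

lemma integrable_path_weight_powr:
  assumes "x \<noteq> []" "0 \<le> t"
  shows "integrable M (\<lambda>w. path_weight (\<omega> w) zs x powr t)"
proof (rule integrable_const_bound)
  show "AE w in M. norm (path_weight (\<omega> w) zs x powr t) \<le> ((1 / \<epsilon>) ^ length zs) powr t"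
    using AE_path_weight_bounds[OF assms(1), of zs]
    by eventually_elim (use assms(2) in \<open>auto intro!: powr_mono2\<close>)
qed measurable

lemma integrable_A_powr:
  assumes "x \<noteq> []" "0 \<le> t"
  shows "integrable M (\<lambda>w. A_ratio (\<omega> w) (i # x) powr t)"
  using integrable_path_weight_powr[OF assms, of "[i]"] by simp

lemma block_step_disjoint:
  "block (length zs) x \<inter> {zs @ x} = {}"
  by (auto simp: block_def)

lemma block_not_root: "x \<noteq> [] \<Longrightarrow> block L x \<subseteq> UNIV - {[]}"
  using block_subset descendants_not_root by blast

text \<open>Along one path the ratios \<open>A\<close> are read off the rows of distinct vertices
  and so are independent, whereas siblings share a row.\<close>

lemma expectation_path_weight_powr:
  "x \<noteq> [] \<Longrightarrow> 0 \<le> t \<Longrightarrow> expectation (\<lambda>w. path_weight (\<omega> w) zs x powr t) = moment \<mu> t ^ length zs"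
proof (induction zs)
  case (Cons i zs)
  have "expectation (\<lambda>w. path_weight (\<omega> w) (i # zs) x powr t) =
      expectation (\<lambda>w. path_weight (\<omega> w) zs x powr t * A_ratio (\<omega> w) (i # zs @ x) powr t)"
    by (intro Bochner_Integration.integral_cong) (auto simp: powr_mult path_weight_nonneg A_nonneg)
  also have "\<dots> = expectation (\<lambda>w. path_weight (\<omega> w) zs x powr t) *
      expectation (\<lambda>w. A_ratio (\<omega> w) (i # zs @ x) powr t)"
  proof (rule expectation_local_mult[OF _ _ _ _ block_step_disjoint])
    show "(\<lambda>w. path_weight (\<omega> w) zs x powr t) \<in> borel_measurable (local_events (block (length zs) x))"
      by (intro powr_real_measurable measurable_local_path_weight) simp
    show "(\<lambda>w. A_ratio (\<omega> w) (i # zs @ x) powr t) \<in> borel_measurable (local_events {zs @ x})"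
      by (intro powr_real_measurable measurable_local_A_ratio) simp_all
  qed (use Cons.prems block_not_root integrable_A_powr integrable_path_weight_powr in auto)
  finally show ?case
    using Cons by (simp add: expectation_A_powr)
qed (simp add: prob_space)

text \<open>The power \<open>t \<le> 1\<close> of the level sum is at most \<open>Y k\<close>, whose
  mean is explicit; the margin \<open>\<delta>\<close> makes the Markov bounds summable.\<close>

lemma AE_level_sum:
  assumes x: "x \<noteq> []" and t: "0 < t" "t \<le> 1" and \<delta>: "0 < \<delta>"
  defines "c \<equiv> (ln (real CARD('b)) + ln (moment \<mu> t)) / t + \<delta>"
  shows "AE w in M. eventually (\<lambda>k. level_sum (\<omega> w) k x < exp (real k * c)) sequentially"
proof -
  define Y where "Y = (\<lambda>k w. \<Sum>zs\<in>words k. path_weight (\<omega> w) zs x powr t)"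
  have int: "integrable M (Y k)" for k
    unfolding Y_def using x t by (intro Bochner_Integration.integrable_sum integrable_path_weight_powr) auto
  have mb: "0 < moment \<mu> t" "0 < real CARD('b)" using mu.moment_pos branching by auto
  have EY: "expectation (Y k) = exp (real k * (ln (real CARD('b)) + ln (moment \<mu> t)))" for k
  proof -
    have "expectation (Y k) = (\<Sum>zs\<in>words k. expectation (\<lambda>w. path_weight (\<omega> w) zs x powr t))"
      unfolding Y_def using x t by (intro Bochner_Integration.integral_sum integrable_path_weight_powr) auto
    also have "\<dots> = (\<Sum>zs\<in>(words k :: 'b list set). moment \<mu> t ^ k)"
      using x t by (intro sum.cong) (auto simp: expectation_path_weight_powr words_def)
    also have "\<dots> = (real CARD('b) * moment \<mu> t) ^ k"
      by (simp add: card_words power_mult_distrib)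
    also have "real CARD('b) * moment \<mu> t = exp (ln (real CARD('b)) + ln (moment \<mu> t))"
      using mb by (simp add: exp_add)
    finally show ?thesis by (simp flip: exp_of_nat_mult)
  qed
  define E where "E = (\<lambda>k. {w\<in>space M. exp (real k * (c * t)) \<le> Y k w})"
  have E_sets: "E k \<in> events" for k
    using borel_measurable_integrable[OF int[of k]] unfolding E_def by measurable
  have PE: "prob (E k) \<le> exp (- (\<delta> * t)) ^ k" for k
  proof -
    have "prob (E k) \<le> expectation (Y k) / exp (real k * (c * t))"
      unfolding E_def by (rule integral_Markov_inequality_measure[OF int, where A = "space M"])
        (auto simp: Y_def intro!: sum_nonneg)
    also have "\<dots> = exp (real k * - (\<delta> * t))"
      using t(1) unfolding EY c_def by (simp add: algebra_simps add_divide_distrib flip: exp_diff)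
    finally show ?thesis by (simp flip: exp_of_nat_mult)
  qed
  have "summable (\<lambda>k. prob (E k))"
    using PE t \<delta> by (intro summable_comparison_test'[OF summable_geometric[of "exp (- (\<delta> * t))"]]) auto
  then have "AE w in M. eventually (\<lambda>k. w \<in> space M - E k) sequentially"
    by (intro borel_cantelli_AE1) (auto simp: E_sets emeasure_eq_measure)
  then show ?thesis
    using AE_space AE_elliptic
  proof eventually_elim
    case (elim w)
    interpret elliptic_environment "\<omega> w" \<epsilon> by fact
    from elim(1) show ?case
    proof eventually_elim
      case (elim k)
      have "level_sum (\<omega> w) k x powr t \<le> Y k w"
        unfolding level_sum_def Y_def using path_weight_pos[OF x] t
        by (intro sum_powr_le) (auto intro: less_imp_le)
      also have "\<dots> < exp (real k * (c * t))"
        using elim by (auto simp: E_def)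
      also have "\<dots> = exp (real k * c) powr t" by (simp add: powr_def mult_ac)
      finally show ?case
        using t(1) level_sum_nonneg[OF x, of k] powr_mono2[of t "exp (real k * c)" "level_sum (\<omega> w) k x"]
        by (auto simp: not_less[symmetric])
    qed
  qed
qed

end

section \<open>Sparse subtrees of heavy paths\<close>

definition heavy_sum ::
    "('b::finite list \<Rightarrow> 'b list \<Rightarrow> real) \<Rightarrow> nat \<Rightarrow> real \<Rightarrow> ('b list \<Rightarrow> real) \<Rightarrow> 'b list \<Rightarrow> real" where
  "heavy_sum p L r f x = (\<Sum>zs\<in>words L. of_bool (r \<le> path_weight p zs x) * f (zs @ x))"

text \<open>A lower bound for \<open>hit p (k * L)\<close> that uses, in each block of \<open>L\<close> generations, only the
  paths of weight at least \<open>r\<close>, and replaces their weight by \<open>r\<close>.\<close>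

primrec sparse_hit ::
    "('b::finite list \<Rightarrow> 'b list \<Rightarrow> real) \<Rightarrow> nat \<Rightarrow> real \<Rightarrow> real \<Rightarrow> real \<Rightarrow> nat \<Rightarrow> 'b list \<Rightarrow> real" where
  "sparse_hit p L r C e 0 x = e"
| "sparse_hit p L r C e (Suc k) x =
     r * heavy_sum p L r (sparse_hit p L r C e k) x / (1 + C * heavy_sum p L r (sparse_hit p L r C e k) x)"

lemma heavy_sum_nonneg: "(\<And>y. 0 \<le> f y) \<Longrightarrow> 0 \<le> heavy_sum p L r f x"
  unfolding heavy_sum_def by (intro sum_nonneg mult_nonneg_nonneg) auto

lemma sparse_hit_nonneg:
  "0 \<le> r \<Longrightarrow> 0 \<le> C \<Longrightarrow> 0 \<le> e \<Longrightarrow> 0 \<le> sparse_hit p L r C e k x"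
proof (induction k arbitrary: x)
  case (Suc k)
  then have "0 \<le> heavy_sum p L r (sparse_hit p L r C e k) x"
    by (intro heavy_sum_nonneg) auto
  then show ?case using Suc.prems by simp
qed simp

text \<open>\<open>U / (1 + C * U)\<close> saturates at \<open>1 / C\<close>. The bound is uniform
  in the environment and settles all integrability questions below.\<close>

lemma sparse_hit_bound:
  assumes "0 \<le> r" "0 < C" "0 \<le> e"
  shows "sparse_hit p L r C e k x \<le> e + r / C"
proof (cases k)
  case (Suc j)
  define U where "U = heavy_sum p L r (sparse_hit p L r C e j) x"
  have U: "0 \<le> U" unfolding U_def using assms by (intro heavy_sum_nonneg sparse_hit_nonneg) auto
  have "r * U * C \<le> r * (1 + C * U)" using assms by (simp add: algebra_simps)
  moreover have "0 < 1 + C * U" using U assms by (simp add: add_pos_nonneg)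
  ultimately have "r * U / (1 + C * U) \<le> r / C"
    using assms(2) by (simp add: divide_simps)
  then show ?thesis using Suc assms(3) by (simp add: U_def)
qed (use assms in simp)

lemma (in elliptic_environment) sparse_hit_le_hit:
  assumes "0 \<le> r" "0 \<le> e" "e \<le> 1"
  shows "x \<noteq> [] \<Longrightarrow> sparse_hit p L r (\<Sum>i<L. (1 / \<epsilon>) ^ Suc i) e k x \<le> hit p (k * L) x"
proof (induction k arbitrary: x)
  case (Suc k)
  define C where "C = (\<Sum>i<L. (1 / \<epsilon>) ^ Suc i)"
  have C: "0 \<le> C" unfolding C_def using eps_pos by (intro sum_nonneg) auto
  define B where "B = sparse_hit p L r C e k"
  have B0: "0 \<le> B y" for y unfolding B_def using assms C by (intro sparse_hit_nonneg) auto
  have BH: "B y \<le> hit p (k * L) y" if "y \<noteq> []" for y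
    unfolding B_def C_def by (rule Suc.IH[OF that])
  \<comment> \<open>\<open>hit_block\<close> takes a function of the endpoint, so the selection of
    heavy paths is encoded through the unique path from \<open>x\<close> to
    \<open>y\<close>.\<close>
  define f where "f = (\<lambda>y. of_bool (\<exists>zs\<in>words L. y = zs @ x \<and> r \<le> path_weight p zs x) * B y)"
  have f: "f (zs @ x) = of_bool (r \<le> path_weight p zs x) * B (zs @ x)" if "zs \<in> words L" for zs
    using that by (auto simp: f_def)
  have fH: "0 \<le> f y \<and> f y \<le> hit p (k * L) y" if "y \<noteq> []" for y
    using B0[of y] BH[OF that] by (auto simp: f_def)
  define U where "U = heavy_sum p L r B x"
  have U: "U = (\<Sum>zs\<in>words L. f (zs @ x))"
    unfolding U_def heavy_sum_def by (intro sum.cong) (auto simp: f)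
  have U0: "0 \<le> U" unfolding U_def using B0 by (rule heavy_sum_nonneg)
  have "r * U \<le> (\<Sum>zs\<in>words L. path_weight p zs x * f (zs @ x))"
    unfolding U sum_distrib_left
    using B0 by (intro sum_mono) (auto simp: f intro: mult_right_mono)
  then have "r * U / (1 + C * U) \<le> (\<Sum>zs\<in>words L. path_weight p zs x * f (zs @ x)) / (1 + C * U)"
    using C U0 by (intro divide_right_mono) auto
  also have "\<dots> \<le> hit p (L + k * L) x"
    using hit_block[of f "k * L" x L] fH Suc.prems unfolding C_def U by blast
  finally show ?case
    by (simp add: U_def B_def C_def del: hit.simps)
qed (use assms in simp)

section \<open>Laws of path weights and large deviations\<close>

context environment_law
begin

text \<open>Each further step is an independent multiplication by a variable of law
  \<open>\<mu>\<close>, so only the length of the path matters.\<close>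

lemma path_weight_law:
  "length zs = length zs' \<Longrightarrow> x \<noteq> [] \<Longrightarrow> y \<noteq> [] \<Longrightarrow>
    distr M borel (\<lambda>w. path_weight (\<omega> w) zs x) = distr M borel (\<lambda>w. path_weight (\<omega> w) zs' y)"
proof (induction zs zs' rule: list_induct2)
  case (Cons i zs i' zs')
  have step: "distr M borel (\<lambda>w. path_weight (\<omega> w) (j # us) z) =
      distr (distr M borel (\<lambda>w. path_weight (\<omega> w) us z) \<Otimes>\<^sub>M \<mu>) borel (\<lambda>(a, b). a * b)"
    if "z \<noteq> []" for j us z
  proof -
    have "indep_var borel (\<lambda>w. path_weight (\<omega> w) us z) borel (\<lambda>w. A_ratio (\<omega> w) (j # us @ z))"
      using that block_not_root[of z]
      by (intro indep_var_local[OF measurable_local_path_weight measurable_local_A_ratio[of _ "{us @ z}"] _ _ block_step_disjoint])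
        auto
    then have "distr M borel (\<lambda>w. path_weight (\<omega> w) us z) \<Otimes>\<^sub>M \<mu> =
        distr M (borel \<Otimes>\<^sub>M borel) (\<lambda>w. (path_weight (\<omega> w) us z, A_ratio (\<omega> w) (j # us @ z)))"
      using that A_ratio_law[of "us @ z" j] unfolding indep_var_distribution_eq by simp
    then show ?thesis
      by (simp add: distr_distr comp_def)
  qed
  show ?case
    unfolding step[OF Cons.prems(1)] step[OF Cons.prems(2)] Cons.IH[OF Cons.prems] ..
qed simp

text \<open>By \<open>path_weight_law\<close> every path of length \<open>L\<close> below a vertex
  other than the root has this probability; \<open>undefined\<close> is an arbitrary label.\<close>

definition heavy_prob :: "nat \<Rightarrow> real \<Rightarrow> real" where
  "heavy_prob L r = prob {w\<in>space M. r \<le> path_weight (\<omega> w) (replicate L undefined) [undefined]}"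

lemma prob_heavy:
  assumes "length zs = L" "x \<noteq> []"
  shows "prob {w\<in>space M. r \<le> path_weight (\<omega> w) zs x} = heavy_prob L r"
proof -
  have *: "prob {w\<in>space M. r \<le> path_weight (\<omega> w) zs x} =
      measure (distr M borel (\<lambda>w. path_weight (\<omega> w) zs x)) {r..}" for zs x
    by (subst measure_distr) (auto intro!: arg_cong[where f = prob])
  show ?thesis
    unfolding heavy_prob_def *
    by (subst path_weight_law[of zs "replicate L undefined" x "[undefined]"]) (use assms in auto)
qed

lemma expectation_heavy:
  assumes "length zs = L" "x \<noteq> []"
  shows "expectation (\<lambda>w. of_bool (r \<le> path_weight (\<omega> w) zs x)) = heavy_prob L r"
proof -
  have "expectation (\<lambda>w. of_bool (r \<le> path_weight (\<omega> w) zs x)) =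
      expectation (indicator {w\<in>space M. r \<le> path_weight (\<omega> w) zs x})"
    by (intro Bochner_Integration.integral_cong) (auto simp: indicator_def)
  also have "\<dots> = prob {w\<in>space M. r \<le> path_weight (\<omega> w) zs x}"
    by simp
  finally show ?thesis using prob_heavy[OF assms] by simp
qed

text \<open>Cramer's lower bound. The tilted expectation of \<open>X\<^sup>t\<close> is concentrated near
  \<open>ln X = L * tilted_mean \<mu> t\<close>, since shifting the exponent by \<open>\<plusminus>h\<close> makes the tails exponentially
  smaller than the whole.\<close>

lemma heavy_prob_ge:
  assumes t: "0 < t" and \<delta>: "0 < \<delta>"
  shows "eventually (\<lambda>L. exp (real L * (ln (moment \<mu> t) - t * (tilted_mean \<mu> t + \<delta>))) / 2 \<le>
    heavy_prob L (exp (real L * (tilted_mean \<mu> t - \<delta>)))) sequentially"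
proof -
  define s where "s = tilted_mean \<mu> t"
  define l where "l = (\<lambda>u. ln (moment \<mu> u))"
  have m: "moment \<mu> u ^ L = exp (real L * l u)" for u L
    using mu.moment_pos[of u] by (simp add: l_def exp_of_nat_mult)
  obtain h where h: "0 < h" "h < t" "l (t + h) - l t < h * (s + \<delta>)" "l (t - h) - l t < - (h * (s - \<delta>))"
    using mu.ln_moment_increments[OF t \<delta>] unfolding s_def l_def by blast
  define c where "c = min (h * (s + \<delta>) - (l (t + h) - l t)) (- (h * (s - \<delta>)) - (l (t - h) - l t))"
  have c: "0 < c" "l (t + h) - h * (s + \<delta>) \<le> l t - c" "l (t - h) + h * (s - \<delta>) \<le> l t - c"
    using h by (auto simp: c_def)
  have "(\<lambda>L. exp (- c) ^ L) \<longlonglongrightarrow> 0"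
    using c(1) by (intro LIMSEQ_realpow_zero) auto
  \<comment> \<open>Each of the two tails will carry at most a quarter of the tilted mass, which
    leaves half of it for the window from \<open>R1\<close> to \<open>R2\<close>.\<close>
  then have "eventually (\<lambda>L. exp (- c) ^ L < 1 / 4) sequentially"
    by (rule order_tendstoD) simp
  then show ?thesis
  proof eventually_elim
    case (elim L)
    define R1 where "R1 = exp (real L * (s - \<delta>))"
    define R2 where "R2 = exp (real L * (s + \<delta>))"
    let ?zs = "replicate L undefined :: 'b list"
    let ?X = "\<lambda>w. path_weight (\<omega> w) ?zs [undefined]"
    have R: "0 < R1" "0 < R2" by (auto simp: R1_def R2_def)
    have E: "expectation (\<lambda>w. ?X w powr u) = exp (real L * l u)" "integrable M (\<lambda>w. ?X w powr u)"
      if "0 \<le> u" for u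
      using expectation_path_weight_powr[of "[undefined]" u ?zs] integrable_path_weight_powr[of "[undefined]" u ?zs] that
      by (auto simp: m)
    have ind: "integrable M (\<lambda>w. of_bool (R1 \<le> ?X w) :: real)"
      by (rule integrable_const_bound[of _ 1]) auto
    have "exp (real L * l t) = expectation (\<lambda>w. ?X w powr t)"
      using E(1)[of t] t by simp
    \<comment> \<open>Between \<open>R1\<close> and \<open>R2\<close> the power is at most
      \<open>R2 powr t\<close>; above \<open>R2\<close> and below \<open>R1\<close> a shift of the
      exponent by \<open>h\<close> gains the required factor.\<close>
    also have "\<dots> \<le> expectation (\<lambda>w. of_bool (R1 \<le> ?X w) * R2 powr t + ?X w powr (t + h) * R2 powr (- h) +
        ?X w powr (t - h) * R1 powr h)"
    proof (rule integral_mono_AE)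
      show "AE w in M. ?X w powr t \<le> of_bool (R1 \<le> ?X w) * R2 powr t + ?X w powr (t + h) * R2 powr (- h) +
          ?X w powr (t - h) * R1 powr h"
        using AE_path_weight_bounds[of "[undefined]" ?zs, OF list.distinct(2)]
      proof eventually_elim
        case (elim w)
        then have X: "0 < ?X w" by simp
        have up: "?X w powr t \<le> ?X w powr (t + h) * R2 powr (- h)" if "R2 < ?X w"
        proof -
          have "R2 powr h \<le> ?X w powr h" using that R h by (intro powr_mono2) auto
          then have "?X w powr t * R2 powr h \<le> ?X w powr t * ?X w powr h" by (intro mult_left_mono) auto
          then show ?thesis using R by (simp add: powr_add powr_minus field_simps)
        qed
        have down: "?X w powr t \<le> ?X w powr (t - h) * R1 powr h" if "?X w < R1"
        proof -
          have "?X w powr h \<le> R1 powr h" using that X h by (intro powr_mono2) auto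
          then have "?X w powr (t - h) * ?X w powr h \<le> ?X w powr (t - h) * R1 powr h" by (intro mult_left_mono) auto
          then show ?thesis by (simp flip: powr_add)
        qed
        have mid: "?X w powr t \<le> R2 powr t" if "?X w \<le> R2"
          using that X t by (intro powr_mono2) auto
        have nn: "0 \<le> ?X w powr (t + h) * R2 powr (- h)" "0 \<le> ?X w powr (t - h) * R1 powr h"
          "0 \<le> of_bool (R1 \<le> ?X w) * R2 powr t"
          by auto
        show ?case
        proof (cases "?X w < R1")
          case True
          then show ?thesis using down nn by linarith
        next
          case False
          then have "of_bool (R1 \<le> ?X w) * R2 powr t = R2 powr t" by simp
          then show ?thesis using up mid nn by (cases "R2 < ?X w") linarith+
        qed
      qed
    qed (use E(2) t h ind in auto)
    also have "\<dots> = heavy_prob L R1 * R2 powr t + exp (real L * l (t + h)) * R2 powr (- h) +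
        exp (real L * l (t - h)) * R1 powr h"
      using E t h ind expectation_heavy[of ?zs L "[undefined]" R1] by simp
    also have "exp (real L * l (t + h)) * R2 powr (- h) \<le> exp (real L * l t) * exp (- c) ^ L"
    proof -
      have "exp (real L * l (t + h)) * R2 powr (- h) = exp (real L * (l (t + h) - h * (s + \<delta>)))"
        by (simp add: R2_def powr_def algebra_simps flip: exp_add)
      also have "\<dots> \<le> exp (real L * (l t - c))"
        using c(2) by (auto intro!: mult_left_mono)
      also have "\<dots> = exp (real L * l t) * exp (- c) ^ L"
        by (simp add: algebra_simps flip: exp_add exp_of_nat_mult)
      finally show ?thesis .
    qed
    also have "exp (real L * l (t - h)) * R1 powr h \<le> exp (real L * l t) * exp (- c) ^ L"
    proof -
      have "exp (real L * l (t - h)) * R1 powr h = exp (real L * (l (t - h) + h * (s - \<delta>)))"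
        by (simp add: R1_def powr_def algebra_simps flip: exp_add)
      also have "\<dots> \<le> exp (real L * (l t - c))"
        using c(3) by (auto intro!: mult_left_mono)
      also have "\<dots> = exp (real L * l t) * exp (- c) ^ L"
        by (simp add: algebra_simps flip: exp_add exp_of_nat_mult)
      finally show ?thesis .
    qed
    also have "exp (real L * l t) * exp (- c) ^ L \<le> exp (real L * l t) * (1 / 4)"
      using elim by (intro mult_left_mono) auto
    finally have "exp (real L * l t) / 2 \<le> heavy_prob L R1 * R2 powr t"
      by simp
    also have "R2 powr t = exp (real L * (t * (s + \<delta>)))"
      by (simp add: R2_def powr_def mult_ac)
    finally have "exp (real L * l t) / 2 / exp (real L * (t * (s + \<delta>))) \<le> heavy_prob L R1"
      by (simp add: field_simps)
    then show ?case
      by (simp add: R1_def s_def l_def right_diff_distrib exp_diff)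
  qed
qed

text \<open>Chernoff's bound, the counterpart of \<open>heavy_prob_ge\<close>. It serves to show
  that \<open>r\<close> times the mean number of heavy paths is below 1.\<close>

lemma heavy_prob_le:
  assumes "0 \<le> t" "0 < r"
  shows "heavy_prob L r \<le> moment \<mu> t ^ L / r powr t"
proof -
  let ?X = "\<lambda>w. path_weight (\<omega> w) (replicate L undefined) [undefined]"
  have "heavy_prob L r \<le> prob {w\<in>space M. r powr t \<le> ?X w powr t}"
    unfolding heavy_prob_def using assms by (intro finite_measure_mono) (auto intro: powr_mono2)
  also have "\<dots> \<le> expectation (\<lambda>w. ?X w powr t) / r powr t"
    using assms by (intro integral_Markov_inequality_measure[where A = "space M"] integrable_path_weight_powr) auto
  also have "expectation (\<lambda>w. ?X w powr t) = moment \<mu> t ^ L"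
    using expectation_path_weight_powr[of "[undefined]" t "replicate L undefined"] assms by simp
  finally show ?thesis .
qed

end

section \<open>Second moments on sparse subtrees\<close>

text \<open>The Paley-Zygmund inequality, with a pointwise quadratic bound in place of
  Cauchy-Schwarz.\<close>

lemma (in prob_space) second_moment_prob:
  fixes X :: "'a \<Rightarrow> real"
  assumes int: "integrable M X" "integrable M (\<lambda>w. (X w)\<^sup>2)"
    and lo: "0 < lo" "lo \<le> expectation X" and v: "0 < v" "expectation (\<lambda>w. (X w)\<^sup>2) \<le> v"
  shows "lo\<^sup>2 / (4 * v) \<le> prob {w\<in>space M. lo / 2 \<le> X w}"
proof -
  define A where "A = {w\<in>space M. lo / 2 \<le> X w}"
  have A: "A \<in> events" using borel_measurable_integrable[OF int(1)] unfolding A_def by measurable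
  \<comment> \<open>With this \<open>c\<close> the quadratic term costs at most
    \<open>lo / 4\<close>, and the coefficient of the indicator is \<open>v / lo\<close>.\<close>
  define c where "c = lo / (2 * v)"
  have c: "0 < c" using lo v by (simp add: c_def)
  have young: "y \<le> c / 2 * y\<^sup>2 + 1 / (2 * c)" for y
  proof -
    have "0 \<le> (c * y - 1)\<^sup>2" by simp
    then have "2 * c * y \<le> c\<^sup>2 * y\<^sup>2 + 1" by (simp add: power2_eq_square algebra_simps)
    then have "y \<le> (c\<^sup>2 * y\<^sup>2 + 1) / (2 * c)" using c by (simp add: field_simps)
    also have "\<dots> = c / 2 * y\<^sup>2 + 1 / (2 * c)" using c by (simp add: field_simps power2_eq_square)
    finally show ?thesis .
  qed
  have "lo \<le> expectation X" by (rule lo)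
  also have "\<dots> \<le> expectation (\<lambda>w. lo / 2 + c / 2 * (X w)\<^sup>2 + 1 / (2 * c) * indicator A w)"
  proof (rule integral_mono)
    show "X w \<le> lo / 2 + c / 2 * (X w)\<^sup>2 + 1 / (2 * c) * indicator A w" if "w \<in> space M" for w
    proof (cases "w \<in> A")
      case True
      then show ?thesis using young[of "X w"] lo by simp
    next
      case False
      then have "X w \<le> lo / 2" using that by (simp add: A_def)
      then show ?thesis using False c by (simp add: add_increasing2)
    qed
    show "integrable M (\<lambda>w. lo / 2 + c / 2 * (X w)\<^sup>2 + 1 / (2 * c) * indicator A w)"
      using int A by (intro Bochner_Integration.integrable_add integrable_mult_right) (auto simp: emeasure_eq_measure)
  qed (rule int)
  also have "\<dots> = lo / 2 + c / 2 * expectation (\<lambda>w. (X w)\<^sup>2) + 1 / (2 * c) * prob A"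
  proof -
    have "integrable M (indicator A :: 'a \<Rightarrow> real)"
      using A by (auto simp: emeasure_eq_measure)
    then show ?thesis
      using int A by (simp add: prob_space)
  qed
  also have "\<dots> \<le> lo / 2 + c / 2 * v + 1 / (2 * c) * prob A"
    using v c by (intro add_mono mult_left_mono) auto
  finally have "lo / 4 \<le> v / lo * prob A"
    using lo v by (simp add: c_def field_simps)
  then show ?thesis
    using lo v unfolding A_def[symmetric] by (simp add: field_simps power2_eq_square)
qed

context environment_law
begin

section \<open>Moments of the sparse recursion\<close>

lemma measurable_local_heavy_indicator:
  "(\<lambda>w. of_bool (r \<le> path_weight (\<omega> w) zs x) :: real) \<in> borel_measurable (local_events (block (length zs) x))"
proof -
  note [measurable] = measurable_local_path_weight
  show ?thesis by measurable
qed

lemma measurable_local_heavy_sum: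
  assumes "\<And>y. (\<lambda>w. f w y) \<in> borel_measurable (local_events (descendants y))"
  shows "(\<lambda>w. heavy_sum (\<omega> w) L r (f w) x) \<in> borel_measurable (local_events (descendants x))"
  unfolding heavy_sum_def
  by (intro borel_measurable_sum borel_measurable_times
      local_events_mono[OF block_subset measurable_local_heavy_indicator]
      local_events_mono[OF descendants_append assms])

lemma measurable_local_sparse_hit:
  "(\<lambda>w. sparse_hit (\<omega> w) L r C e k x) \<in> borel_measurable (local_events (descendants x))"
proof (induction k arbitrary: x)
  case (Suc k)
  note [measurable] = measurable_local_heavy_sum[OF Suc.IH, of L r x]
  show ?case unfolding sparse_hit.simps by measurable
qed simp

lemma integrable_bounded:
  "X \<in> borel_measurable M \<Longrightarrow> (\<And>w. w \<in> space M \<Longrightarrow> \<bar>X w\<bar> \<le> c) \<Longrightarrow> integrable M (X :: 'w \<Rightarrow> real)"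
  by (rule integrable_const_bound[of _ c]) auto

context
  fixes L :: nat and r C :: real
  assumes r: "0 < r" and C: "0 < C"
begin

abbreviation sparse :: "real \<Rightarrow> nat \<Rightarrow> 'b list \<Rightarrow> 'w \<Rightarrow> real" where
  "sparse e k x w \<equiv> sparse_hit (\<omega> w) L r C e k x"

abbreviation heavy :: "'b list \<Rightarrow> 'b list \<Rightarrow> 'w \<Rightarrow> real" where
  "heavy zs x w \<equiv> of_bool (r \<le> path_weight (\<omega> w) zs x)"

abbreviation sparse_sum :: "real \<Rightarrow> nat \<Rightarrow> 'b list \<Rightarrow> 'w \<Rightarrow> real" where
  "sparse_sum e k x w \<equiv> heavy_sum (\<omega> w) L r (sparse_hit (\<omega> w) L r C e k) x"

abbreviation "mean_offspring \<equiv> real CARD('b) ^ L * heavy_prob L r"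

lemma sparse_nonneg: "0 \<le> e \<Longrightarrow> 0 \<le> sparse e k x w"
  using r C by (intro sparse_hit_nonneg) auto

lemma sparse_sum_nonneg: "0 \<le> e \<Longrightarrow> 0 \<le> sparse_sum e k x w"
  by (intro heavy_sum_nonneg sparse_nonneg)

lemma sparse_le: "0 \<le> e \<Longrightarrow> sparse e k x w \<le> e + r / C"
  using r C by (intro sparse_hit_bound) auto

lemma measurable_sparse [measurable]: "sparse e k x \<in> borel_measurable M"
  by (rule local_events_measurable[OF measurable_local_sparse_hit])

lemma measurable_sparse_sum [measurable]: "sparse_sum e k x \<in> borel_measurable M"
  by (rule local_events_measurable[OF measurable_local_heavy_sum[OF measurable_local_sparse_hit]])

lemma integrable_sparse [simp]: "0 \<le> e \<Longrightarrow> integrable M (sparse e k x)"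
  by (rule integrable_bounded[of _ "e + r / C"]) (auto simp: sparse_nonneg sparse_le)

lemma integrable_sparse_mult [simp]:
  assumes "0 \<le> e"
  shows "integrable M (\<lambda>w. sparse e k x w * sparse e k y w)"
proof (rule integrable_bounded)
  show "\<bar>sparse e k x w * sparse e k y w\<bar> \<le> (e + r / C) * (e + r / C)" for w
    unfolding abs_mult using assms r C by (intro mult_mono) (auto simp: sparse_nonneg sparse_le)
qed measurable

lemma integrable_heavy_mult [simp]:
  assumes "integrable M X"
  shows "integrable M (\<lambda>w. heavy zs x w * X w)"
  by (rule Bochner_Integration.integrable_bound[OF assms]) (use assms in auto)

lemma sparse_sum_le: 
  assumes "0 \<le> e"
  shows "sparse_sum e k x w \<le> real CARD('b) ^ L * (e + r / C)"
proof -
  have "sparse_sum e k x w \<le> (\<Sum>zs\<in>(words L :: 'b list set). e + r / C)"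
    unfolding heavy_sum_def using assms sparse_nonneg[OF assms] sparse_le[OF assms] r C
    by (intro sum_mono) auto
  then show ?thesis by (simp add: card_words)
qed

lemma integrable_sparse_sum [simp]: "0 \<le> e \<Longrightarrow> integrable M (sparse_sum e k x)"
  by (rule integrable_bounded[of _ "real CARD('b) ^ L * (e + r / C)"])
    (auto simp: sparse_sum_nonneg sparse_sum_le)

lemma integrable_sparse_sum_sq [simp]:
  assumes "0 \<le> e"
  shows "integrable M (\<lambda>w. (sparse_sum e k x w)\<^sup>2)"
proof (rule integrable_bounded)
  show "\<bar>(sparse_sum e k x w)\<^sup>2\<bar> \<le> (real CARD('b) ^ L * (e + r / C))\<^sup>2" for w
    using assms by (auto intro!: power_mono simp: sparse_sum_nonneg sparse_sum_le)
qed measurable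

lemma expectation_heavy_mult:
  assumes x: "x \<noteq> []" and zs: "length zs = L"
    and X: "X \<in> borel_measurable (local_events (descendants (zs @ x)))" "integrable M X"
  shows "expectation (\<lambda>w. heavy zs x w * X w) = heavy_prob L r * expectation X"
proof -
  have "expectation (\<lambda>w. heavy zs x w * X w) = expectation (heavy zs x) * expectation X"
    by (rule expectation_local_mult[OF measurable_local_heavy_indicator X(1) _ _ block_disjoint[OF refl] _ X(2)])
      (use x zs block_not_root descendants_not_root[of "zs @ x"] in \<open>auto intro!: integrable_bounded[of _ 1]\<close>)
  then show ?thesis using expectation_heavy[OF zs x] by simp
qed

lemma expectation_sparse_sum:
  assumes "0 \<le> e" "x \<noteq> []"
  shows "expectation (sparse_sum e k x) = (\<Sum>zs\<in>words L. heavy_prob L r * expectation (sparse e k (zs @ x)))"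
proof -
  have "expectation (sparse_sum e k x) = (\<Sum>zs\<in>words L. expectation (\<lambda>w. heavy zs x w * sparse e k (zs @ x) w))"
    unfolding heavy_sum_def using assms by (subst Bochner_Integration.integral_sum) auto
  also have "\<dots> = (\<Sum>zs\<in>words L. heavy_prob L r * expectation (sparse e k (zs @ x)))"
    using assms
    by (intro sum.cong refl expectation_heavy_mult measurable_local_sparse_hit integrable_sparse)
      (simp_all add: words_def)
  finally show ?thesis .
qed

lemma sparse_Suc_le: "0 \<le> e \<Longrightarrow> sparse e (Suc k) x w \<le> r * sparse_sum e k x w"
proof -
  assume e: "0 \<le> e"
  let ?U = "sparse_sum e k x w"
  have "r * ?U * 1 \<le> r * ?U * (1 + C * ?U)"
    using r C sparse_sum_nonneg[OF e, of w k x] by (intro mult_left_mono) auto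
  then show ?thesis
    using C sparse_sum_nonneg[OF e, of w k x] by (simp add: divide_simps add_pos_nonneg)
qed

text \<open>Together with \<open>sparse_Suc_le\<close> this makes the recursion linear up to a
  quadratic loss, which the second moment controls.\<close>

lemma sparse_Suc_ge: "0 \<le> e \<Longrightarrow> r * sparse_sum e k x w - r * C * (sparse_sum e k x w)\<^sup>2 \<le> sparse e (Suc k) x w"
proof -
  assume e: "0 \<le> e"
  let ?U = "sparse_sum e k x w"
  have U: "0 \<le> ?U" using sparse_sum_nonneg[OF e] .
  have "(r * ?U - r * C * ?U\<^sup>2) * (1 + C * ?U) = r * ?U - r * C * C * ?U ^ 3"
    by (simp add: algebra_simps power2_eq_square power3_eq_cube)
  also have "\<dots> \<le> r * ?U" using r C U by simp
  finally have "r * ?U - r * C * ?U\<^sup>2 \<le> r * ?U / (1 + C * ?U)"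
    using C U by (subst pos_le_divide_eq) (auto intro: add_pos_nonneg)
  then show ?thesis by simp
qed

lemma heavy_prob_nonneg: "0 \<le> heavy_prob L r"
  by (simp add: heavy_prob_def)

lemma expectation_sparse_le:
  assumes e: "0 \<le> e"
  shows "x \<noteq> [] \<Longrightarrow> expectation (sparse e k x) \<le> e * (r * mean_offspring) ^ k"
proof (induction k arbitrary: x)
  case 0
  then show ?case by (simp add: prob_space)
next
  case (Suc k)
  have "expectation (sparse e (Suc k) x) \<le> expectation (\<lambda>w. r * sparse_sum e k x w)"
    by (rule integral_mono[OF integrable_sparse[OF e] _ sparse_Suc_le[OF e]]) (use e in auto)
  also have "\<dots> = r * (\<Sum>zs\<in>words L. heavy_prob L r * expectation (sparse e k (zs @ x)))"
    using Suc.prems e by (simp add: expectation_sparse_sum)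
  also have "\<dots> \<le> r * (\<Sum>zs\<in>(words L :: 'b list set). heavy_prob L r * (e * (r * mean_offspring) ^ k))"
    using r Suc heavy_prob_nonneg by (intro mult_left_mono sum_mono) auto
  also have "\<dots> = e * (r * mean_offspring) ^ Suc k"
    by (simp add: card_words)
  finally show ?case .
qed

text \<open>Two different paths may share rows, so their indicators are bounded by 1 and only the
  independence of the two endpoint subtrees is used. The price is the square of
  \<open>CARD('b) ^ L\<close>, which does not depend on \<open>k\<close>. On the diagonal the
  indicator is kept and yields the factor \<open>mean_offspring\<close>.\<close>

lemma expectation_sparse_sum_sq_le:
  assumes e: "0 \<le> e" and x: "x \<noteq> []"
    and v: "\<And>y. y \<noteq> [] \<Longrightarrow> expectation (\<lambda>w. (sparse e k y w)\<^sup>2) \<le> v"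
  shows "expectation (\<lambda>w. (sparse_sum e k x w)\<^sup>2) \<le>
    mean_offspring * v + (real CARD('b) ^ L)\<^sup>2 * (e * (r * mean_offspring) ^ k)\<^sup>2"
proof -
  let ?W = "words L :: 'b list set"
  let ?a = "e * (r * mean_offspring) ^ k"
  have a: "0 \<le> ?a" using e r heavy_prob_nonneg by simp
  have pair: "expectation (\<lambda>w. heavy zs x w * sparse e k (zs @ x) w * (heavy us x w * sparse e k (us @ x) w)) \<le>
      (if zs = us then heavy_prob L r * v else 0) + ?a * ?a" (is "?E \<le> _")
    if len: "zs \<in> ?W" "us \<in> ?W" for zs us
  proof (cases "zs = us")
    case True
    have "?E = expectation (\<lambda>w. heavy zs x w * (sparse e k (zs @ x) w)\<^sup>2)"
      using True by (intro Bochner_Integration.integral_cong) (auto simp: power2_eq_square)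
    also have "\<dots> = heavy_prob L r * expectation (\<lambda>w. (sparse e k (zs @ x) w)\<^sup>2)"
      by (rule expectation_heavy_mult)
        (use x len e integrable_sparse_mult[of e k "zs @ x" "zs @ x"] in
          \<open>auto simp: words_def power2_eq_square intro!: borel_measurable_times measurable_local_sparse_hit\<close>)
    also have "\<dots> \<le> heavy_prob L r * v"
      using v[of "zs @ x"] x heavy_prob_nonneg by (intro mult_left_mono) auto
    finally show ?thesis using True a by (simp add: add_increasing2)
  next
    case False
    have "?E \<le> expectation (\<lambda>w. sparse e k (zs @ x) w * sparse e k (us @ x) w)"
    proof (rule integral_mono)
      show "integrable M (\<lambda>w. heavy zs x w * sparse e k (zs @ x) w * (heavy us x w * sparse e k (us @ x) w))"
        using integrable_heavy_mult[OF integrable_heavy_mult[OF integrable_sparse_mult[OF e, of k "zs @ x" "us @ x"], of us x], of zs x]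
        by (simp only: mult_ac)
      show "heavy zs x w * sparse e k (zs @ x) w * (heavy us x w * sparse e k (us @ x) w) \<le>
          sparse e k (zs @ x) w * sparse e k (us @ x) w" for w
        using sparse_nonneg[OF e] by (auto intro: mult_nonneg_nonneg)
    qed (use e in simp)
    also have "\<dots> = expectation (sparse e k (zs @ x)) * expectation (sparse e k (us @ x))"
      by (rule expectation_local_mult[OF measurable_local_sparse_hit measurable_local_sparse_hit])
        (use x len False e in \<open>auto simp: words_def intro!: descendants_disjoint descendants_not_root\<close>)
    also have "\<dots> \<le> ?a * ?a"
      using x a e by (intro mult_mono expectation_sparse_le) (auto intro!: Bochner_Integration.integral_nonneg sparse_nonneg)
    finally show ?thesis using False by simp
  qed
  have int: "integrable M (\<lambda>w. heavy zs x w * sparse e k (zs @ x) w * (heavy us x w * sparse e k (us @ x) w))" for zs us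
    using integrable_heavy_mult[OF integrable_heavy_mult[OF integrable_sparse_mult[OF e, of k "zs @ x" "us @ x"], of us x], of zs x]
    by (simp only: mult_ac)
  have "expectation (\<lambda>w. (sparse_sum e k x w)\<^sup>2) = (\<Sum>zs\<in>?W. \<Sum>us\<in>?W.
      expectation (\<lambda>w. heavy zs x w * sparse e k (zs @ x) w * (heavy us x w * sparse e k (us @ x) w)))"
    unfolding heavy_sum_def power2_eq_square sum_product
    by (subst Bochner_Integration.integral_sum, use int in simp)+ (rule refl)
  also have "\<dots> \<le> (\<Sum>zs\<in>?W. \<Sum>us\<in>?W. (if zs = us then heavy_prob L r * v else 0) + ?a * ?a)"
    by (intro sum_mono pair)
  also have "\<dots> = mean_offspring * v + (real CARD('b) ^ L)\<^sup>2 * ?a\<^sup>2"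
    by (simp add: sum.distrib card_words power2_eq_square algebra_simps)
  finally show ?thesis .
qed

context
  assumes m: "1 < mean_offspring" and rm: "r * mean_offspring < 1"
begin

text \<open>Chosen so that \<open>mean_offspring * K + (CARD('b) ^ L)^2 \<le> K *
  mean_offspring^2\<close>, the condition under which a bound with constant \<open>K\<close>
  reproduces itself; it can be met since \<open>mean_offspring > 1\<close>. The summand 1 covers
  \<open>k = 0\<close>.\<close>

definition second_moment_const :: real where
  "second_moment_const = 1 + (real CARD('b) ^ L)\<^sup>2 / (mean_offspring\<^sup>2 - mean_offspring)"

lemma second_moment_const: "1 \<le> second_moment_const"
  "mean_offspring * second_moment_const + (real CARD('b) ^ L)\<^sup>2 \<le> second_moment_const * mean_offspring\<^sup>2"
proof -
  define q where "q = mean_offspring\<^sup>2 - mean_offspring"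
  have "0 < x\<^sup>2 - x" if "1 < x" for x :: real
    using that by (simp add: power2_eq_square)
  from this[OF m] have q: "0 < q" unfolding q_def .
  show "1 \<le> second_moment_const"
    using q by (simp add: second_moment_const_def q_def[symmetric])
  have "second_moment_const * q = q + (real CARD('b) ^ L)\<^sup>2"
    unfolding second_moment_const_def q_def[symmetric] using q by (simp add: distrib_right)
  then have "(real CARD('b) ^ L)\<^sup>2 \<le> second_moment_const * q" using q by simp
  then show "mean_offspring * second_moment_const + (real CARD('b) ^ L)\<^sup>2 \<le> second_moment_const * mean_offspring\<^sup>2"
    by (simp add: q_def algebra_simps)
qed

lemma second_moments:
  assumes e: "0 \<le> e" and x: "x \<noteq> []"
  shows "expectation (\<lambda>w. (sparse e k x w)\<^sup>2) \<le> second_moment_const * (e * (r * mean_offspring) ^ k)\<^sup>2" (is ?A)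
    and "expectation (\<lambda>w. (sparse_sum e k x w)\<^sup>2) \<le>
      second_moment_const * mean_offspring\<^sup>2 * (e * (r * mean_offspring) ^ k)\<^sup>2" (is ?B)
proof -
  have sum: "expectation (\<lambda>w. (sparse_sum e k x w)\<^sup>2) \<le> second_moment_const * mean_offspring\<^sup>2 * (e * (r * mean_offspring) ^ k)\<^sup>2"
    if "\<And>y. y \<noteq> [] \<Longrightarrow> expectation (\<lambda>w. (sparse e k y w)\<^sup>2) \<le> second_moment_const * (e * (r * mean_offspring) ^ k)\<^sup>2"
      and x: "x \<noteq> []" for k x
  proof -
    let ?a2 = "(e * (r * mean_offspring) ^ k)\<^sup>2"
    have "expectation (\<lambda>w. (sparse_sum e k x w)\<^sup>2) \<le>
        mean_offspring * (second_moment_const * ?a2) + (real CARD('b) ^ L)\<^sup>2 * ?a2"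
      by (rule expectation_sparse_sum_sq_le[OF e x that(1)])
    also have "\<dots> = (mean_offspring * second_moment_const + (real CARD('b) ^ L)\<^sup>2) * ?a2"
      by (simp add: algebra_simps)
    also have "\<dots> \<le> second_moment_const * mean_offspring\<^sup>2 * ?a2"
      using second_moment_const(2) by (intro mult_right_mono) auto
    finally show ?thesis .
  qed
  have A: "expectation (\<lambda>w. (sparse e k x w)\<^sup>2) \<le> second_moment_const * (e * (r * mean_offspring) ^ k)\<^sup>2"
    if "x \<noteq> []" for k x
    using that
  proof (induction k arbitrary: x)
    case 0
    then show ?case
      using second_moment_const(1) by (simp add: prob_space mult_right_le_one_le mult_le_cancel_right1)
  next
    case (Suc k)
    have "expectation (\<lambda>w. (sparse e (Suc k) x w)\<^sup>2) \<le> expectation (\<lambda>w. r\<^sup>2 * (sparse_sum e k x w)\<^sup>2)"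
    proof (rule integral_mono)
      show "integrable M (\<lambda>w. (sparse e (Suc k) x w)\<^sup>2)"
        using integrable_sparse_mult[OF e, of "Suc k" x x] by (simp only: power2_eq_square)
      show "(sparse e (Suc k) x w)\<^sup>2 \<le> r\<^sup>2 * (sparse_sum e k x w)\<^sup>2" for w
        using power_mono[OF sparse_Suc_le[OF e] sparse_nonneg[OF e], of w k x 2]
        unfolding power_mult_distrib .
    qed (use e in simp)
    also have "\<dots> = r\<^sup>2 * expectation (\<lambda>w. (sparse_sum e k x w)\<^sup>2)"
      by simp
    also have "\<dots> \<le> r\<^sup>2 * (second_moment_const * mean_offspring\<^sup>2 * (e * (r * mean_offspring) ^ k)\<^sup>2)"
      using Suc by (intro mult_left_mono sum) auto
    also have "\<dots> = second_moment_const * (e * (r * mean_offspring) ^ Suc k)\<^sup>2"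
      by (simp add: power_mult_distrib)
    finally show ?case .
  qed
  show ?A by (rule A[OF x])
  show ?B by (rule sum[OF A x])
qed

text \<open>The quadratic error of the recursion is of order \<open>e\<^sup>2\<close>, hence negligible for small \<open>e\<close>.\<close>

lemma expectation_sparse_ge:
  assumes e: "0 \<le> e"
  shows "x \<noteq> [] \<Longrightarrow> e * (r * mean_offspring) ^ k *
      (1 - C * second_moment_const * mean_offspring * e * (\<Sum>j<k. (r * mean_offspring) ^ j)) \<le> expectation (sparse e k x)"
proof (induction k arbitrary: x)
  case 0
  then show ?case by (simp add: prob_space)
next
  case (Suc k)
  define a where "a = r * mean_offspring"
  define D where "D = C * second_moment_const * mean_offspring * e"
  define S where "S = (\<Sum>j<k. a ^ j)"
  have "a * (e * a ^ k * (1 - D * S)) = r * (\<Sum>zs\<in>(words L :: 'b list set). heavy_prob L r * (e * a ^ k * (1 - D * S)))"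
    by (simp add: a_def card_words)
  also have "\<dots> \<le> r * (\<Sum>zs\<in>(words L :: 'b list set). heavy_prob L r * expectation (sparse e k (zs @ x)))"
    using Suc r heavy_prob_nonneg unfolding a_def D_def S_def
    by (intro mult_left_mono sum_mono Suc.IH) auto
  also have "\<dots> = r * expectation (sparse_sum e k x)"
    using Suc.prems e by (simp add: expectation_sparse_sum)
  finally have main: "a * (e * a ^ k * (1 - D * S)) \<le> r * expectation (sparse_sum e k x)" .
  have "r * C * expectation (\<lambda>w. (sparse_sum e k x w)\<^sup>2) \<le>
      r * C * (second_moment_const * mean_offspring\<^sup>2 * (e * a ^ k)\<^sup>2)"
    using second_moments(2)[OF e Suc.prems, of k] r C unfolding a_def by (intro mult_left_mono) auto
  moreover have "r * expectation (sparse_sum e k x) - r * C * expectation (\<lambda>w. (sparse_sum e k x w)\<^sup>2) =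
      expectation (\<lambda>w. r * sparse_sum e k x w - r * C * (sparse_sum e k x w)\<^sup>2)"
    using e by simp
  moreover have "\<dots> \<le> expectation (sparse e (Suc k) x)"
    by (rule integral_mono[OF _ integrable_sparse[OF e] sparse_Suc_ge[OF e]]) (use e in auto)
  ultimately have "a * (e * a ^ k * (1 - D * S)) -
      r * C * (second_moment_const * mean_offspring\<^sup>2 * (e * a ^ k)\<^sup>2) \<le> expectation (sparse e (Suc k) x)"
    using main by linarith
  \<comment> \<open>Relative to the main term \<open>e * a ^ Suc k\<close> the new error is
    \<open>D * a ^ k\<close>, the next term of the geometric sum.\<close>
  moreover have "r * C * (second_moment_const * mean_offspring\<^sup>2 * (e * a ^ k)\<^sup>2) = e * a ^ Suc k * D * a ^ k"
    by (simp add: D_def a_def power2_eq_square power_mult_distrib mult_ac)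
  moreover have "e * a ^ Suc k * (1 - D * (\<Sum>j<Suc k. a ^ j)) =
      a * (e * a ^ k * (1 - D * S)) - e * a ^ Suc k * D * a ^ k"
    by (simp add: S_def algebra_simps)
  ultimately show ?case
    unfolding a_def D_def by (simp only:)
qed

lemma sparse_hit_prob:
  obtains e c \<eta> where "0 < e" "e \<le> 1" "0 < c" "0 < \<eta>"
    "\<And>k x. x \<noteq> [] \<Longrightarrow> \<eta> \<le> prob {w\<in>space M. c * (r * mean_offspring) ^ k \<le> sparse e k x w}"
proof -
  define a where "a = r * mean_offspring"
  define K where "K = second_moment_const"
  define F where "F = C * K * mean_offspring"
  \<comment> \<open>The relative error in \<open>expectation_sparse_ge\<close> is at most
    \<open>F * e / (1 - a)\<close>, by the geometric series with ratio \<open>a < 1\<close>; this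
    \<open>e\<close> makes it at most one half.\<close>
  define e where "e = min 1 ((1 - a) / (2 * F))"
  have a: "0 < a" "a < 1" using r m rm by (auto simp: a_def intro!: mult_pos_pos intro: less_trans[OF zero_less_one])
  have K: "1 \<le> K" using second_moment_const(1) by (simp add: K_def)
  have "0 < mean_offspring" using m by linarith
  with C K have F: "0 < F" unfolding F_def by (metis less_le_trans mult_pos_pos zero_less_one)
  have e: "0 < e" "e \<le> 1" "F * e \<le> (1 - a) / 2"
  proof -
    show "0 < e" "e \<le> 1" using a F by (auto simp: e_def)
    have "F * e \<le> F * ((1 - a) / (2 * F))" using F by (intro mult_left_mono) (auto simp: e_def)
    then show "F * e \<le> (1 - a) / 2" using F by simp
  qed
  have "1 / (16 * K) \<le> prob {w\<in>space M. e / 4 * a ^ k \<le> sparse e k x w}" if x: "x \<noteq> []" for k x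
  proof -
    define S where "S = (\<Sum>j<k. a ^ j)"
    have "(1 - a) * S \<le> 1"
      unfolding S_def one_diff_power_eq[symmetric] using a by simp
    moreover have "0 \<le> S" unfolding S_def using a by (intro sum_nonneg) auto
    ultimately have "F * e * S \<le> 1 / 2"
      using mult_right_mono[OF e(3), of S] by simp
    then have "e * a ^ k * (1 / 2) \<le> e * a ^ k * (1 - F * e * S)"
      using e a by (intro mult_left_mono) auto
    also have "\<dots> \<le> expectation (sparse e k x)"
      using expectation_sparse_ge[OF _ x, of e k] e unfolding a_def F_def S_def K_def by simp
    finally have lo: "e * a ^ k / 2 \<le> expectation (sparse e k x)" by simp
    have "(e * a ^ k / 2)\<^sup>2 / (4 * (K * (e * a ^ k)\<^sup>2)) \<le> prob {w\<in>space M. e * a ^ k / 2 / 2 \<le> sparse e k x w}"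
    proof (rule second_moment_prob[OF _ _ _ lo])
      show "integrable M (\<lambda>w. (sparse e k x w)\<^sup>2)"
        using integrable_sparse_mult[of e k x x] e by (simp add: power2_eq_square)
      show "expectation (\<lambda>w. (sparse e k x w)\<^sup>2) \<le> K * (e * a ^ k)\<^sup>2"
        using second_moments(1)[OF _ x, of e k] e unfolding a_def K_def by simp
    qed (use e a K in auto)
    \<comment> \<open>The squared first moment and the second moment scale alike in
      \<open>e * a ^ k\<close>, so the probability bound depends on neither \<open>k\<close> nor
      \<open>x\<close>.\<close>
    moreover have "(e * a ^ k / 2)\<^sup>2 / (4 * (K * (e * a ^ k)\<^sup>2)) = 1 / (16 * K)"
      using e(1) a(1) K by (simp add: power_divide)
    ultimately show ?thesis by (simp add: mult.commute)
  qed
  then show ?thesis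
    using e K by (intro that[of e "e / 4" "1 / (16 * K)"]) (auto simp: a_def)
qed

end

end

end

section \<open>Almost sure lower bound for the hitting probability\<close>

context environment_law
begin

abbreviation root_prob :: "'w \<Rightarrow> nat \<Rightarrow> real" where
  "root_prob w n \<equiv> elliptic_environment.root_hit (\<omega> w) n"

text \<open>The \<open>b\<^sup>j\<close> vertices of generation \<open>j \<approx> n / J\<close> carry independent subtrees, so that a
  positive chance for each of them suffices; reaching that generation costs a factor
  \<open>(\<epsilon> / 2)\<^sup>j\<close> only.\<close>

lemma AE_root_hit_ge:
  assumes L: "0 < L" and r: "0 < r"
    and m: "1 < real CARD('b) ^ L * heavy_prob L r" and rm: "r * (real CARD('b) ^ L * heavy_prob L r) < 1"
    and \<delta>: "0 < \<delta>"
  defines "a \<equiv> r * (real CARD('b) ^ L * heavy_prob L r)"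
  shows "AE w in M. eventually (\<lambda>n. exp (real n * (ln a / real L - \<delta>)) \<le> root_prob w n) sequentially"
proof -
  have eps: "0 < \<epsilon>" "\<epsilon> \<le> 1" by (rule mu.eps_pos mu.eps_le_1)+
  define C where "C = (\<Sum>i<L. (1 / \<epsilon>) ^ Suc i)"
  have C: "0 < C" unfolding C_def using L eps by (intro sum_pos) auto
  have a: "0 < a" "a < 1"
    using r m rm unfolding a_def by (auto intro!: mult_pos_pos intro: less_trans[OF zero_less_one])
  obtain e c \<eta> where e: "0 < e" "e \<le> 1" and c: "0 < c" and \<eta>: "0 < \<eta>"
    and P: "\<And>k x. x \<noteq> [] \<Longrightarrow> \<eta> \<le> prob {w\<in>space M. c * a ^ k \<le> sparse_hit (\<omega> w) L r C e k x}"
  proof (rule sparse_hit_prob[OF r C m rm])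
    fix e c \<eta> :: real
    assume "0 < e" "e \<le> 1" "0 < c" "0 < \<eta>"
      "\<And>k x. x \<noteq> [] \<Longrightarrow> \<eta> \<le> prob {w\<in>space M. c * (r * (real CARD('b) ^ L * heavy_prob L r)) ^ k \<le> sparse_hit (\<omega> w) L r C e k x}"
    then show ?thesis by (intro that[of e c \<eta>]) (simp_all only: a_def)
  qed
  define K where "K = - ln (\<epsilon> / 2)"
  have K: "0 < K" using eps by (simp add: K_def)
  \<comment> \<open>\<open>K\<close> is the logarithmic cost per generation of a forced path; about
    \<open>n / J\<close> forced generations then cost at most
    \<open>n * \<delta> / 2\<close>.\<close>
  obtain J :: nat where J: "2 * K / \<delta> < real J" using reals_Archimedean2 by blast
  have J0: "0 < J" using J K \<delta> by (cases J) (auto simp: divide_less_0_iff)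
  \<comment> \<open>\<open>k n\<close> is the number of full blocks fitting into
    \<open>n - n div J\<close> generations. The rounding, less than \<open>L\<close> generations, is
    added to the forced part, so that \<open>n = \<kappa> n + k n * L\<close> exactly.\<close>
  define k where "k = (\<lambda>n. (n - n div J) div L)"
  define \<kappa> where "\<kappa> = (\<lambda>n. n - k n * L)"
  have kL: "k n * L \<le> n - n div J" for n unfolding k_def by simp
  have k_le: "k n * L \<le> n" for n using kL[of n] by simp
  have kn: "n = \<kappa> n + k n * L" "n div J \<le> \<kappa> n" for n
    using kL[of n] div_le_dividend[of n J] unfolding \<kappa>_def by linarith+
  have \<kappa>_le: "\<kappa> n \<le> n div J + L" for n
  proof -
    have "n - n div J = k n * L + (n - n div J) mod L" unfolding k_def by simp
    moreover have "(n - n div J) mod L < L" using L by simp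
    ultimately show ?thesis using div_le_dividend[of n J] unfolding \<kappa>_def by linarith
  qed
  let ?x = "[undefined] :: 'b list"
  let ?B = "\<lambda>n zs w. sparse_hit (\<omega> w) L r C e (k n) (zs @ ?x)"
  define F where "F = (\<lambda>n. \<Inter>zs\<in>words (\<kappa> n). ?B n zs -` {..<c * a ^ k n} \<inter> space M)"
  have ne: "(words j :: 'b list set) \<noteq> {}" for j
    using card_words[of j, where 'b = 'b] by (metis card.empty power_not_zero zero_less_card_finite less_numeral_extra(3))
  have B_meas [measurable]: "?B n zs \<in> borel_measurable M" for n zs
    by (rule local_events_measurable[OF measurable_local_sparse_hit])
  have F_sets: "F n \<in> events" for n
    unfolding F_def using ne by (intro sets.finite_INT) auto
  have PF: "prob (F n) \<le> exp \<eta> * exp (- \<eta> / real J) ^ n" for n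
  proof -
    have "indep_vars (\<lambda>_. borel) (\<lambda>zs. ?B n zs) (words (\<kappa> n))"
    proof (rule indep_vars_local[OF measurable_local_sparse_hit])
      show "descendants (zs @ ?x) \<subseteq> UNIV - {[]}" for zs
        by (rule descendants_not_root) simp
      show "disjoint_family_on (\<lambda>zs. descendants (zs @ ?x)) (words (\<kappa> n))"
        unfolding disjoint_family_on_def by (intro ballI impI descendants_disjoint) (auto simp: words_def)
    qed
    then have "prob (F n) = (\<Prod>zs\<in>words (\<kappa> n). prob (?B n zs -` {..<c * a ^ k n} \<inter> space M))"
      unfolding F_def using ne by (intro indep_varsD_finite) auto
    also have "\<dots> \<le> (\<Prod>zs\<in>(words (\<kappa> n) :: 'b list set). exp (- \<eta>))"
    proof (intro prod_mono conjI)
      fix zs :: "'b list"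
      have "prob (?B n zs -` {..<c * a ^ k n} \<inter> space M) =
          prob (space M - {w\<in>space M. c * a ^ k n \<le> ?B n zs w})"
        by (intro arg_cong[where f = prob]) auto
      also have "\<dots> = 1 - prob {w\<in>space M. c * a ^ k n \<le> ?B n zs w}"
        by (intro prob_compl) measurable
      also have "\<dots> \<le> 1 + - \<eta>" using P[of "zs @ ?x" "k n"] by simp
      also have "\<dots> \<le> exp (- \<eta>)" by (rule exp_ge_add_one_self)
      finally show "prob (?B n zs -` {..<c * a ^ k n} \<inter> space M) \<le> exp (- \<eta>)" .
    qed simp
    also have "\<dots> = exp (- \<eta>) ^ (CARD('b) ^ \<kappa> n)" by (simp add: card_words)
    also have "\<dots> \<le> exp (- \<eta>) ^ (n div J)"
    proof (rule power_decreasing)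
      \<comment> \<open>A wasteful bound on the number of independent subtrees, but it already makes
        the failure probability exponentially small in \<open>n\<close>.\<close>
      have "\<kappa> n \<le> CARD('b) ^ \<kappa> n"
        using branching by (intro less_imp_le power_gt_expt) auto
      then show "n div J \<le> CARD('b) ^ \<kappa> n" using kn(2)[of n] by linarith
    qed (use \<eta> in auto)
    also have "\<dots> = exp (- (\<eta> * real (n div J)))" by (simp flip: exp_of_nat_mult)
    also have "\<dots> \<le> exp (\<eta> * (1 - real n / real J))"
    proof -
      have "real n / real J - 1 \<le> real (n div J)"
      proof -
        have "n \<le> J + (n div J) * J" using dividend_less_div_times[OF J0, of n] by simp
        then have "real n \<le> real J + real (n div J) * real J" by (metis of_nat_add of_nat_le_iff of_nat_mult)
        then show ?thesis using J0 by (simp add: field_simps)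
      qed
      then have "\<eta> * (real n / real J - 1) \<le> \<eta> * real (n div J)" using \<eta> by (intro mult_left_mono) auto
      then show ?thesis by (simp add: algebra_simps)
    qed
    also have "\<dots> = exp \<eta> * exp (- \<eta> / real J) ^ n"
    proof -
      have "\<eta> * (1 - real n / real J) = \<eta> + real n * (- \<eta> / real J)"
        by (simp add: algebra_simps)
      then show ?thesis by (simp only: exp_add exp_of_nat_mult)
    qed
    finally show ?thesis .
  qed
  have "summable (\<lambda>n. exp \<eta> * exp (- \<eta> / real J) ^ n)"
    using \<eta> J0 by (intro summable_mult summable_geometric) auto
  then have "summable (\<lambda>n. prob (F n))"
  proof (rule summable_comparison_test'[where N = 0])
    show "norm (prob (F n)) \<le> exp \<eta> * exp (- \<eta> / real J) ^ n" for n
      using PF[of n] by (simp only: real_norm_def abs_of_nonneg[OF measure_nonneg])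
  qed
  then have BC: "AE w in M. eventually (\<lambda>n. w \<in> space M - F n) sequentially"
    by (intro borel_cantelli_AE1) (auto simp: F_sets emeasure_eq_measure)
  \<comment> \<open>Collects the factors independent of \<open>n\<close>: the step from the root,
    the constant of the sparse recursion and the rounding. The second half of
    \<open>\<delta>\<close> absorbs them.\<close>
  define b0 where "b0 = \<epsilon> * c * exp (- (K * real L))"
  have b0: "0 < b0" using eps c by (simp add: b0_def)
  have "eventually (\<lambda>n. - ln b0 / (\<delta> / 2) \<le> real n) sequentially"
    using filterlim_real_sequentially by (simp add: filterlim_at_top)
  then have large: "eventually (\<lambda>n. exp (- (real n * (\<delta> / 2))) \<le> b0) sequentially"
  proof eventually_elim
    case (elim n)
    then have "- (real n * (\<delta> / 2)) \<le> ln b0" using \<delta> by (simp add: field_simps)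
    then have "exp (- (real n * (\<delta> / 2))) \<le> exp (ln b0)" by simp
    then show ?case using b0 by simp
  qed
  show ?thesis
    using BC AE_elliptic AE_space
  proof eventually_elim
    case (elim w)
    interpret elliptic_environment "\<omega> w" \<epsilon> by fact
    from elim(1) large show ?case
    proof eventually_elim
      case (elim n)
      then have "\<exists>zs\<in>words (\<kappa> n). \<not> ?B n zs w < c * a ^ k n"
        using \<open>w \<in> space M\<close> unfolding F_def by blast
      then obtain zs :: "'b list" where zs: "zs \<in> words (\<kappa> n)" "c * a ^ k n \<le> ?B n zs w"
        by (auto simp only: not_less)
      have "c * a ^ k n \<le> hit (\<omega> w) (k n * L) (zs @ ?x)"
        using zs(2) sparse_hit_le_hit[of r e "zs @ ?x" L "k n"] r e unfolding C_def[symmetric] by simp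
      then have "\<epsilon> * ((\<epsilon> / 2) ^ \<kappa> n * (c * a ^ k n)) \<le> \<epsilon> * ((\<epsilon> / 2) ^ \<kappa> n * hit (\<omega> w) (k n * L) (zs @ ?x))"
        using eps by (intro mult_left_mono) auto
      also have "\<dots> \<le> root_prob w (\<kappa> n + k n * L)"
        using zs(1) by (intro root_hit_ge) (simp add: words_def)
      finally have ge: "\<epsilon> * c * ((\<epsilon> / 2) ^ \<kappa> n * a ^ k n) \<le> root_prob w n"
        using kn(1)[of n] by (simp add: mult_ac)
      have "exp (real n * (ln a / real L)) \<le> a ^ k n"
      proof -
        have "real (k n) * real L \<le> real n" using k_le[of n] by (metis of_nat_le_iff of_nat_mult)
        then have "real (k n) \<le> real n / real L" using L by (simp add: field_simps)
        then have "real n / real L * ln a \<le> real (k n) * ln a"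
          using a by (intro mult_right_mono_neg) auto
        moreover have "a ^ k n = exp (real (k n) * ln a)" using a by (simp add: exp_of_nat_mult)
        ultimately show ?thesis by simp
      qed
      moreover have "exp (- (K * real L)) * exp (- (real n * (\<delta> / 2))) \<le> (\<epsilon> / 2) ^ \<kappa> n"
      proof -
        have "real (\<kappa> n) \<le> real (n div J) + real L" using \<kappa>_le[of n] by linarith
        also have "real (n div J) \<le> real n / real J" by (rule of_nat_div_le_of_nat)
        finally have "K * real (\<kappa> n) \<le> K * (real n / real J + real L)"
          using K by (intro mult_left_mono) auto
        moreover have "K * (real n / real J) \<le> real n * (\<delta> / 2)"
        proof -
          have "K / real J \<le> \<delta> / 2" using J J0 \<delta> by (simp add: field_simps)
          then have "real n * (K / real J) \<le> real n * (\<delta> / 2)" by (intro mult_left_mono) auto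
          then show ?thesis by (simp add: mult_ac)
        qed
        ultimately have "- (K * real L) + - (real n * (\<delta> / 2)) \<le> - (K * real (\<kappa> n))"
          using distrib_left[of K "real n / real J" "real L"] by linarith
        moreover have "(\<epsilon> / 2) ^ \<kappa> n = exp (- (K * real (\<kappa> n)))"
          using eps unfolding K_def by (simp add: mult.commute exp_of_nat_mult)
        ultimately show ?thesis by (simp flip: exp_add)
      qed
      ultimately have "(exp (- (K * real L)) * exp (- (real n * (\<delta> / 2)))) * exp (real n * (ln a / real L)) \<le>
          (\<epsilon> / 2) ^ \<kappa> n * a ^ k n"
        using eps a by (intro mult_mono) auto
      then have "\<epsilon> * c * ((exp (- (K * real L)) * exp (- (real n * (\<delta> / 2)))) * exp (real n * (ln a / real L))) \<le>
          \<epsilon> * c * ((\<epsilon> / 2) ^ \<kappa> n * a ^ k n)"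
        using eps c by (intro mult_left_mono) auto
      with ge have "b0 * (exp (- (real n * (\<delta> / 2))) * exp (real n * (ln a / real L))) \<le> root_prob w n"
        unfolding b0_def by (simp add: mult_ac)
      moreover have "exp (- (real n * (\<delta> / 2))) * (exp (- (real n * (\<delta> / 2))) * exp (real n * (ln a / real L))) \<le>
          b0 * (exp (- (real n * (\<delta> / 2))) * exp (real n * (ln a / real L)))"
        using elim(2) by (intro mult_right_mono) auto
      moreover have "exp (- (real n * (\<delta> / 2))) * (exp (- (real n * (\<delta> / 2))) * exp (real n * (ln a / real L))) =
          exp (real n * (ln a / real L - \<delta>))"
        by (simp add: algebra_simps flip: exp_add)
      ultimately show ?case by linarith
    qed
  qed
qed

text \<open>By Cramer's bound a long block has about \<open>exp (L * offspring b t)\<close> paths of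
  weight about \<open>exp (L * tilted_mean \<mu> t)\<close>, and the product grows at
  \<open>rate b t\<close> per generation. The signs of \<open>offspring\<close> and
  \<open>rate\<close> supply the two hypotheses on \<open>heavy_prob\<close> in
  \<open>AE_root_hit_ge\<close>.\<close>

lemma AE_root_hit_rate:
  assumes t: "0 < t" "t \<le> 1" and off: "0 < mu.offspring CARD('b) t" and neg: "mu.rate CARD('b) t < 0"
    and \<delta>: "0 < \<delta>"
  shows "AE w in M. eventually (\<lambda>n. exp (real n * (mu.rate CARD('b) t - \<delta>)) \<le> root_prob w n) sequentially"
proof -
  define s where "s = tilted_mean \<mu> t"
  define off where "off = mu.offspring CARD('b) t"
  define \<rho> where "\<rho> = mu.rate CARD('b) t"
  \<comment> \<open>\<open>d \<le> off / 4\<close> preserves at least half of the offspring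
    exponent; \<open>d \<le> \<delta> / 8\<close> keeps the total loss \<open>d + t * d\<close>
    within \<open>\<delta> / 4\<close>.\<close>
  define d where "d = min (\<delta> / 8) (off / 4)"
  have d: "0 < d" "d \<le> \<delta> / 8" "d \<le> off / 4" using assms by (auto simp: d_def off_def)
  have b: "0 < real CARD('b)" by simp
  have td: "t * d \<le> d" using t d by (simp add: mult_left_le_one_le)
  have ev: "eventually (\<lambda>L. B \<le> real L) sequentially" for B :: real
    using filterlim_real_sequentially by (simp add: filterlim_at_top)
  \<comment> \<open>The lower bounds on \<open>L\<close> absorb the factor \<open>1 / 2\<close> of
    Cramer's bound, one in the growth rate and the other in the proof of
    \<open>1 < m\<close>.\<close>
  have "eventually (\<lambda>L. 0 < L \<and> exp (real L * (ln (moment \<mu> t) - t * (s + d))) / 2 \<le>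
      heavy_prob L (exp (real L * (s - d))) \<and> 4 * ln 2 / \<delta> \<le> real L \<and> (ln 2 + 1) / (off / 2) \<le> real L) sequentially"
    using heavy_prob_ge[OF t(1) d(1)] unfolding s_def
    by (intro eventually_conj eventually_gt_at_top ev)
  then obtain L where L: "0 < L" "4 * ln 2 / \<delta> \<le> real L" "(ln 2 + 1) / (off / 2) \<le> real L"
    and hp: "exp (real L * (ln (moment \<mu> t) - t * (s + d))) / 2 \<le> heavy_prob L (exp (real L * (s - d)))"
    by (auto dest: eventually_happens'[rotated])
  define r where "r = exp (real L * (s - d))"
  define m where "m = real CARD('b) ^ L * heavy_prob L r"
  have bL: "real CARD('b) ^ L = exp (real L * ln (real CARD('b)))"
    using b by (simp add: exp_of_nat_mult)
  have m_ge: "exp (real L * (off - t * d)) / 2 \<le> m"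
  proof -
    have "exp (real L * ln (real CARD('b))) * (exp (real L * (ln (moment \<mu> t) - t * (s + d))) / 2) \<le> m"
      unfolding m_def bL r_def by (intro mult_left_mono hp) auto
    moreover have "real L * ln (real CARD('b)) + real L * (ln (moment \<mu> t) - t * (s + d)) = real L * (off - t * d)"
      by (simp add: off_def mu.offspring_def s_def algebra_simps)
    ultimately show ?thesis by (simp flip: exp_add)
  qed
  have m1: "1 < m"
  proof -
    have "ln 2 + 1 \<le> real L * (off / 2)"
      using L(3) off by (simp add: off_def[symmetric] pos_divide_le_eq)
    also have "\<dots> \<le> real L * (off - t * d)"
    proof (rule mult_left_mono)
      show "off / 2 \<le> off - t * d" using d td by linarith
    qed simp
    finally have "ln 2 < real L * (off - t * d)" by simp
    then have "exp (ln 2) < exp (real L * (off - t * d))" by (simp only: exp_less_cancel_iff)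
    then show ?thesis using m_ge by simp
  qed
  \<comment> \<open>Chernoff's bound at the same exponent \<open>t\<close> gives at most
    \<open>exp (L * (\<rho> - (1 - t) * d))\<close>, and \<open>\<rho>\<close> is negative.\<close>
  have rm1: "r * m < 1"
  proof -
    have "r * m \<le> r * (real CARD('b) ^ L * (moment \<mu> t ^ L / r powr t))"
      unfolding m_def using t by (intro mult_left_mono heavy_prob_le) (auto simp: r_def)
    also have "moment \<mu> t ^ L = exp (real L * ln (moment \<mu> t))"
      using mu.moment_pos[of t] by (simp add: exp_of_nat_mult)
    also have "r * (real CARD('b) ^ L * (exp (real L * ln (moment \<mu> t)) / r powr t)) = exp (real L * (\<rho> - (1 - t) * d))"
      unfolding bL r_def powr_def \<rho>_def mu.rate_def s_def
      by (simp add: algebra_simps flip: exp_add exp_diff)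
    also have "\<dots> < 1"
    proof -
      have "\<rho> - (1 - t) * d < 0" using neg t d unfolding \<rho>_def by (smt (verit) mult_nonneg_nonneg)
      then show ?thesis using L(1) by (simp add: mult_less_0_iff)
    qed
    finally show ?thesis .
  qed
  have "\<rho> - \<delta> \<le> ln (r * m) / real L - \<delta> / 2"
  proof -
    have "r * (exp (real L * (off - t * d)) / 2) \<le> r * m"
      using m_ge by (intro mult_left_mono) (auto simp: r_def)
    then have "ln (r * (exp (real L * (off - t * d)) / 2)) \<le> ln (r * m)"
      using m1 by (subst ln_le_cancel_iff) (auto simp: r_def)
    moreover have "ln (r * (exp (real L * (off - t * d)) / 2)) = real L * (s - d) + real L * (off - t * d) - ln 2"
      by (simp add: r_def ln_mult ln_div)
    moreover have "real L * (s - d) + real L * (off - t * d) = real L * (\<rho> - d - t * d)"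
      by (simp add: \<rho>_def off_def mu.rate_eq s_def algebra_simps)
    ultimately have "real L * (\<rho> - d - t * d) - ln 2 \<le> ln (r * m)" by simp
    moreover have "ln 2 \<le> real L * (\<delta> / 4)" using L(2) \<delta> by (simp add: field_simps)
    moreover have "real L * (\<rho> - \<delta> / 2) \<le> real L * (\<rho> - d - t * d - \<delta> / 4)"
    proof (rule mult_left_mono)
      show "\<rho> - \<delta> / 2 \<le> \<rho> - d - t * d - \<delta> / 4" using d td by linarith
    qed simp
    ultimately have "real L * (\<rho> - \<delta> / 2) \<le> ln (r * m)"
      by (simp add: algebra_simps)
    then have "\<rho> - \<delta> / 2 \<le> ln (r * m) / real L"
      using L(1) by (simp add: field_simps)
    then show ?thesis by simp
  qed
  then have le: "exp (real n * (\<rho> - \<delta>)) \<le> exp (real n * (ln (r * m) / real L - \<delta> / 2))" for n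
    by (auto intro!: mult_left_mono)
  have "AE w in M. eventually (\<lambda>n. exp (real n * (ln (r * m) / real L - \<delta> / 2)) \<le> root_prob w n) sequentially"
    using AE_root_hit_ge[OF L(1) _ m1[unfolded m_def] rm1[unfolded m_def], of "\<delta> / 2"] \<delta>
    by (simp add: m_def r_def)
  then show ?thesis
    unfolding \<rho>_def[symmetric]
    by eventually_elim (auto elim!: eventually_mono intro: order_trans[OF le])
qed

end

section \<open>The maximal displacement\<close>

text \<open>The hypotheses control \<open>l\<close> along exponential time scales only. Rounding
  \<open>ln N / d\<close> to an integer and the shift in \<open>n + 2\<close> cost a constant, which
  disappears after division by \<open>ln N\<close>. The tolerances \<open>\<kappa> / (j + 2)\<close>
  tend to 0 and stay below \<open>\<kappa>\<close>.\<close>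

lemma speed_interpolation:
  fixes l :: "nat \<Rightarrow> nat" and \<kappa> :: real
  assumes \<kappa>: "0 < \<kappa>"
    and slow: "\<And>j::nat. eventually (\<lambda>n. \<forall>k\<le>nat \<lfloor>exp (real n * (\<kappa> - \<kappa> / real (j + 2)))\<rfloor>. l k < n + 2) sequentially"
    and fast: "\<And>j::nat. eventually (\<lambda>n. \<exists>k\<le>nat \<lceil>exp (real n * (\<kappa> + \<kappa> / real (j + 2)))\<rceil>. n < l k) sequentially"
  shows "(\<lambda>n. 1 / ln (real n) * real (Max (l ` {0..n}))) \<longlonglongrightarrow> 1 / \<kappa>"
proof -
  have ln_large: "eventually (\<lambda>N. B < ln (real N)) sequentially" for B
    using filterlim_compose[OF ln_at_top filterlim_real_sequentially] by (simp add: filterlim_at_top_dense)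
  have shrink: "(\<lambda>j. \<kappa> / real (j + 2)) \<longlonglongrightarrow> 0"
    by (rule LIMSEQ_ignore_initial_segment[where f = "\<lambda>j. \<kappa> / real j"]) (rule lim_const_over_n)
  have small: "\<kappa> / real (j + 2) < \<kappa>" "0 < \<kappa> / real (j + 2)" for j
    using \<kappa> divide_strict_left_mono[of 1 "real (j + 2)" \<kappa>] by simp_all
  show ?thesis
  proof (rule order_tendstoI)
    fix y assume y: "1 / \<kappa> < y"
    have "(\<lambda>j. 1 / (\<kappa> - \<kappa> / real (j + 2))) \<longlonglongrightarrow> 1 / (\<kappa> - 0)"
      using \<kappa> by (intro tendsto_intros shrink) auto
    then have "eventually (\<lambda>j. 1 / (\<kappa> - \<kappa> / real (j + 2)) < y) sequentially"
      using y by (intro order_tendstoD) auto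
    then obtain j where j: "1 / (\<kappa> - \<kappa> / real (j + 2)) < y"
      by (auto dest: eventually_happens'[rotated])
    define d where "d = \<kappa> - \<kappa> / real (j + 2)"
    have d: "0 < d" using small[of j] by (simp add: d_def)
    obtain n0 where n0: "\<And>n. n0 \<le> n \<Longrightarrow> \<forall>k\<le>nat \<lfloor>exp (real n * d)\<rfloor>. l k < n + 2"
      using slow[of j] unfolding eventually_sequentially d_def by blast
    \<comment> \<open>The threshold ensures \<open>n0 \<le> n\<close> and that the constant 2, from
      rounding up and from the shift, is below the slack \<open>ln N * (y - 1 / d)\<close>.\<close>
    have "eventually (\<lambda>N. max (max 0 (real n0 * d)) (2 / (y - 1 / d)) < ln (real N)) sequentially"
      by (rule ln_large)
    then show "eventually (\<lambda>N. 1 / ln (real N) * real (Max (l ` {0..N})) < y) sequentially"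
    proof eventually_elim
      case (elim N)
      then have lnN: "0 < ln (real N)" "real n0 * d < ln (real N)" "2 / (y - 1 / d) < ln (real N)" by auto
      then have N: "0 < real N" by (cases N) auto
      define n where "n = nat \<lceil>ln (real N) / d\<rceil>"
      have n: "ln (real N) / d \<le> real n" "real n \<le> ln (real N) / d + 1"
        using lnN d unfolding n_def by (auto simp: of_nat_ceiling real_nat_ceiling_ge)
      have "real n0 < ln (real N) / d" using lnN d by (simp add: field_simps)
      then have "n0 \<le> n" using n(1) by linarith
      have "ln (real N) \<le> real n * d" using n(1) d by (simp add: field_simps)
      then have "real N \<le> exp (real n * d)" using N by (metis exp_le_cancel_iff exp_ln)
      then have "N \<le> nat \<lfloor>exp (real n * d)\<rfloor>" by (simp add: le_nat_floor)
      then have "l k < n + 2" if "k \<le> N" for k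
        using n0[OF \<open>n0 \<le> n\<close>] that by (meson order_trans)
      then have "Max (l ` {0..N}) < n + 2" by (subst Max_less_iff) auto
      then have "real (Max (l ` {0..N})) \<le> real n + 1" by linarith
      also have "\<dots> \<le> ln (real N) / d + 2" using n(2) by simp
      also have "\<dots> < ln (real N) * y"
      proof -
        have "0 < y - 1 / d" using j by (simp add: d_def)
        then have "2 < ln (real N) * (y - 1 / d)" using lnN(3) by (simp add: field_simps)
        then show ?thesis by (simp add: algebra_simps)
      qed
      finally show ?case using lnN(1) by (simp add: field_simps)
    qed
  next
    fix y assume y: "y < 1 / \<kappa>"
    have "(\<lambda>j. 1 / (\<kappa> + \<kappa> / real (j + 2))) \<longlonglongrightarrow> 1 / (\<kappa> + 0)"
      using \<kappa> by (intro tendsto_intros shrink) auto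
    then have "eventually (\<lambda>j. y < 1 / (\<kappa> + \<kappa> / real (j + 2))) sequentially"
      using y by (intro order_tendstoD) auto
    then obtain j where j: "y < 1 / (\<kappa> + \<kappa> / real (j + 2))"
      by (auto dest: eventually_happens'[rotated])
    define d where "d = \<kappa> + \<kappa> / real (j + 2)"
    have d: "0 < d" using small[of j] \<kappa> unfolding d_def by linarith
    obtain n0 where n0: "\<And>n. n0 \<le> n \<Longrightarrow> \<exists>k\<le>nat \<lceil>exp (real n * d)\<rceil>. n < l k"
      using fast[of j] unfolding eventually_sequentially d_def by blast
    have "eventually (\<lambda>N. max 0 (real (Suc n0) * d) < ln (real N)) sequentially"
      by (rule ln_large)
    then show "eventually (\<lambda>N. y < 1 / ln (real N) * real (Max (l ` {0..N}))) sequentially"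
    proof eventually_elim
      case (elim N)
      then have lnN: "0 < ln (real N)" "real (Suc n0) * d < ln (real N)" by auto
      then have N: "0 < real N" by (cases N) auto
      define n where "n = nat \<lfloor>ln (real N) / d\<rfloor>"
      have n: "real n \<le> ln (real N) / d" "ln (real N) / d < real n + 1"
        using lnN d unfolding n_def by (auto simp: of_nat_floor)
      have "real (Suc n0) < ln (real N) / d" using lnN d by (simp add: field_simps)
      then have "n0 \<le> n" using n(2) by linarith
      have "real n * d \<le> ln (real N)" using n(1) d by (simp add: field_simps)
      then have "exp (real n * d) \<le> real N" using N by (metis exp_le_cancel_iff exp_ln)
      then have "nat \<lceil>exp (real n * d)\<rceil> \<le> N" by (simp add: nat_le_iff ceiling_le_iff)
      then obtain k where "k \<le> N" "n < l k"
        using n0[OF \<open>n0 \<le> n\<close>] by (meson order_trans)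
      then have "n < Max (l ` {0..N})"
        by (subst Max_gr_iff) auto
      then have "ln (real N) / d \<le> real (Max (l ` {0..N}))" using n(2) by linarith
      moreover have "ln (real N) * y < ln (real N) / d"
        using j lnN(1) mult_strict_left_mono[of y "1 / d" "ln (real N)"] by (simp add: d_def)
      ultimately have "ln (real N) * y < real (Max (l ` {0..N}))" by linarith
      then show ?case using lnN(1) by (simp add: field_simps)
    qed
  qed
qed

section \<open>From quenched estimates to annealed almost sure bounds\<close>

lemma AE_eventually_path:
  assumes Q: "prob_space Q" "sets Q = sets path_space"
    and A: "\<And>n. A n \<in> sets path_space"
    and B: "eventually (\<lambda>n. measure Q (A n) \<le> B * exp (- d) ^ n) sequentially" "0 < d"
  shows "AE X in Q. eventually (\<lambda>n. X \<notin> A n) sequentially"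
proof -
  interpret Q: prob_space Q by fact
  have "summable (\<lambda>n. B * exp (- d) ^ n)"
    using B(2) by (intro summable_mult summable_geometric) auto
  then have "summable (\<lambda>n. measure Q (A n))"
    by (rule summable_comparison_test_ev[rotated]) (use B(1) in \<open>auto elim!: eventually_mono\<close>)
  then have "AE X in Q. eventually (\<lambda>n. X \<in> space Q - A n) sequentially"
    using A Q(2) by (intro borel_cantelli_AE1) (auto simp: Q.emeasure_eq_measure)
  then show ?thesis
    by eventually_elim (auto elim!: eventually_mono)
qed

lemma sets_path_eventually:
  assumes "\<And>n. A n \<in> sets path_space"
  shows "{X. eventually (\<lambda>n. X \<notin> A n) sequentially} \<in> sets path_space"
proof -
  have "{X. eventually (\<lambda>n. X \<notin> A n) sequentially} = (\<Union>m. \<Inter>n\<in>{m..}. space path_space - A n)"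
    by (auto simp: eventually_sequentially)
  also have "\<dots> \<in> sets path_space"
    using assms sets.top[of path_space]
    by (intro sets.countable_UN'' sets.countable_INT'' sets.compl_sets) auto
  finally show ?thesis .
qed

context environment_law
begin

lemma AE_annealed:
  assumes "\<And>n. A n \<in> sets path_space"
    and "AE w in M. AE X in quenched_law (\<omega> w). eventually (\<lambda>n. X \<notin> A n) sequentially"
  shows "AE X in annealed_law M \<omega>. eventually (\<lambda>n. X \<notin> A n) sequentially"
  unfolding annealed_law_def
  by (subst AE_bind[OF measurable_prob_algebraD[OF quenched_law_measurable]])
    (use assms sets_path_eventually[of A] in \<open>auto simp: pred_def\<close>)

lemma sets_leave_ball: "{X :: nat \<Rightarrow> 'b list. \<not> (\<forall>k\<le>N. X k \<in> tree_ball n)} \<in> sets path_space"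
proof -
  have "{X :: nat \<Rightarrow> 'b list. \<not> (\<forall>k\<le>N. X k \<in> tree_ball n)} = space path_space - {X. \<forall>k\<le>N. X k \<in> tree_ball n}"
    by auto
  then show ?thesis by (simp only:) (intro sets.compl_sets sets_path_stay)
qed

context
  fixes t \<kappa> :: real
  assumes t: "0 < t" "t \<le> 1" and \<kappa>: "0 < \<kappa>"
    and pressure: "(ln (real CARD('b)) + ln (moment \<mu> t)) / t = - \<kappa>"
begin

lemma AE_level_sums:
  assumes "0 < \<delta>"
  shows "AE w in M. eventually (\<lambda>n. (\<Sum>i\<in>UNIV. level_sum (\<omega> w) n [i]) \<le>
    real CARD('b) * exp (real n * (\<delta> - \<kappa>))) sequentially"
proof -
  have "AE w in M. \<forall>i\<in>(UNIV :: 'b set). eventually (\<lambda>n. level_sum (\<omega> w) n [i] < exp (real n * (\<delta> - \<kappa>))) sequentially"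
    using AE_level_sum[OF _ t assms] unfolding pressure by (subst AE_finite_all) (auto simp: add.commute)
  then show ?thesis
  proof eventually_elim
    case (elim w)
    then have "eventually (\<lambda>n. \<forall>i\<in>(UNIV :: 'b set). level_sum (\<omega> w) n [i] < exp (real n * (\<delta> - \<kappa>))) sequentially"
      by (subst eventually_ball_finite_distrib) auto
    then show ?case
    proof eventually_elim
      case (elim n)
      then have "(\<Sum>i\<in>UNIV. level_sum (\<omega> w) n [i]) \<le> (\<Sum>i\<in>(UNIV :: 'b set). exp (real n * (\<delta> - \<kappa>)))"
        by (intro sum_mono) (auto intro: less_imp_le)
      then show ?case by simp
    qed
  qed
qed

text \<open>Each step leaves the ball with probability at most of order
  \<open>exp (n * (\<delta> / 2 - \<kappa>))\<close>; over
  \<open>exp (n * (\<kappa> - \<delta>))\<close> steps this adds up to order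
  \<open>exp (- n * \<delta> / 2)\<close>, which is summable.\<close>

lemma AE_slow:
  assumes \<delta>: "0 < \<delta>"
  shows "AE X in annealed_law M \<omega>.
    eventually (\<lambda>n. \<forall>k\<le>nat \<lfloor>exp (real n * (\<kappa> - \<delta>))\<rfloor>. length (X k) < n + 2) sequentially"
proof -
  let ?N = "\<lambda>n. nat \<lfloor>exp (real n * (\<kappa> - \<delta>))\<rfloor>"
  let ?A = "\<lambda>n. {X. \<not> (\<forall>k\<le>?N n. X k \<in> tree_ball (Suc (Suc n)))}"
  have "AE w in M. AE X in quenched_law (\<omega> w). eventually (\<lambda>n. X \<notin> ?A n) sequentially"
    using AE_level_sums[OF half_gt_zero[OF \<delta>]] AE_elliptic AE_space
  proof eventually_elim
    case (elim w)
    interpret elliptic_environment "\<omega> w" \<epsilon> by (rule elim)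
    interpret Q: prob_space "quenched_law (\<omega> w)" by (rule prob_space_quenched_law)
    show ?case
    proof (rule AE_eventually_path[where B = "real CARD('b) / \<epsilon>" and d = "\<delta> / 2"])
      from elim(1) show "eventually (\<lambda>n. measure (quenched_law (\<omega> w)) (?A n) \<le>
          real CARD('b) / \<epsilon> * exp (- (\<delta> / 2)) ^ n) sequentially"
      proof eventually_elim
        case (elim n)
        have "?A n = space (quenched_law (\<omega> w)) - {X. \<forall>k\<le>?N n. X k \<in> tree_ball (Suc (Suc n))}"
          by (auto simp: sets_eq_imp_space_eq[OF quenched_law_cylinder(2)])
        then have "measure (quenched_law (\<omega> w)) (?A n) = 1 - survival (Suc (Suc n)) (?N n) []"
          using \<open>w \<in> space M\<close>
          by (simp only: Q.prob_compl sets_path_stay quenched_law_cylinder(2))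
            (subst prob_stay, auto simp: tree_ball_def[of "Suc (Suc n)"] simp del: finite_tree_ball intro: finite_tree_ball[of "Suc (Suc n)", unfolded tree_ball_def])
        also have "\<dots> \<le> real (?N n) * ((\<Sum>i\<in>UNIV. level_sum (\<omega> w) n [i]) / \<epsilon>)"
          by (rule escape_le)
        also have "\<dots> \<le> exp (real n * (\<kappa> - \<delta>)) * (real CARD('b) * exp (real n * (\<delta> / 2 - \<kappa>)) / \<epsilon>)"
          using elim eps_pos level_sum_nonneg
          by (intro mult_mono divide_right_mono) (auto intro!: sum_nonneg divide_nonneg_pos of_nat_floor)
        also have "\<dots> = real CARD('b) / \<epsilon> * exp (- (\<delta> / 2)) ^ n"
          by (simp add: algebra_simps flip: exp_of_nat_mult exp_add)
        finally show ?case .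
      qed
    qed (use \<delta> in \<open>auto simp: prob_space_quenched_law quenched_law_cylinder(2) sets_leave_ball[simplified]\<close>)
  qed
  then have "AE X in annealed_law M \<omega>. eventually (\<lambda>n. X \<notin> ?A n) sequentially"
    by (intro AE_annealed sets_leave_ball)
  then show ?thesis by (simp add: tree_ball_def)
qed

text \<open>In \<open>survival_le\<close> the numerator stays bounded and the denominator is at
  least \<open>exp (- n * (\<kappa> + \<delta> / 2))\<close>; after
  \<open>exp (n * (\<kappa> + \<delta>))\<close> steps the chance of staying is of order
  \<open>exp (- n * \<delta> / 2)\<close>.\<close>

lemma AE_fast:
  assumes root: "\<And>\<delta>. 0 < \<delta> \<Longrightarrow>
      AE w in M. eventually (\<lambda>n. exp (- (real n * (\<kappa> + \<delta>))) \<le> root_prob w n) sequentially"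
    and \<delta>: "0 < \<delta>"
  shows "AE X in annealed_law M \<omega>.
    eventually (\<lambda>n. \<exists>k\<le>nat \<lceil>exp (real n * (\<kappa> + \<delta>))\<rceil>. n < length (X k)) sequentially"
proof -
  let ?N = "\<lambda>n. nat \<lceil>exp (real n * (\<kappa> + \<delta>))\<rceil>"
  let ?A = "\<lambda>n. {X. \<forall>k\<le>?N n. X k \<in> tree_ball (Suc n)}"
  have half: "0 < \<delta> / 2" "0 < \<kappa> / 2" using \<delta> \<kappa> by auto
  have "AE w in M. AE X in quenched_law (\<omega> w). eventually (\<lambda>n. X \<notin> ?A n) sequentially"
    using AE_level_sums[OF half(2)] root[OF half(1)] AE_elliptic AE_space
  proof eventually_elim
    case (elim w)
    interpret elliptic_environment "\<omega> w" \<epsilon> by (rule elim)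
    let ?s = "\<lambda>n. \<Sum>i\<in>UNIV. level_sum (\<omega> w) n [i]"
    have s0: "0 \<le> ?s n" for n using level_sum_nonneg by (intro sum_nonneg) auto
    have "summable (\<lambda>n. real CARD('b) * exp (- (\<kappa> / 2)) ^ n)"
      using half by (intro summable_mult summable_geometric) auto
    moreover have "eventually (\<lambda>n. norm (?s n) \<le> real CARD('b) * exp (- (\<kappa> / 2)) ^ n) sequentially"
      using elim(1) s0 by (auto elim!: eventually_mono simp flip: exp_of_nat_mult)
    ultimately have "summable ?s"
      by (rule summable_comparison_test_ev[rotated])
    then have s_le: "(\<Sum>k<n. ?s k) \<le> suminf ?s" for n
      using s0 by (intro sum_le_suminf) auto
    \<comment> \<open>A bound on the mean excursion length, finite for this realisation and uniform
      in \<open>n\<close>; the level sums are summable because \<open>\<kappa> > 0\<close>.\<close>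
    define R where "R = 1 + suminf ?s / \<epsilon>"
    have R: "root_return n \<le> R" for n
    proof -
      have "root_return n \<le> 1 + (\<Sum>k<n. ?s k) / \<epsilon>"
        using root_return_le[of n] by (simp add: sum.swap[of _ UNIV])
      also have "\<dots> \<le> R"
        unfolding R_def using s_le eps_pos by (intro add_left_mono divide_right_mono) auto
      finally show ?thesis .
    qed
    show ?case
    proof (rule AE_eventually_path[where B = R and d = "\<delta> / 2"])
      from elim(2) show "eventually (\<lambda>n. measure (quenched_law (\<omega> w)) (?A n) \<le> R * exp (- (\<delta> / 2)) ^ n) sequentially"
      proof eventually_elim
        case (elim n)
        let ?h = "exp (- (real n * (\<kappa> + \<delta> / 2)))" and ?e = "exp (real n * (\<kappa> + \<delta>))"
        have h: "?h \<le> elliptic_environment.root_hit (\<omega> w) n" using elim .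
        have "measure (quenched_law (\<omega> w)) (?A n) = survival (Suc n) (?N n) []"
          using \<open>w \<in> space M\<close> finite_tree_ball by (intro prob_stay) (auto simp: tree_ball_def)
        moreover have "?e * survival (Suc n) (?N n) [] \<le> R / ?h"
        proof -
          have "0 \<le> survival (Suc n) (?N n) []"
            using \<open>measure (quenched_law (\<omega> w)) (?A n) = survival (Suc n) (?N n) []\<close>[symmetric] by simp
          moreover have "?e \<le> real (Suc (?N n))"
            using real_nat_ceiling_ge[of ?e] by linarith
          ultimately have "?e * survival (Suc n) (?N n) [] \<le> real (Suc (?N n)) * survival (Suc n) (?N n) []"
            by (intro mult_right_mono)
          also have "\<dots> \<le> root_return n / elliptic_environment.root_hit (\<omega> w) n"
            by (rule survival_le)
          also have "\<dots> \<le> R / ?h"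
            using R[of n] h root_return_ge_1[of n] by (intro frac_le) auto
          finally show ?thesis .
        qed
        ultimately have "measure (quenched_law (\<omega> w)) (?A n) \<le> R / ?h / ?e"
          by (simp add: field_simps)
        also have "\<dots> = R * exp (- (\<delta> / 2)) ^ n"
          by (simp add: exp_minus field_simps flip: exp_of_nat_mult exp_add)
        finally show ?case .
      qed
    qed (use \<delta> in \<open>auto simp: prob_space_quenched_law quenched_law_cylinder(2) sets_path_stay\<close>)
  qed
  then have "AE X in annealed_law M \<omega>. eventually (\<lambda>n. X \<notin> ?A n) sequentially"
    by (intro AE_annealed sets_path_stay)
  then show ?thesis by (simp add: tree_ball_def not_less Suc_le_eq)
qed

end

end

theorem theorem1p1:
  fixes M :: "'w measure"
    and \<omega> :: "'w \<Rightarrow> 'b::finite list \<Rightarrow> 'b list \<Rightarrow> real"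
    and \<mu> :: "real measure"
  assumes env: "random_environment M \<omega>"
    and law_A: "\<And>x. length x \<ge> 2 \<Longrightarrow> distr M borel (\<lambda>w. A_ratio (\<omega> w) x) = \<mu>"
    and p_lt: "p_const \<mu> < 1 / real CARD('b)"
  shows "0 < q_const \<mu> CARD('b) \<and> q_const \<mu> CARD('b) < 1 / real CARD('b) \<and>
    (AE X in annealed_law M \<omega>.
       (\<lambda>n. 1 / ln (real n) * real (Max ((\<lambda>i. length (X i)) ` {0..n})))
         \<longlonglongrightarrow> 1 / ln (1 / (q_const \<mu> CARD('b) * real CARD('b))))"
proof -
  interpret random_environment M \<omega> by (rule env)
  obtain \<epsilon> where \<epsilon>: "0 < \<epsilon>" and ell: "AE w in M. \<forall>x y.
      (tree_adj x y \<longrightarrow> \<epsilon> \<le> \<omega> w x y) \<and> (\<not> tree_adj x y \<longrightarrow> \<omega> w x y = 0)"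
    using omega_elliptic by blast
  interpret environment_law M \<omega> \<mu> \<epsilon>
  proof
    show "AE w in M. elliptic_environment (\<omega> w) \<epsilon>"
      using ell AE_space by eventually_elim (auto intro!: elliptic_environment.intro simp: \<epsilon> omega_sum)
  qed (rule law_A)
  let ?b = "CARD('b)"
  have b: "0 < real ?b" by simp
  obtain t where t: "0 < t" "t \<le> 1" "\<And>u. 0 \<le> u \<Longrightarrow> u < t \<Longrightarrow> 0 < mu.offspring ?b u"
    "t = 1 \<or> mu.offspring ?b t = 0"
    by (rule mu.critical_exponent[OF branching]) blast
  note crit = mu.q_const_critical[OF branching p_lt t]
  let ?\<kappa> = "- mu.rate ?b t"
  have q: "q_const \<mu> ?b = exp (mu.rate ?b t) / real ?b"
    using crit(1) by (simp add: field_simps)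
  \<comment> \<open>At \<open>t\<close> itself \<open>offspring\<close> may be 0, so the lower bound
    is taken at some \<open>u < t\<close> with negative rate; continuity of \<open>rate\<close>
    limits the loss to \<open>\<delta> / 2\<close>.\<close>
  have "AE w in M. eventually (\<lambda>n. exp (- (real n * (?\<kappa> + \<delta>))) \<le> root_prob w n) sequentially"
    if \<delta>: "0 < \<delta>" for \<delta>
  proof -
    have "(mu.rate ?b \<longlongrightarrow> mu.rate ?b t) (at_left t)"
      using mu.continuous_rate[of ?b] by (simp add: continuous_on_eq_continuous_at isCont_def filterlim_at_split)
    then have "eventually (\<lambda>u. mu.rate ?b t - \<delta> / 2 < mu.rate ?b u) (at_left t)"
      "eventually (\<lambda>u. mu.rate ?b u < 0) (at_left t)"
      using \<delta> crit(2) by (auto intro: order_tendstoD)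
    then have "eventually (\<lambda>u. u \<in> {0<..<t} \<and> mu.rate ?b t - \<delta> / 2 < mu.rate ?b u \<and> mu.rate ?b u < 0) (at_left t)"
      using eventually_at_left_real[OF t(1)] by eventually_elim simp
    then obtain u where u: "0 < u" "u < t" "mu.rate ?b t - \<delta> / 2 < mu.rate ?b u" "mu.rate ?b u < 0"
      by (auto dest!: eventually_happens)
    have root: "AE w in M. eventually (\<lambda>n. exp (real n * (mu.rate ?b u - \<delta> / 2)) \<le> root_prob w n) sequentially"
      using u t \<delta> by (intro AE_root_hit_rate) auto
    have le: "exp (- (real n * (?\<kappa> + \<delta>))) \<le> exp (real n * (mu.rate ?b u - \<delta> / 2))" for n
    proof -
      have "real n * (mu.rate ?b t - \<delta>) \<le> real n * (mu.rate ?b u - \<delta> / 2)"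
        using u by (intro mult_left_mono) auto
      then show ?thesis by (simp add: algebra_simps)
    qed
    from root show ?thesis
    proof eventually_elim
      case (elim w)
      then show ?case by (rule eventually_mono) (rule order_trans[OF le])
    qed
  qed
  note root = this
  have \<kappa>: "0 < ?\<kappa>" "(ln (real ?b) + ln (moment \<mu> t)) / t = - ?\<kappa>"
    using crit(2,3) by auto
  note fast = AE_fast[OF t(1,2) \<kappa> root]
  note slow = AE_slow[OF t(1,2) \<kappa>]
  \<comment> \<open>The exceptional null set depends on the tolerance, so only countably many
    tolerances are used.\<close>
  have "AE X in annealed_law M \<omega>. \<forall>j::nat.
      eventually (\<lambda>n. \<forall>k\<le>nat \<lfloor>exp (real n * (?\<kappa> - ?\<kappa> / real (j + 2)))\<rfloor>. length (X k) < n + 2) sequentially"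
    unfolding AE_all_countable using crit(2) by (intro allI slow divide_pos_pos) auto
  moreover have "AE X in annealed_law M \<omega>. \<forall>j::nat.
      eventually (\<lambda>n. \<exists>k\<le>nat \<lceil>exp (real n * (?\<kappa> + ?\<kappa> / real (j + 2)))\<rceil>. n < length (X k)) sequentially"
    unfolding AE_all_countable using crit(2) by (intro allI fast divide_pos_pos) auto
  ultimately have "AE X in annealed_law M \<omega>.
      (\<lambda>n. 1 / ln (real n) * real (Max ((\<lambda>i. length (X i)) ` {0..n}))) \<longlonglongrightarrow> 1 / ?\<kappa>"
  proof eventually_elim
    case (elim X)
    then show ?case
      using crit(2) by (intro speed_interpolation) auto
  qed
  moreover have "ln (1 / exp y) = - y" for y :: real
    by (simp add: ln_div)
  then have "ln (1 / (q_const \<mu> ?b * real ?b)) = ?\<kappa>"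
    by (simp only: crit(1))
  moreover have "0 < q_const \<mu> ?b" "q_const \<mu> ?b < 1 / real ?b"
    using crit(2) b unfolding q by (auto simp: divide_strict_right_mono)
  ultimately show ?thesis by simp
qed

end
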